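(* Let $j^{*}:G_{1}\rightarrow\pi_{1}(HA,(0,0))$ be the epimorphism induced by the inclusion $j:Y_{1}\hookrightarrow HA$, and let $K=\ker j^{*}$. Then $(w_{1},w_{2},\dots)\in K$ if and only if there exists $N$ such that the following holds: for each $n\geq N$, if each occurrence of $x_{i}$ in $w_{n}$, for each $i\leq N$, is replaced by $x_{N}$, creating a (non-reduced) word $v_{n}$ on the letters $\{x_{N},x_{N+1},\dots,x_{n}\}$, then $v_{n}$ reduces to the trivial element of $F_{N,n}$.
   Context: For $n\geq1$ let $X_{n}\subset\mathbb{R}^{2}$ be the circle of radius $\frac1n$ centered at $(\frac1n,0)$, $Y_{n}=\bigcup_{i\geq n}X_{i}$; $Y_1$ is the Hawaiian earring. Let $A_{n}\subset\mathbb{R}^2$ be the closed pinched annulus bounded by $X_{n}\cup X_{n+1}$ and $Y^{n}=Y_{1}\cup A_{1}\cup\dots\cup A_{n}$ with the Euclidean subspace topology. The harmonic archipelago $HA$ has underlying set $\bigcup_{n}Y^{n}$, with a topology such that each $Y^{n}$ inherits its usual topology and: (1) there is a sequence $z_{n}\in\operatorname{int}(A_{n})$ such that $\{z_{1},z_{2},\dots\}$ has no subsequential limit, and (2) if $p\in HA$ is a subsequential limit of a sequence $(y_n)$ with $y_{n}\in\operatorname{int}(A_{n})$ for all $n$, then $p=(0,0)$. Let $x_i$ denote the loop going once around $X_i$ from $(0,0)$. For $n\ge N$, $F_{N,n}$ is the free group on $x_N,\dots,x_n$, and $\phi_{N,n}:F_{N,n+1}\to F_{N,n}$ fixes $x_i$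 ($N\le i\le n$) and kills $x_{n+1}$. The retractions $r_{1,n}:Y_1\to X_1\cup\dots\cup X_n$ collapsing $X_i$ ($i>n$) to $(0,0)$ induce an injective homomorphism $\psi_1:\pi_1(Y_1,(0,0))\to\varprojlim F_{1,n}$; elements of the inverse limit are written as canonical sequences $(w_1,w_2,\dots)$ with $w_n\in F_{1,n}$ a reduced word and $\phi_{1,n}(w_{n+1})=w_n$. $G_1$ is the image of $\psi_1$ (those canonical sequences such that for each $i$ there is $M_i$ with $x_i$ appearing at most $M_i$ times in every $w_n$), and $\pi_1(Y_1,(0,0))$ is identified with $G_1$. *)

theory Defs
  imports "HOL-Analysis.Analysis"
begin

type_synonym pt = "real \<times> real"

definition Xc :: "nat \<Rightarrow> pt set" where
  "Xc n = {p. dist p (1 / real n, 0) = 1 / real n}"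

definition Y1 :: "pt set" where
  "Y1 = (\<Union>n\<in>{1..}. Xc n)"

definition An :: "nat \<Rightarrow> pt set" where
  "An n = {p. dist p (1 / real n, 0) \<le> 1 / real n \<and>
               dist p (1 / real (Suc n), 0) \<ge> 1 / real (Suc n)}"

definition intAn :: "nat \<Rightarrow> pt set" where
  "intAn n = interior (An n)"

definition Yup :: "nat \<Rightarrow> pt set" where
  "Yup n = Y1 \<union> (\<Union>i\<in>{1..n}. An i)"

definition HA_set :: "pt set" where
  "HA_set = (\<Union>n\<in>{1..}. Yup n)"

definition HA_topology :: "pt topology \<Rightarrow> bool" where
  "HA_topology T \<longleftrightarrow>
     topspace T = HA_set \<and>
     (\<forall>n\<ge>1. subtopology T (Yup n) = top_of_set (Yup n)) \<and>
     (\<exists>z. (\<forall>n\<ge>1. z n \<in> intAn n) \<and>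
          \<not> (\<exists>p r. strict_mono r \<and> limitin T (z \<circ> r) p sequentially)) \<and>
     (\<forall>y p. (\<forall>n\<ge>1. y n \<in> intAn n) \<and>
            (\<exists>r. strict_mono r \<and> limitin T (y \<circ> r) p sequentially) \<longrightarrow> p = (0, 0))"

text \<open>Words in the free group: letters (i, True) = x_i, (i, False) = x_i^{-1}.\<close>
type_synonym letter = "nat \<times> bool"

fun cancels :: "letter \<Rightarrow> letter \<Rightarrow> bool" where
  "cancels (i, b) (j, c) \<longleftrightarrow> i = j \<and> b \<noteq> c"

fun red :: "letter list \<Rightarrow> letter list" where
  "red [] = []"
| "red (a # w) = (case red w of [] \<Rightarrow> [a]
                   | b # u \<Rightarrow> (if cancels a b then u else a # b # u))"

definition reduced :: "letter list \<Rightarrow> bool" where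
  "reduced w \<longleftrightarrow> (\<forall>k. Suc k < length w \<longrightarrow> \<not> cancels (w ! k) (w ! Suc k))"

definition std_loop :: "nat \<Rightarrow> real \<Rightarrow> pt" where
  "std_loop i t = (1 / real i - cos (2 * pi * t) / real i, sin (2 * pi * t) / real i)"

fun letter_loop :: "letter \<Rightarrow> real \<Rightarrow> pt" where
  "letter_loop (i, b) = (if b then std_loop i else reversepath (std_loop i))"

fun word_loop :: "letter list \<Rightarrow> real \<Rightarrow> pt" where
  "word_loop [] = (\<lambda>_. (0, 0))"
| "word_loop (a # w) = letter_loop a +++ word_loop w"

definition wedge :: "nat \<Rightarrow> pt set" where
  "wedge n = (\<Union>i\<in>{1..n}. Xc i)"

definition retr :: "nat \<Rightarrow> pt \<Rightarrow> pt" where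
  "retr n p = (if p \<in> wedge n then p else (0, 0))"

text \<open>w_n: the reduced word in F_{1,n} representing r_{1,n} \<circ> \<gamma> (i.e. the n-th entry of \<psi>_1[\<gamma>]).\<close>
definition word_of :: "nat \<Rightarrow> (real \<Rightarrow> pt) \<Rightarrow> letter list" where
  "word_of n \<gamma> = (THE w. reduced w \<and> (\<forall>(i, b)\<in>set w. 1 \<le> i \<and> i \<le> n) \<and>
        homotopic_paths (wedge n) (retr n \<circ> \<gamma>) (word_loop w))"

definition collapse :: "nat \<Rightarrow> letter list \<Rightarrow> letter list" where
  "collapse N w = map (\<lambda>(i, b). (if i \<le> N then N else i, b)) w"

end

theory Submission
  imports Defs "HOL-Library.Sublist" "HOL-Complex_Analysis.Great_Picard"
begin

text \<open>A path in the earring is sampled finely and a letter is recorded whenever it passes the far point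
  of one of the first \<open>n\<close> circles; the reduced word \<open>hol n f\<close> obtained this way is invariant under
  homotopy and is the \<open>n\<close>-th entry of the canonical sequence.

  A loop \<open>f\<close> with \<open>hol n f = []\<close> for all large \<open>n\<close> is null in its image: its lifts to the Cayley trees,
  with edge weights decreasing fast enough, have equicontinuous distances to the root, a uniform limit
  \<open>h\<close> exists by Arzela-Ascoli, \<open>f s = f t\<close> whenever \<open>h s = h t = min h\<close> on \<open>{s..t}\<close>, and sliding each point
  down this tree is a null homotopy.

  If all the words \<open>v\<^sub>n\<close> are trivial, slide the first \<open>N\<close> circles of the loop through the annuli onto the
  circle \<open>N\<close>; the resulting loop is null. Conversely, a null homotopy in the archipelago is continuous for the
  Euclidean topology and misses all punctures \<open>z\<^sub>n\<close> with \<open>n \<ge> N\<close>, so it can be pushed radially off the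
  interiors of the annuli into a finite wedge.\<close>

section \<open>Reduced words\<close>

text \<open>The earring is not semilocally simply connected at the origin, so there is no universal
  cover in which a loop could be lifted once and for all. Only the truncations lift, to trees that
  change with \<open>n\<close>; what passes to the limit is the real-valued distance to the root.
  The weight of an edge depends on its label \<open>i\<close> alone and is chosen from the modulus
  of continuity of \<open>f\<close>, so all estimates are the same at every level. The limit height
  still detects \<open>f\<close>, because the position on each single circle is controlled by the
  tree distance. Counting crossings of far points serves three purposes: homotopy invariance, the
  entries of the canonical sequence, and the lifts. The null homotopies stay inside the image of the
  loop; applied in a finite wedge, this also shows that \<open>word_of\<close> is well defined. In
  the archipelago, the condition on \<open>z\<close> makes a compact homotopy miss almost all
  punctures, while the condition on limits at the origin makes it Euclidean continuous. For the
  converse, a Euclidean homotopy in some \<open>Yup N\<close> is carried over by the agreement of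
  the two topologies there.\<close>

definition push :: "letter \<Rightarrow> letter list \<Rightarrow> letter list" where
  "push a w = (case w of [] \<Rightarrow> [a] | b # u \<Rightarrow> if cancels a b then u else a # b # u)"

definition flip :: "letter \<Rightarrow> letter" where
  "flip a = (fst a, \<not> snd a)"

lemma flip_flip [simp]: "flip (flip a) = a"
  by (simp add: flip_def)

lemma flip_Pair [simp]: "flip (i, b) = (i, \<not> b)"
  by (simp add: flip_def)

lemma cancels_iff: "cancels a b \<longleftrightarrow> b = flip a"
  by (cases a; cases b) auto

lemma push_Nil [simp]: "push a [] = [a]"
  by (simp add: push_def)

lemma push_Cons: "push a (b # w) = (if b = flip a then w else a # b # w)"
  by (simp add: push_def cancels_iff)

lemma red_Cons: "red (a # w) = push a (red w)"
  by (simp add: push_def)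

declare red.simps(2) [simp del]
declare red_Cons [simp]

lemma reduced_Nil [simp]: "reduced []"
  by (simp add: reduced_def)

lemma reduced_Cons: "reduced (a # w) \<longleftrightarrow> reduced w \<and> (w = [] \<or> hd w \<noteq> flip a)"
proof (cases w)
  case (Cons b u)
  show ?thesis
  proof
    assume "reduced (a # w)"
    then have H: "\<not> cancels ((a # w) ! k) ((a # w) ! Suc k)" if "Suc k < Suc (length w)" for k
      using that by (simp add: reduced_def)
    show "reduced w \<and> (w = [] \<or> hd w \<noteq> flip a)"
      using H [of 0] H [of "Suc k" for k] by (auto simp: Cons reduced_def cancels_iff)
  next
    assume R: "reduced w \<and> (w = [] \<or> hd w \<noteq> flip a)"
    then have "\<not> cancels ((a # w) ! k) ((a # w) ! Suc k)" if "Suc k < length (a # w)" for k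
      using that by (cases k) (auto simp: Cons reduced_def cancels_iff)
    then show "reduced (a # w)"
      by (auto simp: reduced_def)
  qed
qed (simp add: reduced_def)

lemma reduced_push: "reduced w \<Longrightarrow> reduced (push a w)"
  by (cases w) (auto simp: push_Cons reduced_Cons)

lemma reduced_red [simp]: "reduced (red w)"
  by (induction w) (auto intro: reduced_push)

lemma red_reduced: "reduced w \<Longrightarrow> red w = w"
proof (induction w)
  case (Cons a w)
  then show ?case
    by (cases w) (auto simp: reduced_Cons push_Cons)
qed simp

lemma red_red [simp]: "red (red w) = red w"
  by (simp add: red_reduced)

text \<open>Letters act on reduced words as mutually inverse permutations. This action (van der
  Waerden's trick) replaces a confluence argument for free reduction.\<close>

lemma push_flip_push: "reduced w \<Longrightarrow> push (flip a) (push a w) = w"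
proof (cases w)
  case (Cons b u)
  then show "reduced w \<Longrightarrow> ?thesis"
    by (cases u) (auto simp: push_Cons reduced_Cons)
qed (simp add: push_Cons)

lemma push_push_flip: "reduced w \<Longrightarrow> push a (push (flip a) w) = w"
  using push_flip_push [of w "flip a"] by simp

lemma red_append: "red (u @ v) = foldr push u (red v)"
  by (induction u) auto

lemma reduced_foldr_push: "reduced w \<Longrightarrow> reduced (foldr push u w)"
  by (induction u) (auto intro: reduced_push)

text \<open>If \<open>push\<close> cancels, the two actions undo each other; otherwise both sides
  agree by definition. By induction the action of a word depends only on its reduction, which makes
  \<open>red\<close> compatible with concatenation.\<close>

lemma foldr_push_push:
  assumes "reduced y" "reduced x"
  shows "foldr push (push a y) x = push a (foldr push y x)"
  using assms
  by (cases y) (auto simp: push_Cons reduced_Cons push_push_flip reduced_foldr_push)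

lemma foldr_push_red: "reduced x \<Longrightarrow> foldr push (red u) x = foldr push u x"
  by (induction u) (auto simp: foldr_push_push)

lemma red_append_red_left [simp]: "red (red u @ v) = red (u @ v)"
  by (simp add: red_append foldr_push_red)

lemma red_append_red_right [simp]: "red (u @ red v) = red (u @ v)"
  by (simp add: red_append)

lemma red_cong:
  assumes "red u = red u'"
  shows "red (x @ u @ y) = red (x @ u' @ y)"
  using assms by (metis red_append_red_left red_append_red_right)

lemma red_cong_left: "red u = red u' \<Longrightarrow> red (u @ y) = red (u' @ y)"
  using red_cong [of u u' "[]"] by simp

lemma red_cong_right: "red u = red u' \<Longrightarrow> red (x @ u) = red (x @ u')"
  using red_cong [of u u' x "[]"] by simp

lemma reduced_singleton [simp]: "reduced [a]"
  by (simp add: reduced_Cons)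

lemma set_push: "set (push a w) \<subseteq> insert a (set w)"
  by (cases w) (auto simp: push_Cons)

lemma set_red: "set (red w) \<subseteq> set w"
proof (induction w)
  case (Cons a w)
  then show ?case
    using set_push [of a "red w"] by auto
qed simp

lemma length_push: "length (push a w) \<le> Suc (length w)"
  by (cases w) (auto simp: push_Cons)

lemma length_red: "length (red w) \<le> length w"
proof (induction w)
  case (Cons a w)
  then show ?case
    using length_push [of a "red w"] by (auto intro: order_trans)
qed simp

section \<open>Crossing letters\<close>

text \<open>A point is classified by the circle on whose far half it lies and by whether it is in the
  lower half plane; a letter is read off when a path passes the far point of a circle.\<close>

fun cross :: "letter option \<Rightarrow> letter option \<Rightarrow> letter list" where
  "cross (Some (i, b)) (Some (j, c)) = (if i = j \<and> b \<noteq> c then [(i, c)] else [])"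
| "cross _ _ = []"

lemma cross_same [simp]: "cross a a = []"
  by (cases a) auto

lemma reduced_cross [simp]: "reduced (cross a b)"
  by (cases "(a, b)" rule: cross.cases) auto

lemma length_cross: "length (cross a b) \<le> 1"
  by (cases "(a, b)" rule: cross.cases) auto

text \<open>The one obstruction to adding a middle sample: the outer two lie on opposite sides of
  the same far half and the middle one is not on that far half, so that the crossing between the
  outer samples is lost.\<close>

fun nonsep :: "letter option \<Rightarrow> letter option \<Rightarrow> letter option \<Rightarrow> bool" where
  "nonsep (Some (i, s)) None (Some (j, t)) \<longleftrightarrow> i \<noteq> j \<or> s = t"
| "nonsep (Some (i, s)) (Some (k, u)) (Some (j, t)) \<longleftrightarrow> i \<noteq> j \<or> s = t \<or> k = i"
| "nonsep _ _ _ \<longleftrightarrow> True"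

text \<open>Cocycle identity. With all three samples on one far half it is a check of the sides; in
  every other case the hypotheses, in which each sample takes the middle role once, leave all three
  crossing words empty.\<close>

lemma red_cross_cross:
  assumes "nonsep a b c" "nonsep a c b" "nonsep b a c"
  shows "red (cross a b @ cross b c) = cross a c"
  using assms
proof (cases "a = None \<or> c = None")
  case True
  then show ?thesis
    using assms by (cases a; cases b; cases c) auto
next
  case False
  then obtain i s j t where ac: "a = Some (i, s)" "c = Some (j, t)"
    by auto
  show ?thesis
  proof (cases b)
    case None
    then show ?thesis
      using assms ac by auto
  next
    case (Some y)
    then obtain k u where b: "b = Some (k, u)"
      by (cases y) auto
    show ?thesis
    proof (cases "k = i \<and> j = i")
      case True
      then have "k = i" "j = i" by auto
      show ?thesis
        unfolding ac b \<open>k = i\<close> \<open>j = i\<close>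
        by (cases s; cases t; cases u; simp add: push_Cons)
    next
      case False
      then have "\<not> (i = j \<and> s \<noteq> t)" "\<not> (i = k \<and> s \<noteq> u)" "\<not> (k = j \<and> u \<noteq> t)"
        using assms unfolding ac b nonsep.simps by blast+
      then have "cross a c = []" "cross a b = []" "cross b c = []"
        unfolding ac b cross.simps by presburger+
      then show ?thesis
        by simp
    qed
  qed
qed

lemma red_cross_cross_append:
  assumes "nonsep a b c" "nonsep a c b" "nonsep b a c"
  shows "red (cross a b @ cross b c @ w) = red (cross a c @ w)"
  by (metis append_assoc assms red_append_red_left red_cross_cross)

section \<open>The circles in inverted coordinates\<close>

text \<open>The circle through the origin of radius \<open>1 / \<kappa>\<close> centred on the positive axis is the level set
  of \<open>kap\<close> at \<open>\<kappa>\<close>. Division by zero gives \<open>kap 0 = 0\<close>.\<close>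

definition kap :: "pt \<Rightarrow> real" where
  "kap p = 2 * fst p / (norm p)\<^sup>2"

lemma norm_sq_pt: "(norm (p::pt))\<^sup>2 = (fst p)\<^sup>2 + (snd p)\<^sup>2"
  by (simp add: norm_prod_def)

lemma kap_0 [simp]: "kap 0 = 0"
  by (simp add: kap_def)

lemma kap_scaleR: "c \<noteq> 0 \<Longrightarrow> kap (c *\<^sub>R p) = kap p / c"
  by (simp add: kap_def power_mult_distrib) (simp add: power2_eq_square)

lemma continuous_on_kap: "continuous_on (- {0}) kap"
  unfolding kap_def by (intro continuous_intros) auto

lemma open_kap_interval: "open {p \<in> - {0}. kap p \<in> {a<..<b}}"
  using continuous_open_preimage [OF continuous_on_kap, of "{a<..<b}"] by (auto simp: vimage_def Int_def)

lemma dist_sq_center: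
  fixes p :: pt
  assumes "a \<noteq> 0"
  shows "(dist p (1 / a, 0))\<^sup>2 = (norm p)\<^sup>2 - 2 * fst p / a + (1 / a)\<^sup>2"
  unfolding dist_norm norm_sq_pt by (simp add: power2_diff)

text \<open>On squaring the distance the term \<open>(1 / n)\<^sup>2\<close> cancels, so disks
  tangent to the axis at the origin become bounds on \<open>kap\<close>. The origin is listed apart
  because \<open>kap 0\<close> is a default value.\<close>

lemma dist_center_le_iff:
  assumes "n \<ge> 1"
  shows "dist p (1 / real n, 0) \<le> 1 / real n \<longleftrightarrow> p = 0 \<or> real n \<le> kap p" (is ?A)
    and "dist p (1 / real n, 0) \<ge> 1 / real n \<longleftrightarrow> p = 0 \<or> kap p \<le> real n" (is ?B)
proof -
  have n: "real n > 0" using assms by simp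
  have "dist p (1 / real n, 0) \<le> 1 / real n \<longleftrightarrow> (dist p (1 / real n, 0))\<^sup>2 \<le> (1 / real n)\<^sup>2"
    using n abs_le_square_iff [of "dist p (1 / real n, 0)" "1 / real n"] by simp
  also have "\<dots> \<longleftrightarrow> (norm p)\<^sup>2 * real n \<le> 2 * fst p"
    using n by (simp add: dist_sq_center field_simps)
  also have "\<dots> \<longleftrightarrow> p = 0 \<or> real n \<le> kap p"
    by (cases "p = 0") (auto simp: kap_def field_simps)
  finally show ?A .
  have "dist p (1 / real n, 0) \<ge> 1 / real n \<longleftrightarrow> (dist p (1 / real n, 0))\<^sup>2 \<ge> (1 / real n)\<^sup>2"
    using n abs_le_square_iff [of "1 / real n" "dist p (1 / real n, 0)"] by simp
  also have "\<dots> \<longleftrightarrow> (norm p)\<^sup>2 * real n \<ge> 2 * fst p"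
    using n by (simp add: dist_sq_center field_simps)
  also have "\<dots> \<longleftrightarrow> p = 0 \<or> kap p \<le> real n"
    by (cases "p = 0") (auto simp: kap_def field_simps)
  finally show ?B .
qed

lemma Xc_iff: "n \<ge> 1 \<Longrightarrow> p \<in> Xc n \<longleftrightarrow> p = 0 \<or> kap p = real n"
  using dist_center_le_iff [of n p] by (auto simp: Xc_def)

lemma Y1_iff: "p \<in> Y1 \<longleftrightarrow> p = 0 \<or> (\<exists>n\<ge>1. kap p = real n)"
  by (auto simp: Y1_def Xc_iff)

lemma wedge_iff:
  "n \<ge> 1 \<Longrightarrow> p \<in> wedge n \<longleftrightarrow> p = 0 \<or> (\<exists>i. 1 \<le> i \<and> i \<le> n \<and> kap p = real i)"
  unfolding wedge_def by (auto simp: Xc_iff)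

lemma wedge_subset_Y1: "wedge n \<subseteq> Y1"
  by (auto simp: wedge_def Y1_def)

lemma kap_circle: "kap p = c \<Longrightarrow> p \<noteq> 0 \<Longrightarrow> c * (norm p)\<^sup>2 = 2 * fst p"
  by (auto simp: kap_def)

lemma circle_eq:
  assumes "p \<noteq> 0" "kap p = real i" "i \<ge> 1"
  shows "(1 - real i * fst p)\<^sup>2 + (real i * snd p)\<^sup>2 = 1"
proof -
  have "real i * ((fst p)\<^sup>2 + (snd p)\<^sup>2) = 2 * fst p"
    using kap_circle [of p] assms by (simp add: norm_sq_pt)
  then have "real i * (real i * ((fst p)\<^sup>2 + (snd p)\<^sup>2)) = real i * (2 * fst p)"
    by simp
  then show ?thesis
    by (simp add: power2_eq_square algebra_simps)
qed

definition idx :: "pt \<Rightarrow> nat" where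
  "idx p = nat \<lfloor>kap p\<rfloor>"

lemma idx_eq: "kap p = real i \<Longrightarrow> idx p = i"
  by (simp add: idx_def)

lemma kap_idx: "p \<in> Y1 \<Longrightarrow> kap p = real (idx p)"
  by (auto simp: Y1_iff idx_def)

lemma idx_pos: "p \<in> Y1 \<Longrightarrow> p \<noteq> 0 \<Longrightarrow> idx p \<ge> 1"
  by (auto simp: Y1_iff idx_def)

text \<open>The near halves all meet at the origin and get \<open>None\<close>, so changing circles
  there records nothing. The far point itself counts as upper side.\<close>

definition cls :: "nat \<Rightarrow> pt \<Rightarrow> letter option" where
  "cls n p = (if p \<noteq> 0 \<and> idx p \<le> n \<and> fst p * real (idx p) > 1
    then Some (idx p, snd p < 0) else None)"

lemma cls_0 [simp]: "cls n 0 = None"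
  by (simp add: cls_def)

lemma cls_Some_iff:
  assumes "p \<in> Y1"
  shows "cls n p = Some (i, b) \<longleftrightarrow>
    p \<noteq> 0 \<and> kap p = real i \<and> i \<le> n \<and> fst p * real i > 1 \<and> b = (snd p < 0)"
  using kap_idx [OF assms] idx_eq [of p i] by (auto simp: cls_def)

text \<open>The arc is compact and lies in an open set, hence has a uniform neighbourhood in it. The
  value 3/2 lies halfway between the edge of the far half (1) and the far point (2); on
  \<open>Y1\<close>, where \<open>kap\<close> is integral, a deviation below 1/2 means the same
  circle.\<close>

lemma far_point_nbhd:
  assumes "i \<ge> (1::nat)"
  obtains e where "e > 0" "e \<le> 1 / (2 * real i)"
    "\<And>p q. \<lbrakk>p \<in> Xc i; fst p * real i \<ge> 3/2; dist p q < e\<rbrakk>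
      \<Longrightarrow> q \<noteq> 0 \<and> \<bar>kap q - real i\<bar> < 1/2 \<and> fst q * real i > 1"
proof -
  define U where "U = {q \<in> - {0}. kap q \<in> {real i - 1/2 <..< real i + 1/2}} \<inter> {q. fst q * real i > 1}"
  define C where "C = Xc i \<inter> {q. fst q * real i \<ge> 3/2}"
  have "open U"
    unfolding U_def by (intro open_Int open_kap_interval open_Collect_less continuous_intros)
  moreover have "compact C"
  proof -
    have "Xc i = sphere (1 / real i, 0) (1 / real i)"
      by (auto simp: Xc_def dist_commute)
    moreover have "closed {q::pt. fst q * real i \<ge> 3/2}"
      by (intro closed_Collect_le continuous_intros)
    ultimately show ?thesis
      unfolding C_def by (simp add: compact_Int_closed)
  qed
  moreover have "C \<subseteq> U"
  proof
    fix p assume p: "p \<in> C"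
    then have "p \<noteq> 0" by (auto simp: C_def)
    then show "p \<in> U"
      using p assms Xc_iff [of i p] by (auto simp: U_def C_def)
  qed
  ultimately obtain e where e: "e > 0" "(\<Union>x\<in>C. ball x e) \<subseteq> U"
    using compact_subset_open_imp_ball_epsilon_subset [of C U] by blast
  show ?thesis
  proof
    show "min e (1 / (2 * real i)) > 0" "min e (1 / (2 * real i)) \<le> 1 / (2 * real i)"
      using e(1) assms by auto
    fix p q assume "p \<in> Xc i" "fst p * real i \<ge> 3/2" "dist p q < min e (1 / (2 * real i))"
    then have "q \<in> U"
      using e(2) by (force simp: C_def)
    then have "q \<noteq> 0" "real i - 1/2 < kap q" "kap q < real i + 1/2" "fst q * real i > 1"
      by (auto simp: U_def)
    then show "q \<noteq> 0 \<and> \<bar>kap q - real i\<bar> < 1/2 \<and> fst q * real i > 1"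
      by linarith
  qed
qed

text \<open>Below 3/2 the circle equation gives \<open>\<bar>snd p\<bar> > 1 / (2 * real i)\<close>,
  and a point on the other side of the axis is at least that far away.\<close>

lemma opposite_far:
  assumes "i \<ge> (1::nat)" "p \<noteq> 0" "kap p = real i" "fst p * real i > 1"
    and "(snd p < 0) \<noteq> (snd q < 0)" "dist p q < 1 / (2 * real i)"
  shows "fst p * real i \<ge> 3/2"
proof (rule ccontr)
  assume "\<not> fst p * real i \<ge> 3/2"
  then have "\<bar>fst p * real i - 1\<bar> \<le> 1/2"
    using assms by auto
  then have "(fst p * real i - 1)\<^sup>2 \<le> (1/2)\<^sup>2"
    by (metis abs_le_square_iff abs_of_pos half_gt_zero_iff zero_less_one)
  moreover have "(fst p * real i - 1)\<^sup>2 + (snd p * real i)\<^sup>2 = 1"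
    using circle_eq [of p i] assms(1-3) by (simp add: power2_commute [of 1] mult.commute)
  ultimately have "(snd p * real i)\<^sup>2 > (1/2)\<^sup>2"
    by (simp add: power2_eq_square)
  then have "\<bar>snd p * real i\<bar> > 1/2"
    by (metis abs_le_square_iff abs_of_pos half_gt_zero_iff not_le zero_less_one)
  then have "\<bar>snd p\<bar> > 1 / (2 * real i)"
    using assms(1) by (simp add: abs_mult field_simps)
  moreover have "\<bar>snd p\<bar> \<le> \<bar>snd p - snd q\<bar>"
    using assms(5) by auto
  moreover have "\<bar>snd p - snd q\<bar> \<le> dist p q"
    by (metis dist_real_def dist_snd_le)
  ultimately show False
    using assms(6) by linarith
qed

lemma ex_eta_one:
  assumes "i \<ge> (1::nat)" "i \<le> n"
  shows "\<exists>e>0. \<forall>p\<in>Y1. \<forall>q\<in>Y1. \<forall>r\<in>Y1. \<forall>b. dist p q < e \<and> dist p r < e \<and>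
    cls n p = Some (i, b) \<and> cls n r = Some (i, \<not> b) \<longrightarrow> (\<exists>b'. cls n q = Some (i, b'))"
proof -
  obtain e where e: "e > 0" "e \<le> 1 / (2 * real i)"
    and E: "\<And>p q. \<lbrakk>p \<in> Xc i; fst p * real i \<ge> 3/2; dist p q < e\<rbrakk>
      \<Longrightarrow> q \<noteq> 0 \<and> \<bar>kap q - real i\<bar> < 1/2 \<and> fst q * real i > 1"
    using far_point_nbhd [OF assms(1)] by blast
  have "\<exists>b'. cls n q = Some (i, b')"
    if Y: "p \<in> Y1" "q \<in> Y1" "r \<in> Y1" and d: "dist p q < e" "dist p r < e"
      and c: "cls n p = Some (i, b)" "cls n r = Some (i, \<not> b)" for p q r b
  proof -
    have p: "p \<noteq> 0" "kap p = real i" "fst p * real i > 1" "(snd p < 0) \<noteq> (snd r < 0)"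
      using c cls_Some_iff [OF Y(1)] cls_Some_iff [OF Y(3)] by auto
    have "fst p * real i \<ge> 3/2"
      using opposite_far [OF assms(1) p] d e by linarith
    then have q: "q \<noteq> 0 \<and> \<bar>kap q - real i\<bar> < 1/2 \<and> fst q * real i > 1"
      using E [of p q] d p assms Xc_iff by blast
    then have "\<bar>real (idx q) - real i\<bar> < 1/2"
      using kap_idx [OF Y(2)] by simp
    then have "idx q = i" by linarith
    then show ?thesis
      using q assms(2) kap_idx [OF Y(2)] by (auto simp: cls_def)
  qed
  then show ?thesis
    using e(1) by blast
qed

text \<open>Only the circles up to \<open>n\<close> matter, so a minimum of finitely many positive
  numbers works; the bound depends on \<open>n\<close>. The extra element 1 covers
  \<open>n = 0\<close>.\<close>

lemma ex_eta:
  "\<exists>e>0. \<forall>p\<in>Y1. \<forall>q\<in>Y1. \<forall>r\<in>Y1. dist p q < e \<and> dist p r < e \<longrightarrow> nonsep (cls n p) (cls n q) (cls n r)"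
proof -
  define P where "P i e \<longleftrightarrow> (\<forall>p\<in>Y1. \<forall>q\<in>Y1. \<forall>r\<in>Y1. \<forall>b. dist p q < e \<and> dist p r < e \<and>
    cls n p = Some (i, b) \<and> cls n r = Some (i, \<not> b) \<longrightarrow> (\<exists>b'. cls n q = Some (i, b')))" for i e
  have "\<forall>i\<in>{1..n}. \<exists>e>0. P i e"
    using ex_eta_one by (auto simp: P_def)
  then obtain e where e: "\<And>i. i \<in> {1..n} \<Longrightarrow> e i > 0 \<and> P i (e i)"
    by metis
  define d where "d = Min (insert 1 (e ` {1..n}))"
  have "d > 0"
    using e by (auto simp: d_def)
  have "d \<le> e i" if "i \<in> {1..n}" for i
    unfolding d_def by (rule Min_le) (use that in auto)
  have "nonsep (cls n p) (cls n q) (cls n r)"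
    if Y: "p \<in> Y1" "q \<in> Y1" "r \<in> Y1" and D: "dist p q < d" "dist p r < d" for p q r
  proof (rule ccontr)
    assume N: "\<not> nonsep (cls n p) (cls n q) (cls n r)"
    then obtain i b where c: "cls n p = Some (i, b)" "cls n r = Some (i, \<not> b)"
      and q: "\<And>b'. cls n q \<noteq> Some (i, b')"
      by (cases "(cls n p, cls n q, cls n r)" rule: nonsep.cases) auto
    have i: "i \<in> {1..n}"
      using c(1) idx_pos [OF Y(1)] by (auto simp: cls_def split: if_splits)
    then have "dist p q < e i" "dist p r < e i" "P i (e i)"
      using e D \<open>\<And>i. i \<in> {1..n} \<Longrightarrow> d \<le> e i\<close> by (force intro: less_le_trans)+
    then show False
      using Y c q unfolding P_def by blast
  qed
  then show ?thesis
    using \<open>d > 0\<close> by blast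
qed

definition eta :: "nat \<Rightarrow> real" where
  "eta n = (SOME e. e > 0 \<and> (\<forall>p\<in>Y1. \<forall>q\<in>Y1. \<forall>r\<in>Y1. dist p q < e \<and> dist p r < e \<longrightarrow>
    nonsep (cls n p) (cls n q) (cls n r)))"

lemma eta: "eta n > 0 \<and> (\<forall>p\<in>Y1. \<forall>q\<in>Y1. \<forall>r\<in>Y1. dist p q < eta n \<and> dist p r < eta n \<longrightarrow>
    nonsep (cls n p) (cls n q) (cls n r))"
  unfolding eta_def by (rule someI_ex [OF ex_eta])

lemma eta_pos: "eta n > 0"
  using eta by blast

abbreviation crs :: "nat \<Rightarrow> pt \<Rightarrow> pt \<Rightarrow> letter list" where
  "crs n p q \<equiv> cross (cls n p) (cls n q)"

lemma red_crs_crs: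
  assumes "p \<in> Y1" "q \<in> Y1" "r \<in> Y1" "dist p q < eta n" "dist q r < eta n" "dist p r < eta n"
  shows "red (crs n p q @ crs n q r @ w) = red (crs n p r @ w)"
  by (rule red_cross_cross_append)
    (use eta [of n] assms in \<open>auto simp: dist_commute\<close>)


section \<open>Sampled words\<close>

definition seqword :: "nat \<Rightarrow> (nat \<Rightarrow> pt) \<Rightarrow> nat \<Rightarrow> nat \<Rightarrow> letter list" where
  "seqword n p a b = concat (map (\<lambda>k. crs n (p k) (p (Suc k))) [a..<b])"

lemma seqword_append: "a \<le> b \<Longrightarrow> b \<le> c \<Longrightarrow> seqword n p a b @ seqword n p b c = seqword n p a c"
  unfolding seqword_def using upt_add_eq_append [of a b "c - b"] by simp

lemma seqword_refl [simp]: "seqword n p a a = []"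
  by (simp add: seqword_def)

lemma seqword_Suc: "a \<le> b \<Longrightarrow> seqword n p a (Suc b) = seqword n p a b @ crs n (p b) (p (Suc b))"
  by (simp add: seqword_def)

lemma seqword_rec: "a < b \<Longrightarrow> seqword n p a b = crs n (p a) (p (Suc a)) @ seqword n p (Suc a) b"
  by (simp add: seqword_def upt_rec)

lemma seqword_Nil:
  assumes "\<And>k. a \<le> k \<Longrightarrow> k < b \<Longrightarrow> crs n (p k) (p (Suc k)) = []"
  shows "seqword n p a b = []"
  using assms by (auto simp: seqword_def)

lemma seqword_cong:
  assumes "\<And>k. a \<le> k \<Longrightarrow> k \<le> b \<Longrightarrow> cls n (p k) = cls m (q k)"
  shows "seqword n p a b = seqword m q a b"
proof -
  have "map (\<lambda>k. crs n (p k) (p (Suc k))) [a..<b] = map (\<lambda>k. crs m (q k) (q (Suc k))) [a..<b]"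
    using assms by auto
  then show ?thesis
    unfolding seqword_def by (rule arg_cong)
qed

lemma seqword_shift: "seqword n p (a + c) (b + c) = seqword n (\<lambda>k. p (k + c)) a b"
  unfolding seqword_def by (induction b) (auto simp: seqword_def)

text \<open>A ladder with rails \<open>p\<close> and \<open>q\<close>: the diagonal from
  \<open>p k\<close> to \<open>q (Suc k)\<close> cuts each square into two triangles, and the
  cocycle identity is applied to both.\<close>

lemma red_seqword_close:
  assumes "\<And>k. k \<le> m \<Longrightarrow> p k \<in> Y1" "\<And>k. k \<le> m \<Longrightarrow> q k \<in> Y1"
    and "\<And>k. k < m \<Longrightarrow> dist (p k) (p (Suc k)) < eta n"
    and "\<And>k. k < m \<Longrightarrow> dist (q k) (q (Suc k)) < eta n"
    and "\<And>k. k < m \<Longrightarrow> dist (p k) (q (Suc k)) < eta n"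
    and "\<And>k. k \<le> m \<Longrightarrow> dist (p k) (q k) < eta n"
  shows "red (seqword n p 0 m @ crs n (p m) (q m)) = red (crs n (p 0) (q 0) @ seqword n q 0 m)"
  using assms
proof (induction m)
  case (Suc m)
  have IH: "red (seqword n p 0 m @ crs n (p m) (q m)) = red (crs n (p 0) (q 0) @ seqword n q 0 m)"
    by (rule Suc.IH) (use Suc.prems in auto)
  have "red (seqword n p 0 (Suc m) @ crs n (p (Suc m)) (q (Suc m)))
      = red (seqword n p 0 m @ (crs n (p m) (p (Suc m)) @ crs n (p (Suc m)) (q (Suc m)) @ []))"
    by (simp add: seqword_Suc)
  also have "\<dots> = red (seqword n p 0 m @ (crs n (p m) (q (Suc m)) @ []))"
    by (rule red_cong_right, rule red_crs_crs) (use Suc.prems in auto)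
  also have "\<dots> = red (seqword n p 0 m @ (crs n (p m) (q m) @ crs n (q m) (q (Suc m)) @ []))"
    by (rule red_cong_right, rule red_crs_crs [symmetric]) (use Suc.prems in auto)
  also have "\<dots> = red ((seqword n p 0 m @ crs n (p m) (q m)) @ crs n (q m) (q (Suc m)))"
    by simp
  also have "\<dots> = red ((crs n (p 0) (q 0) @ seqword n q 0 m) @ crs n (q m) (q (Suc m)))"
    by (rule red_cong_left) (rule IH)
  finally show ?case
    by (simp add: seqword_Suc)
qed simp

text \<open>Repeated samples contribute empty crossings. This lets a coarse sampling be stretched to
  the length of a fine one, as the ladder comparison requires.\<close>

lemma seqword_div:
  assumes "m > 0"
  shows "seqword n (\<lambda>l. p (l div m)) 0 (K * m) = seqword n p 0 K"
proof (induction K)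
  case (Suc K)
  have "seqword n (\<lambda>l. p (l div m)) 0 (Suc K * m)
      = seqword n (\<lambda>l. p (l div m)) 0 (K * m) @ seqword n (\<lambda>l. p (l div m)) (K * m) (Suc (K * m + (m - 1)))"
    using seqword_append [of 0 "K * m" "Suc K * m" n "\<lambda>l. p (l div m)"] assms by (simp add: add.commute)
  also have "seqword n (\<lambda>l. p (l div m)) (K * m) (Suc (K * m + (m - 1))) =
      seqword n (\<lambda>l. p (l div m)) (K * m) (K * m + (m - 1)) @ crs n (p K) (p (Suc K))"
  proof -
    have "(K * m + (m - 1)) div m = K"
      using assms by (intro div_nat_eqI) (auto simp: algebra_simps)
    moreover have "Suc (K * m + (m - 1)) div m = Suc K"
      using assms by simp
    ultimately show ?thesis
      by (simp only: seqword_Suc le_add1)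
  qed
  also have "seqword n (\<lambda>l. p (l div m)) (K * m) (K * m + (m - 1)) = []"
  proof (rule seqword_Nil)
    fix k assume "K * m \<le> k" "k < K * m + (m - 1)"
    then have "k div m = K" "Suc k div m = K"
      by (intro div_nat_eqI; simp add: algebra_simps)+
    then show "crs n (p (k div m)) (p (Suc k div m)) = []"
      by simp
  qed
  finally show ?case
    using Suc by (simp add: seqword_Suc)
qed simp

text \<open>Two mesh widths rather than one, since the diagonals of the ladders join parameters up
  to \<open>2 / real K\<close> apart.\<close>

definition good :: "nat \<Rightarrow> (real \<Rightarrow> pt) \<Rightarrow> nat \<Rightarrow> bool" where
  "good n f K \<longleftrightarrow> 0 < K \<and> (\<forall>s\<in>{0..1}. \<forall>t\<in>{0..1}. \<bar>s - t\<bar> \<le> 2 / real K \<longrightarrow> dist (f s) (f t) < eta n)"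

lemma good_mono: "good n f K \<Longrightarrow> K \<le> K' \<Longrightarrow> good n f K'"
  unfolding good_def
  by (smt (verit) frac_le of_nat_0_less_iff of_nat_mono order_less_le_trans)

lemma goodD:
  "\<lbrakk>good n f K; 0 \<le> s; s \<le> 1; 0 \<le> t; t \<le> 1; \<bar>s - t\<bar> \<le> 2 / real K\<rbrakk> \<Longrightarrow> dist (f s) (f t) < eta n"
  by (simp add: good_def)

lemma ex_good:
  assumes "path f"
  shows "\<exists>K. good n f K"
proof -
  have "uniformly_continuous_on {0..1} f"
    using assms by (simp add: path_def compact_uniformly_continuous)
  then obtain d where d: "d > 0"
    "\<And>s t. \<lbrakk>s \<in> {0..1}; t \<in> {0..1}; dist s t < d\<rbrakk> \<Longrightarrow> dist (f s) (f t) < eta n"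
    using eta_pos [of n] unfolding uniformly_continuous_on_def by metis
  obtain K where K: "K > 0" "inverse (real K) < d / 2"
    using d(1) by (metis ex_inverse_of_nat_less half_gt_zero)
  then have "2 / real K < d"
    by (simp add: field_simps)
  then show ?thesis
    using K d by (auto simp: good_def dist_real_def intro!: exI [of _ K])
qed

definition sword :: "nat \<Rightarrow> (real \<Rightarrow> pt) \<Rightarrow> nat \<Rightarrow> letter list" where
  "sword n f K = seqword n (\<lambda>k. f (real k / real K)) 0 K"

definition hol :: "nat \<Rightarrow> (real \<Rightarrow> pt) \<Rightarrow> letter list" where
  "hol n f = red (sword n f (SOME K. good n f K))"

lemma path_Y1D: "path_image f \<subseteq> Y1 \<Longrightarrow> 0 \<le> t \<Longrightarrow> t \<le> 1 \<Longrightarrow> f t \<in> Y1"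
  by (auto simp: path_image_def)

lemma red_sword_mult:
  assumes g: "good n f K" and Y: "path_image f \<subseteq> Y1" and m: "m > 0"
  shows "red (sword n f (K * m)) = red (sword n f K)"
proof -
  have K: "K > 0" using g by (simp add: good_def)
  define p where "p l = f (real l / real (K * m))" for l
  \<comment> \<open>The coarse sampling, each sample repeated \<open>m\<close> times.\<close>
  define q where "q l = f (real (l div m) / real K)" for l
  have near: "\<bar>real l / real (K * m) - real (l div m) / real K\<bar> \<le> 1 / real K"
    "real (l div m) / real K \<le> real l / real (K * m)" for l
  proof -
    have *: "real l = real (l div m) * real m + real (l mod m)"
      by (metis div_mult_mod_eq of_nat_add of_nat_mult)
    have "real (l mod m) \<le> real m"
      using m by (simp add: order_less_imp_le)
    then show "\<bar>real l / real (K * m) - real (l div m) / real K\<bar> \<le> 1 / real K"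
      "real (l div m) / real K \<le> real l / real (K * m)"
      using K m unfolding * by (simp_all add: field_simps)
  qed
  have le1: "real l / real (K * m) \<le> 1" "real (l div m) / real K \<le> 1" if "l \<le> K * m" for l
  proof -
    show "real l / real (K * m) \<le> 1"
      using that K m by (simp del: of_nat_mult)
    then show "real (l div m) / real K \<le> 1"
      using near(2) [of l] by linarith
  qed
  have step: "\<bar>real (Suc l) / real (K * m) - real l / real (K * m)\<bar> \<le> 1 / real K" for l
    using K m by (simp add: field_simps)
  have step': "\<bar>real (Suc l div m) / real K - real (l div m) / real K\<bar> \<le> 1 / real K" for l
    using K m by (auto simp: div_Suc field_simps)
  have "red (seqword n p 0 (K * m) @ crs n (p (K * m)) (q (K * m)))
      = red (crs n (p 0) (q 0) @ seqword n q 0 (K * m))"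
  proof (rule red_seqword_close)
    fix l
    show "p l \<in> Y1" "q l \<in> Y1" if "l \<le> K * m"
      using le1 [OF that] by (auto simp: p_def q_def intro!: path_Y1D [OF Y])
    show "dist (p l) (q l) < eta n" if "l \<le> K * m"
      unfolding p_def q_def by (rule goodD [OF g]) (use le1 [OF that] near [of l] in auto)
    show "dist (p l) (p (Suc l)) < eta n" if "l < K * m"
      unfolding p_def
      by (rule goodD [OF g]) (use le1 [of l] le1 [of "Suc l"] step [of l] that in \<open>auto simp del: of_nat_mult of_nat_Suc\<close>)
    show "dist (q l) (q (Suc l)) < eta n" if "l < K * m"
      unfolding q_def
      by (rule goodD [OF g]) (use le1 [of l] le1 [of "Suc l"] step' [of l] that in \<open>auto simp del: of_nat_mult of_nat_Suc\<close>)
    show "dist (p l) (q (Suc l)) < eta n" if "l < K * m"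
      unfolding p_def q_def
      by (rule goodD [OF g]) (use le1 [of l] le1 [of "Suc l"] step' [of l] near [of l] that in \<open>auto simp del: of_nat_mult of_nat_Suc\<close>)
  qed
  moreover have "p 0 = q 0" "p (K * m) = q (K * m)"
    using K m by (simp_all add: p_def q_def)
  ultimately have "red (seqword n p 0 (K * m)) = red (seqword n q 0 (K * m))"
    by simp
  also have "seqword n q 0 (K * m) = seqword n (\<lambda>k. f (real k / real K)) 0 K"
    unfolding q_def using seqword_div [OF m, of n "\<lambda>k. f (real k / real K)" K] .
  finally show ?thesis
    by (simp add: sword_def p_def)
qed

text \<open>Two admissible meshes \<open>K\<close> and \<open>L\<close> are compared through the
  common refinement \<open>K * L\<close>, so the choice made in \<open>hol\<close> is
  immaterial.\<close>

lemma hol_eq: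
  assumes "good n f K" "path_image f \<subseteq> Y1"
  shows "hol n f = red (sword n f K)"
proof -
  define L where "L = (SOME K. good n f K)"
  have "good n f L"
    unfolding L_def using assms(1) by (rule someI)
  then have "red (sword n f L) = red (sword n f (L * K))" "red (sword n f K) = red (sword n f (K * L))"
    using assms red_sword_mult by (auto simp: good_def)
  then show ?thesis
    by (simp add: hol_def L_def mult.commute)
qed

lemma reduced_hol [simp]: "reduced (hol n f)"
  by (simp add: hol_def)

text \<open>On a fine grid, consecutive rows of the homotopy form a ladder; its two end rungs are
  trivial because the endpoints stay fixed.\<close>

lemma homotopic_paths_hol_eq:
  assumes "homotopic_paths Y1 f g"
  shows "hol n f = hol n g"
proof -
  obtain h where h: "continuous_on ({0..1} \<times> {0..1}) h" "h ` ({0..1} \<times> {0..1}) \<subseteq> Y1"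
    and h0: "\<And>x. x \<in> {0..1} \<Longrightarrow> h (0, x) = f x" and h1: "\<And>x. x \<in> {0..1} \<Longrightarrow> h (1, x) = g x"
    and ends: "\<And>t. t \<in> {0..1::real} \<Longrightarrow> pathstart (h \<circ> Pair t) = pathstart f \<and> pathfinish (h \<circ> Pair t) = pathfinish f"
    using assms unfolding homotopic_paths by blast
  have "uniformly_continuous_on ({0..1} \<times> {0..1}) h"
    using h(1) by (simp add: compact_Times compact_uniformly_continuous)
  then obtain d where d: "d > 0" and D: "\<And>x y. \<lbrakk>x \<in> {0..1} \<times> {0..1}; y \<in> {0..1} \<times> {0..1}; dist x y < d\<rbrakk> \<Longrightarrow> dist (h x) (h y) < eta n"
    using eta_pos [of n] unfolding uniformly_continuous_on_def by metis
  \<comment> \<open>Each of the two coordinates may change by \<open>2 / real K\<close>, hence the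
    4.\<close>
  obtain K where K: "K > 0" "inverse (real K) < d / 4"
    using d by (metis ex_inverse_of_nat_less divide_pos_pos zero_less_numeral)
  then have K4: "4 / real K < d"
    by (simp add: field_simps)
  have near: "dist (h (s, t)) (h (s', t')) < eta n"
    if "s \<in> {0..1}" "t \<in> {0..1}" "s' \<in> {0..1}" "t' \<in> {0..1}" "\<bar>s - s'\<bar> \<le> 2 / real K" "\<bar>t - t'\<bar> \<le> 2 / real K"
    for s t s' t'
  proof (rule D)
    have "dist (s, t) (s', t') \<le> \<bar>s - s'\<bar> + \<bar>t - t'\<bar>"
      using sqrt_sum_squares_le_sum_abs [of "s - s'" "t - t'"] by (simp add: dist_Pair_Pair dist_real_def)
    also have "\<dots> \<le> 2 / real K + 2 / real K"
      using that by linarith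
    finally show "dist (s, t) (s', t') < d"
      using K4 by simp
  qed (use that in auto)
  define r where "r j = (\<lambda>t. h (real j / real K, t))" for j
  have frac: "real j / real K \<in> {0..1}" if "j \<le> K" for j
    using that K(1) by simp
  have goodr: "good n (r j) K" if "j \<le> K" for j
    unfolding good_def r_def using K near frac [OF that] by auto
  have Yr: "path_image (r j) \<subseteq> Y1" if "j \<le> K" for j
    using h(2) frac [OF that] by (auto simp: r_def path_image_def)
  have endsr: "r j 0 = f 0 \<and> r j 1 = f 1" if "j \<le> K" for j
    using ends [OF frac [OF that]] by (auto simp: r_def pathstart_def pathfinish_def)
  have step: "hol n (r j) = hol n (r (Suc j))" if j: "j < K" for j
  proof -
    let ?p = "\<lambda>k. r j (real k / real K)" and ?q = "\<lambda>k. r (Suc j) (real k / real K)"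
    have jj: "\<bar>real j / real K - real (Suc j) / real K\<bar> \<le> 2 / real K" for j
      using K(1) by (simp add: field_simps)
    have *: "red (seqword n ?p 0 K @ crs n (?p K) (?q K)) = red (crs n (?p 0) (?q 0) @ seqword n ?q 0 K)"
    proof (rule red_seqword_close)
      fix k
      show "?p k \<in> Y1" "?q k \<in> Y1" if "k \<le> K"
        using path_Y1D [OF Yr] frac [OF that] j by auto
      show "dist (?p k) (?p (Suc k)) < eta n" "dist (?q k) (?q (Suc k)) < eta n"
        "dist (?p k) (?q (Suc k)) < eta n" if "k < K"
        unfolding r_def using that j
        by (intro near frac jj; simp add: K)+
      show "dist (?p k) (?q k) < eta n" if "k \<le> K"
        unfolding r_def using that j
        by (intro near frac jj; simp add: K)+
    qed
    moreover have "?p 0 = ?q 0" "?p K = ?q K"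
      using endsr [of j] endsr [of "Suc j"] j K by auto
    ultimately have "red (seqword n ?p 0 K) = red (seqword n ?q 0 K)"
      by (metis append_Nil append_Nil2 cross_same)
    then show ?thesis
      using hol_eq [OF goodr Yr] j by (simp add: sword_def)
  qed
  have "hol n (r j) = hol n (r 0)" if "j \<le> K" for j
    using that by (induction j) (use step in auto)
  then have "hol n (r K) = hol n (r 0)" by blast
  moreover have "hol n (r 0) = hol n f"
  proof -
    have "good n f K"
      using goodr [of 0] h0 by (auto simp: good_def r_def)
    moreover have "path_image f \<subseteq> Y1"
      using Yr [of 0] h0 by (auto simp: path_image_def r_def)
    moreover have "sword n (r 0) K = sword n f K"
      unfolding sword_def by (rule seqword_cong) (use h0 frac in \<open>auto simp: r_def\<close>)
    ultimately show ?thesis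
      using hol_eq [of n "r 0" K] hol_eq [of n f K] goodr [of 0] Yr [of 0] by simp
  qed
  moreover have "hol n (r K) = hol n g"
  proof -
    have rK: "r K t = g t" if "t \<in> {0..1}" for t
      using that h1 K by (simp add: r_def)
    have "good n g K"
      using goodr [of K] rK by (auto simp: good_def)
    moreover have "path_image g \<subseteq> Y1"
      using Yr [of K] rK by (auto simp: path_image_def)
    moreover have "sword n (r K) K = sword n g K"
      unfolding sword_def by (rule seqword_cong) (use rK frac in auto)
    ultimately show ?thesis
      using hol_eq [of n "r K" K] hol_eq [of n g K] goodr [of K] Yr [of K] by simp
  qed
  ultimately show ?thesis by simp
qed

text \<open>With \<open>K + K\<close> samples the junction is itself a sample, so already the
  unreduced words concatenate.\<close>

lemma hol_join:
  assumes f: "path f" "path_image f \<subseteq> Y1" and g: "path g" "path_image g \<subseteq> Y1"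
    and fg: "pathfinish f = pathstart g"
  shows "hol n (f +++ g) = red (hol n f @ hol n g)"
proof -
  have Y: "path_image (f +++ g) \<subseteq> Y1"
    using f g fg by (simp add: path_image_join)
  obtain K1 K2 K3 where K: "good n f K1" "good n g K2" "good n (f +++ g) K3"
    using ex_good [OF f(1)] ex_good [OF g(1)] ex_good [OF path_join_imp [OF f(1) g(1) fg]] by blast
  define K where "K = K1 + K2 + K3"
  have good: "good n f K" "good n g K" "good n (f +++ g) (K + K)"
    using K by (auto simp: K_def intro: good_mono)
  have K0: "K > 0"
    using good(1) by (simp add: good_def)
  have "sword n (f +++ g) (K + K) = sword n f K @ sword n g K"
  proof -
    let ?p = "\<lambda>k. (f +++ g) (real k / real (K + K))"
    have "sword n (f +++ g) (K + K) = seqword n ?p 0 K @ seqword n ?p K (K + K)"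
      by (simp add: sword_def seqword_append)
    also have "seqword n ?p 0 K = sword n f K"
      unfolding sword_def
    proof (rule seqword_cong)
      fix k assume "0 \<le> k" "k \<le> K"
      then show "cls n (?p k) = cls n (f (real k / real K))"
        using K0 by (simp add: joinpaths_def field_simps)
    qed
    also have "seqword n ?p K (K + K) = seqword n (\<lambda>k. ?p (k + K)) 0 K"
      using seqword_shift [of n ?p 0 K K] by simp
    also have "\<dots> = sword n g K"
      unfolding sword_def
    proof (rule seqword_cong)
      fix k assume "0 \<le> k" "k \<le> K"
      show "cls n (?p (k + K)) = cls n (g (real k / real K))"
      proof (cases "k = 0")
        case True
        then show ?thesis
          using K0 fg by (simp add: joinpaths_def pathfinish_def pathstart_def)
      next
        case False
        have "2 * (real (k + K) / real (K + K)) - 1 = real k / real K"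
          using K0 by (simp add: field_simps)
        moreover have "\<not> real (k + K) / real (K + K) \<le> 1 / 2"
          using K0 False by (simp add: field_simps)
        ultimately show ?thesis
          by (simp only: joinpaths_def if_False)
      qed
    qed
    finally show ?thesis .
  qed
  then show ?thesis
    using hol_eq [OF good(1) f(2)] hol_eq [OF good(2) g(2)] hol_eq [OF good(3) Y] by simp
qed

lemma cls_retr:
  assumes "p \<in> Y1" "n \<ge> 1" "n \<le> m"
  shows "cls m (retr n p) = cls n p"
proof (cases "p \<in> wedge n")
  case True
  then show ?thesis
    using assms idx_eq [of p] by (auto simp: retr_def cls_def wedge_iff)
next
  case False
  then show ?thesis
    using assms kap_idx [of p] idx_pos [of p] by (auto simp: retr_def cls_def wedge_iff zero_prod_def [symmetric])
qed

lemma hol_const: "p \<in> Y1 \<Longrightarrow> hol n (\<lambda>_. p) = []"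
proof -
  assume p: "p \<in> Y1"
  have "good n (\<lambda>_. p) 1"
    by (simp add: good_def eta_pos)
  then have "hol n (\<lambda>_. p) = red (sword n (\<lambda>_. p) 1)"
    using p by (intro hol_eq) (auto simp: path_image_def)
  then show ?thesis
    by (simp add: sword_def seqword_def)
qed

section \<open>Contracting a path along a height function\<close>

text \<open>If \<open>h\<close> is a height function for \<open>f\<close>, then \<open>f\<close> factors through the tree coded by \<open>h\<close>, and the
  homotopy moves each point of that tree towards the root.\<close>

lemma height_function_null:
  fixes f :: "real \<Rightarrow> 'a::metric_space" and h :: "real \<Rightarrow> real"
  assumes f: "path f" and h: "continuous_on {0..1} h" and h01: "h 0 = 0" "h 1 = 0"
    and hpos: "\<And>t. 0 \<le> t \<Longrightarrow> t \<le> 1 \<Longrightarrow> 0 \<le> h t"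
    and hf: "\<And>s t. \<lbrakk>0 \<le> s; s \<le> t; t \<le> 1; h s = h t; \<And>v. s \<le> v \<Longrightarrow> v \<le> t \<Longrightarrow> h s \<le> h v\<rbrakk> \<Longrightarrow> f s = f t"
  shows "homotopic_paths (path_image f) f (\<lambda>_. f 0)"
proof -
  \<comment> \<open>A pair \<open>(t, r)\<close> stands for the point at height \<open>r\<close> on
    the branch from the root to the tree point of \<open>t\<close>.\<close>
  define D where "D = {(t, r). 0 \<le> t \<and> t \<le> 1 \<and> 0 \<le> r \<and> r \<le> h t}"
  have "\<exists>u. 0 \<le> u \<and> u \<le> t \<and> h u = r \<and> (\<forall>y. u \<le> y \<and> y \<le> t \<longrightarrow> r \<le> h y) \<and>
      (\<forall>v. 0 \<le> v \<and> v \<le> t \<and> h v \<le> r \<longrightarrow> v \<le> u)" if "(t, r) \<in> D" for t r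
  proof -
    have tr: "0 \<le> t" "t \<le> 1" "0 \<le> r" "r \<le> h t"
      using that by (auto simp: D_def)
    have ht: "continuous_on {0..t} h"
      by (rule continuous_on_subset [OF h]) (use tr in auto)
    \<comment> \<open>The time sought is the last one before \<open>t\<close> with height at most
      \<open>r\<close>: it represents the point at height \<open>r\<close> on the branch of
      \<open>t\<close>.\<close>
    define V where "V = {v \<in> {0..t}. h v \<le> r}"
    have "closed V"
      unfolding V_def using continuous_on_closed_Collect_le [OF ht continuous_on_const] by auto
    moreover have "V \<subseteq> {0..t}"
      by (auto simp: V_def)
    ultimately have "compact V"
      by (meson bounded_closed_interval bounded_subset compact_eq_bounded_closed)
    moreover have "0 \<in> V"
      using tr h01 by (auto simp: V_def)
    ultimately obtain u where u: "u \<in> V" "\<And>v. v \<in> V \<Longrightarrow> v \<le> u"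
      by (metis compact_attains_sup empty_iff)
    then have u': "0 \<le> u" "u \<le> t" "h u \<le> r"
      by (auto simp: V_def)
    have "continuous_on {u..t} h"
      by (rule continuous_on_subset [OF ht]) (use u' in auto)
    then obtain v where "u \<le> v" "v \<le> t" "h v = r"
      using IVT' [of h u r t] u' tr by blast
    then have "v = u"
      using u(2) [of v] u' by (auto simp: V_def)
    then have "h u = r"
      using \<open>h v = r\<close> by simp
    moreover have "r \<le> h y" if "u \<le> y" "y \<le> t" for y
      using u(2) [of y] that u' \<open>h u = r\<close> by (cases "y = u") (force simp: V_def)+
    ultimately show ?thesis
      using u u' by (intro exI [of _ u]) (auto simp: V_def)
  qed
  then have "\<forall>z\<in>D. \<exists>u. (\<lambda>z u. 0 \<le> u \<and> u \<le> fst z \<and> h u = snd z \<and> (\<forall>y. u \<le> y \<and> y \<le> fst z \<longrightarrow> snd z \<le> h y) \<and>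
      (\<forall>v. 0 \<le> v \<and> v \<le> fst z \<and> h v \<le> snd z \<longrightarrow> v \<le> u)) z u" (is "\<forall>z\<in>D. \<exists>u. ?Q z u")
    by (simp add: split_paired_all)
  then have "\<exists>u. \<forall>z\<in>D. ?Q z (u z)"
    by (rule bchoice)
  then obtain u where "\<forall>z\<in>D. ?Q z (u z)" ..
  then have u: "\<And>t r. (t, r) \<in> D \<Longrightarrow> 0 \<le> u (t, r) \<and> u (t, r) \<le> t \<and> h (u (t, r)) = r \<and>
      (\<forall>y. u (t, r) \<le> y \<and> y \<le> t \<longrightarrow> r \<le> h y) \<and> (\<forall>v. 0 \<le> v \<and> v \<le> t \<and> h v \<le> r \<longrightarrow> v \<le> u (t, r))"
    by force
  \<comment> \<open>The map \<open>u\<close> itself may jump; only \<open>f \<circ> u\<close> is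
    continuous. A limit \<open>l\<close> of values of \<open>u\<close> has the same height as
    \<open>u a\<close>, and \<open>h\<close> does not dip below it in between, so \<open>hf\<close>
    identifies the two values of \<open>f\<close>.\<close>
  have "continuous_on D (f \<circ> u)"
    unfolding continuous_on_sequentially
  proof (intro allI ballI impI, elim conjE)
    fix x :: "nat \<Rightarrow> real \<times> real" and a assume a: "a \<in> D" and xD: "\<forall>n. x n \<in> D" and xa: "x \<longlonglongrightarrow> a"
    show "((f \<circ> u) \<circ> x) \<longlonglongrightarrow> (f \<circ> u) a"
    proof (rule ccontr)
      assume "\<not> ?thesis"
      then obtain U where U: "open U" "f (u a) \<in> U" "\<not> eventually (\<lambda>n. f (u (x n)) \<in> U) sequentially"
        unfolding tendsto_def by auto
      obtain r :: "nat \<Rightarrow> nat" where r: "strict_mono r" "\<And>n. f (u (x (r n))) \<notin> U"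
        using not_eventually_sequentiallyD [OF U(3)] by blast
      have "u (x (r n)) \<in> {0..1}" for n
      proof -
        obtain t q where "x (r n) = (t, q)" by fastforce
        moreover have "(t, q) \<in> D" using xD calculation by metis
        ultimately show ?thesis using u [of t q] by (auto simp: D_def)
      qed
      then obtain l s where l: "l \<in> {0..1}" "strict_mono s" "((\<lambda>n. u (x (r n))) \<circ> s) \<longlonglongrightarrow> l"
        using compact_imp_seq_compact [of "{0..1::real}"] unfolding seq_compact_def by (metis compact_Icc)
      define y where "y n = x (r (s n))" for n
      have yD: "y n \<in> D" for n using xD by (simp add: y_def)
      have ya: "y \<longlonglongrightarrow> a"
        using LIMSEQ_subseq_LIMSEQ [OF LIMSEQ_subseq_LIMSEQ [OF xa r(1)] l(2)] by (simp add: y_def [abs_def] o_def)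
      have uy: "(\<lambda>n. u (y n)) \<longlonglongrightarrow> l"
        using l(3) by (simp add: y_def o_def)
      have Y: "0 \<le> u (y n) \<and> u (y n) \<le> fst (y n) \<and> h (u (y n)) = snd (y n) \<and> fst (y n) \<le> 1 \<and>
          (\<forall>z. u (y n) \<le> z \<and> z \<le> fst (y n) \<longrightarrow> snd (y n) \<le> h z)" for n
      proof -
        obtain t q where "y n = (t, q)" by fastforce
        moreover have "(t, q) \<in> D" using yD calculation by metis
        ultimately show ?thesis using u [of t q] by (auto simp: D_def)
      qed
      have y01: "u (y n) \<in> {0..1}" for n
        using Y [of n] by auto
      obtain t q where tq: "a = (t, q)" by fastforce
      have tq': "0 \<le> t" "t \<le> 1" "0 \<le> q" "q \<le> h t" and ua: "0 \<le> u a" "u a \<le> t" "h (u a) = q"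
        "\<And>v. 0 \<le> v \<Longrightarrow> v \<le> t \<Longrightarrow> h v \<le> q \<Longrightarrow> v \<le> u a"
        using a u [of t q] unfolding tq by (auto simp: D_def)
      have yt: "(\<lambda>n. fst (y n)) \<longlonglongrightarrow> t" and yq: "(\<lambda>n. snd (y n)) \<longlonglongrightarrow> q"
        using tendsto_fst [OF ya] tendsto_snd [OF ya] tq by auto
      have "l \<le> t"
        by (rule LIMSEQ_le [OF uy yt]) (use Y in auto)
      have "(\<lambda>n. h (u (y n))) \<longlonglongrightarrow> h l"
        by (rule continuous_on_tendsto_compose [OF h uy l(1)]) (use y01 in auto)
      moreover have "(\<lambda>n. h (u (y n))) \<longlonglongrightarrow> q"
        using yq Y by simp
      ultimately have hl: "h l = q"
        using LIMSEQ_unique by blast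
      \<comment> \<open>Such a \<open>z\<close> eventually lies between \<open>u (y n)\<close> and
        \<open>fst (y n)\<close>, where \<open>h\<close> is at least
        \<open>snd (y n)\<close>.\<close>
      have ge: "q \<le> h z" if z: "l < z" "z < t" for z
      proof -
        have "\<forall>\<^sub>F n in sequentially. u (y n) < z" "\<forall>\<^sub>F n in sequentially. z < fst (y n)"
          using order_tendstoD uy yt z by blast+
        then have "\<forall>\<^sub>F n in sequentially. snd (y n) \<le> h z"
          by eventually_elim (use Y in auto)
        then show ?thesis
          using tendsto_upperbound [OF yq] by auto
      qed
      have "l \<le> u a"
        using ua(4) l(1) \<open>l \<le> t\<close> hl by auto
      moreover have "h l \<le> h v" if "l \<le> v" "v \<le> u a" for v
      proof (cases "v = l \<or> v = t")
        case True
        then show ?thesis using hl tq' by auto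
      next
        case False
        then show ?thesis using ge [of v] that ua hl by auto
      qed
      ultimately have "f l = f (u a)"
        using hf [of l "u a"] l(1) ua tq' hl by auto
      moreover have "(\<lambda>n. f (u (y n))) \<longlonglongrightarrow> f l"
        by (rule continuous_on_tendsto_compose [OF f [unfolded path_def] uy l(1)]) (use y01 in auto)
      ultimately have "\<forall>\<^sub>F n in sequentially. f (u (y n)) \<in> U"
        using U by (auto simp: tendsto_def)
      then show False
        using r(2) by (auto simp: y_def eventually_sequentially)
    qed
  qed
  \<comment> \<open>The homotopy at time \<open>s\<close> moves the point of \<open>t\<close> down
    to height \<open>(1 - s) * h t\<close>.\<close>
  moreover have D: "(t, (1 - s) * h t) \<in> D" if "s \<in> {0..1}" "t \<in> {0..1}" for s t
    using that hpos [of t] by (auto simp: D_def mult_left_le_one_le)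
  moreover have "continuous_on ({0..1} \<times> {0..1}) (\<lambda>z. (snd z, (1 - fst z) * h (snd z)))"
    by (intro continuous_intros continuous_on_compose2 [OF h]) auto
  ultimately have cont: "continuous_on ({0..1} \<times> {0..1}) (\<lambda>z. f (u (snd z, (1 - fst z) * h (snd z))))"
    using continuous_on_compose2 [of D "\<lambda>z. f (u z)" "{0..1} \<times> {0..1}" "\<lambda>z. (snd z, (1 - fst z) * h (snd z))"]
    by (fastforce simp: o_def)
  show ?thesis
    unfolding homotopic_paths
  proof (intro exI conjI ballI)
    show "continuous_on ({0..1} \<times> {0..1}) (\<lambda>z. f (u (snd z, (1 - fst z) * h (snd z))))"
      by (rule cont)
    show "(\<lambda>z. f (u (snd z, (1 - fst z) * h (snd z)))) \<in> {0..1} \<times> {0..1} \<rightarrow> path_image f"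
    proof
      fix z :: "real \<times> real" assume "z \<in> {0..1} \<times> {0..1}"
      then have z: "fst z \<in> {0..1}" "snd z \<in> {0..1}" by auto
      have "u (snd z, (1 - fst z) * h (snd z)) \<in> {0..1}"
        using u [OF D [OF z]] z by auto
      then show "f (u (snd z, (1 - fst z) * h (snd z))) \<in> path_image f"
        by (simp add: path_image_def)
    qed
    fix t :: real assume t: "t \<in> {0..1}"
    have "u (t, h t) = t"
      using u [of t "h t"] D [of 0 t] t by (force intro: antisym)
    then show "f (u (snd (0, t), (1 - fst (0, t)) * h (snd (0, t)))) = f t"
      by simp
    have "f 0 = f (u (t, 0))"
      using u [of t 0] D [of 1 t] t h01 hpos by (intro hf) auto
    then show "f (u (snd (1, t), (1 - fst (1, t)) * h (snd (1, t)))) = f 0"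
      by simp
    have "u (0, 0) = 0"
      using u [of 0 0] D [of t 0] t h01 by auto
    then show "pathstart ((\<lambda>z. f (u (snd z, (1 - fst z) * h (snd z)))) \<circ> Pair t) = pathstart f"
      by (simp add: pathstart_def h01)
    have "u (1, 0) = 1"
      using u [of 1 0] D [of t 1] t h01 by (force intro: antisym)
    then show "pathfinish ((\<lambda>z. f (u (snd z, (1 - fst z) * h (snd z)))) \<circ> Pair t) = pathfinish f"
      by (simp add: pathfinish_def h01)
  qed
qed


section \<open>Lifts to trees\<close>

abbreviation lab :: "letter list \<Rightarrow> nat" where
  "lab e \<equiv> fst (hd e)"

text \<open>The vertex belonging to a time will be the word of the path still to be run, so moving
  along the edge from \<open>v\<close> to \<open>a # v\<close> runs the letter \<open>a\<close>
  backwards; hence -1 for a positive letter.\<close>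

definition sg :: "letter list \<Rightarrow> real" where
  "sg e = (if snd (hd e) then - 1 else 1)"

text \<open>The nonempty reduced word \<open>a # v\<close> stands for the edge of the Cayley tree from \<open>v\<close> to \<open>a # v\<close>, and
  \<open>\<phi> e t\<close> for the part of the edge \<open>e\<close> covered by the geodesic from the root to the lift of \<open>f t\<close>.\<close>

locale tree_lift =
  fixes n :: nat and f :: "real \<Rightarrow> pt" and E :: "letter list set" and \<phi> :: "letter list \<Rightarrow> real \<Rightarrow> real"
  assumes finE: "finite E"
    and E_ne: "e \<in> E \<Longrightarrow> e \<noteq> []"
    and E_lab: "e \<in> E \<Longrightarrow> 1 \<le> lab e \<and> lab e \<le> n"
    and E_tl: "e \<in> E \<Longrightarrow> tl e \<noteq> [] \<Longrightarrow> tl e \<in> E"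
    and cont: "e \<in> E \<Longrightarrow> continuous_on {0..1} (\<phi> e)"
    and range: "e \<in> E \<Longrightarrow> t \<in> {0..1} \<Longrightarrow> 0 \<le> \<phi> e t \<and> \<phi> e t \<le> 1"
    and parent: "e \<in> E \<Longrightarrow> t \<in> {0..1} \<Longrightarrow> 0 < \<phi> e t \<Longrightarrow> tl e \<noteq> [] \<Longrightarrow> \<phi> (tl e) t = 1"
    and comparable: "e \<in> E \<Longrightarrow> e' \<in> E \<Longrightarrow> t \<in> {0..1} \<Longrightarrow> 0 < \<phi> e t \<Longrightarrow> 0 < \<phi> e' t \<Longrightarrow> suffix e e' \<or> suffix e' e"
    and on_edge: "e \<in> E \<Longrightarrow> t \<in> {0..1} \<Longrightarrow> 0 < \<phi> e t \<Longrightarrow> \<phi> e t < 1 \<Longrightarrow> f t = std_loop (lab e) (sg e * \<phi> e t)"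
    and ex_edge: "t \<in> {0..1} \<Longrightarrow> f t \<noteq> 0 \<Longrightarrow> kap (f t) = real i \<Longrightarrow> i \<le> n \<Longrightarrow>
      \<exists>e\<in>E. lab e = i \<and> 0 < \<phi> e t \<and> \<phi> e t < 1"
    and ends: "e \<in> E \<Longrightarrow> \<phi> e 0 = 0 \<and> \<phi> e 1 = 0"

begin

lemma ancestor:
  assumes "suffix e e'" "e \<noteq> e'" "e' \<in> E" "e \<in> E" "t \<in> {0..1}" "0 < \<phi> e' t"
  shows "\<phi> e t = 1"
  using assms
proof (induction e')
  case (Cons a v)
  then have s: "suffix e v"
    by (simp add: suffix_Cons)
  then have "v \<noteq> []"
    using E_ne [OF Cons.prems(4)] by auto
  then have "\<phi> v t = 1" "v \<in> E"
    using parent [OF Cons.prems(3,5,6)] E_tl [OF Cons.prems(3)] by auto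
  then show ?case
    using Cons.IH [OF s] Cons.prems by (cases "e = v") auto
qed simp

text \<open>Were \<open>e'\<close> strictly beyond \<open>e\<close>, then \<open>ancestor\<close>
  would make \<open>e\<close> completely covered. So a partly covered edge is the last one of its
  geodesic, and at each time there is at most one.\<close>

lemma partial_edge:
  assumes "e \<in> E" "e' \<in> E" "t \<in> {0..1}" "0 < \<phi> e t" "\<phi> e t < 1" "0 < \<phi> e' t"
  shows "suffix e' e"
  using comparable [OF assms(1,2,3,4,6)] ancestor [of e e' t] assms by fastforce

lemma partial_edge_unique:
  assumes "e \<in> E" "e' \<in> E" "t \<in> {0..1}" "0 < \<phi> e t" "\<phi> e t < 1" "0 < \<phi> e' t" "\<phi> e' t < 1"
  shows "e = e'"
  using partial_edge assms by (meson suffix_order.antisym)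

lemma phi_ivt:
  assumes e: "e \<in> E" and st: "s \<in> {0..1}" "t \<in> {0..1}"
    and c: "min (\<phi> e s) (\<phi> e t) \<le> c" "c \<le> max (\<phi> e s) (\<phi> e t)"
  obtains v where "min s t \<le> v" "v \<le> max s t" "\<phi> e v = c" "v \<in> {0..1}"
proof -
  have "continuous_on {min s t..max s t} (\<phi> e)"
    by (rule continuous_on_subset [OF cont [OF e]]) (use st in auto)
  then have "connected (\<phi> e ` {min s t..max s t})"
    by (rule connected_continuous_image) simp
  moreover have "min (\<phi> e s) (\<phi> e t) \<in> \<phi> e ` {min s t..max s t}" "max (\<phi> e s) (\<phi> e t) \<in> \<phi> e ` {min s t..max s t}"
    by (auto simp: min_def max_def)
  ultimately have "c \<in> \<phi> e ` {min s t..max s t}"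
    using connectedD_interval c by blast
  then show ?thesis
    using that st by force
qed

definition height :: "(nat \<Rightarrow> real) \<Rightarrow> real \<Rightarrow> real" where
  "height l t = (\<Sum>e\<in>E. l (lab e) * \<phi> e t)"

text \<open>The common part of the two geodesics from the root cancels; what remains is the length
  with label \<open>i\<close> of the geodesic between the lifts of \<open>f s\<close> and
  \<open>f t\<close>, edges having length 1.\<close>

definition edist :: "nat \<Rightarrow> real \<Rightarrow> real \<Rightarrow> real" where
  "edist i s t = (\<Sum>e | e \<in> E \<and> lab e = i. \<bar>\<phi> e s - \<phi> e t\<bar>)"

lemma continuous_on_height: "continuous_on {0..1} (height l)"
  unfolding height_def by (intro continuous_intros cont)

lemma height_nonneg: "(\<And>i. 0 < l i) \<Longrightarrow> t \<in> {0..1} \<Longrightarrow> 0 \<le> height l t"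
  unfolding height_def by (intro sum_nonneg mult_nonneg_nonneg) (use range in \<open>auto intro: less_imp_le\<close>)

lemma height_ends: "height l 0 = 0" "height l 1 = 0"
  using ends by (simp_all add: height_def)

text \<open>To reach \<open>x\<close> outside the part of \<open>e\<close> covered at
  \<open>u\<close>, the lift must back down along \<open>e\<close>, and at such a time the height
  would be smaller. Thus the lift at a minimum lies on the geodesic from the root to every lift over
  the interval.\<close>

lemma minimum_below:
  assumes l: "\<And>i. 0 < l i" and u: "u \<in> {a..b}" "{a..b} \<subseteq> {0..1}"
    and min: "\<And>v. v \<in> {a..b} \<Longrightarrow> height l u \<le> height l v"
    and x: "x \<in> {a..b}" and e: "e \<in> E"
  shows "\<phi> e u \<le> \<phi> e x"
proof (rule ccontr)
  assume N: "\<not> \<phi> e u \<le> \<phi> e x"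
  \<comment> \<open>Strictly between 0 and 1, so at the time \<open>v\<close> below the edge
    \<open>e\<close> is the last one, and all edges covered at \<open>v\<close> are covered at least
    as much at \<open>u\<close>.\<close>
  define c where "c = (\<phi> e u + \<phi> e x) / 2"
  have ux: "u \<in> {0..1}" "x \<in> {0..1}"
    using u x by auto
  have c: "0 < c" "c < 1" "c < \<phi> e u"
    using N range [OF e ux(1)] range [OF e ux(2)] by (auto simp: c_def)
  obtain v where v: "min u x \<le> v" "v \<le> max u x" "\<phi> e v = c" "v \<in> {0..1}"
    by (rule phi_ivt [OF e ux, of c]) (use N in \<open>auto simp: c_def\<close>)
  have vab: "v \<in> {a..b}"
    using v u x by auto
  have le: "\<phi> e' v \<le> \<phi> e' u" if e': "e' \<in> E" for e'
  proof (cases "e' = e \<or> \<phi> e' v \<le> 0")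
    case True
    then show ?thesis
      using c v range [OF e' ux(1)] by auto
  next
    case False
    then have "suffix e' e"
      using partial_edge [OF e e' v(4)] c v by auto
    then have "\<phi> e' u = 1"
      using ancestor [of e' e u] False e e' ux c by auto
    then show ?thesis
      using range [OF e' v(4)] by simp
  qed
  have "height l v < height l u"
    unfolding height_def
  proof (rule sum_strict_mono_ex1 [OF finE])
    show "\<forall>e\<in>E. l (lab e) * \<phi> e v \<le> l (lab e) * \<phi> e u"
      using le l by (simp add: less_imp_le)
    show "\<exists>e\<in>E. l (lab e) * \<phi> e v < l (lab e) * \<phi> e u"
      using e v c l by (intro bexI [of _ e]) auto
  qed
  then show False
    using min [OF vab] by simp
qed

lemma sum_labels:
  "(\<Sum>e\<in>E. l (lab e) * \<bar>\<phi> e s - \<phi> e t\<bar>) = (\<Sum>i\<in>{1..n}. l i * edist i s t)"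
proof -
  have "(\<Sum>i\<in>{1..n}. l i * edist i s t) = (\<Sum>i\<in>{1..n}. \<Sum>e\<in>{e \<in> E. lab e = i}. l (lab e) * \<bar>\<phi> e s - \<phi> e t\<bar>)"
    unfolding edist_def by (intro sum.cong refl) (simp add: sum_distrib_left)
  also have "\<dots> = (\<Sum>e\<in>E. l (lab e) * \<bar>\<phi> e s - \<phi> e t\<bar>)"
    by (rule sum.group [OF finE]) (use E_lab in auto)
  finally show ?thesis ..
qed

lemma height_diff_le:
  assumes l: "\<And>i. 0 < l i"
  shows "\<bar>height l s - height l t\<bar> \<le> (\<Sum>i\<in>{1..n}. l i * edist i s t)"
proof -
  have "height l s - height l t = (\<Sum>e\<in>E. l (lab e) * (\<phi> e s - \<phi> e t))"
    by (simp add: height_def sum_subtractf algebra_simps)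
  also have "\<bar>\<dots>\<bar> \<le> (\<Sum>e\<in>E. l (lab e) * \<bar>\<phi> e s - \<phi> e t\<bar>)"
    using l by (intro order_trans [OF sum_abs]) (simp add: abs_mult less_imp_le)
  finally show ?thesis
    by (simp only: sum_labels)
qed

lemma edist_nonneg: "0 \<le> edist i s t"
  unfolding edist_def by (intro sum_nonneg) auto

lemma edist_triangle: "edist i s t \<le> edist i s u + edist i u t"
  unfolding edist_def sum.distrib [symmetric] by (intro sum_mono) auto

text \<open>At the minimum \<open>u\<close>, each \<open>\<phi> e u\<close> is below both
  \<open>\<phi> e s\<close> and \<open>\<phi> e t\<close>, and
  \<open>\<bar>x - y\<bar> \<le> x + y - 2 * m\<close> whenever \<open>m\<close> is below
  \<open>x\<close> and \<open>y\<close>. So ends of equal height with hardly a dip between them have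
  nearby lifts.\<close>

lemma height_minimum_ge:
  assumes l: "\<And>i. 0 < l i" and st: "0 \<le> s" "s \<le> t" "t \<le> 1"
  obtains u where "s \<le> u" "u \<le> t"
    "(\<Sum>i\<in>{1..n}. l i * edist i s t) \<le> height l s + height l t - 2 * height l u"
proof -
  have "continuous_on {s..t} (height l)"
    by (rule continuous_on_subset [OF continuous_on_height]) (use st in auto)
  then obtain u where u: "u \<in> {s..t}" "\<And>v. v \<in> {s..t} \<Longrightarrow> height l u \<le> height l v"
    using continuous_attains_inf [of "{s..t}" "height l"] st by auto
  have below: "\<phi> e u \<le> \<phi> e s" "\<phi> e u \<le> \<phi> e t" if "e \<in> E" for e
    by (rule minimum_below [OF l u(1) _ u(2) _ that]; use st in auto)+
  have "(\<Sum>e\<in>E. l (lab e) * \<bar>\<phi> e s - \<phi> e t\<bar>) \<le> (\<Sum>e\<in>E. l (lab e) * (\<phi> e s + \<phi> e t - 2 * \<phi> e u))"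
    using l by (intro sum_mono mult_left_mono) (force intro: less_imp_le simp: abs_le_iff dest: below)+
  also have "\<dots> = height l s + height l t - 2 * height l u"
    by (simp add: height_def sum_subtractf sum.distrib sum_distrib_left algebra_simps)
  finally have "(\<Sum>i\<in>{1..n}. l i * edist i s t) \<le> height l s + height l t - 2 * height l u"
    by (simp only: sum_labels)
  then show ?thesis
    by (intro that [of u]) (use u(1) in auto)
qed

end

section \<open>The position on a single circle in terms of the lift\<close>

lemma std_loop_Lipschitz:
  assumes "i \<ge> 1"
  shows "dist (std_loop i x) (std_loop i y) \<le> 4 * pi * \<bar>x - y\<bar>"
proof -
  have *: "\<bar>cos a - cos b\<bar> \<le> \<bar>a - b\<bar>" "\<bar>sin a - sin b\<bar> \<le> \<bar>a - b\<bar>" for a b :: real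
  proof -
    have "norm (cos a - cos b) \<le> 1 * norm (a - b)"
      by (rule field_differentiable_bound [of UNIV cos "\<lambda>x. - sin x"])
        (auto intro!: derivative_eq_intros)
    then show "\<bar>cos a - cos b\<bar> \<le> \<bar>a - b\<bar>" by simp
    have "norm (sin a - sin b) \<le> 1 * norm (a - b)"
      by (rule field_differentiable_bound [of UNIV sin "cos"])
        (auto intro!: derivative_eq_intros)
    then show "\<bar>sin a - sin b\<bar> \<le> \<bar>a - b\<bar>" by simp
  qed
  have i: "1 / real i \<le> 1" "0 < real i"
    using assms by auto
  have **: "\<bar>z / real i\<bar> \<le> \<bar>z\<bar>" for z
    using i mult_left_mono [of "1 / real i" 1 "\<bar>z\<bar>"] by (simp add: abs_divide)
  have "dist (std_loop i x) (std_loop i y) \<le>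
      \<bar>(cos (2 * pi * y) - cos (2 * pi * x)) / real i\<bar> + \<bar>(sin (2 * pi * x) - sin (2 * pi * y)) / real i\<bar>"
    using sqrt_sum_squares_le_sum_abs [of "(cos (2 * pi * y) - cos (2 * pi * x)) / real i" "(sin (2 * pi * x) - sin (2 * pi * y)) / real i"]
    by (simp add: std_loop_def dist_Pair_Pair dist_real_def diff_divide_distrib)
  also have "\<dots> \<le> \<bar>cos (2 * pi * y) - cos (2 * pi * x)\<bar> + \<bar>sin (2 * pi * x) - sin (2 * pi * y)\<bar>"
    by (intro add_mono **)
  also have "\<dots> \<le> \<bar>2 * pi * y - 2 * pi * x\<bar> + \<bar>2 * pi * x - 2 * pi * y\<bar>"
    by (intro add_mono *)
  also have "\<dots> = 4 * pi * \<bar>x - y\<bar>"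
  proof -
    have "\<bar>2 * pi * y - 2 * pi * x\<bar> = 2 * pi * \<bar>x - y\<bar>" "\<bar>2 * pi * x - 2 * pi * y\<bar> = 2 * pi * \<bar>x - y\<bar>"
      by (simp_all add: right_diff_distrib [symmetric] abs_mult abs_minus_commute del: right_diff_distrib_numeral)
    then show ?thesis by simp
  qed
  finally show ?thesis .
qed

lemma std_loop_add_int: "std_loop i (x + of_int k) = std_loop i x"
proof -
  have "2 * pi * (x + of_int k) = 2 * pi * x + of_int k * (2 * pi)"
    by (simp add: algebra_simps)
  moreover have "cos (a + of_int k * (2 * pi)) = cos a" "sin (a + of_int k * (2 * pi)) = sin a" for a
    using cos.plus_of_int [of a k] sin.plus_of_int [of a k] by simp_all
  ultimately show ?thesis
    by (simp only: std_loop_def)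
qed

definition circ :: "nat \<Rightarrow> pt \<Rightarrow> pt" where
  "circ i p = (if kap p = real i then p else 0)"

lemma norm_std_loop_sq:
  "(norm (std_loop i t))\<^sup>2 = (2 - 2 * cos (2 * pi * t)) / (real i)\<^sup>2"
proof -
  have "(norm (std_loop i t))\<^sup>2 = ((1 - cos (2 * pi * t)) / real i)\<^sup>2 + (sin (2 * pi * t) / real i)\<^sup>2"
    by (simp add: norm_sq_pt std_loop_def diff_divide_distrib)
  also have "\<dots> = ((1 - cos (2 * pi * t))\<^sup>2 + (sin (2 * pi * t))\<^sup>2) / (real i)\<^sup>2"
    by (simp add: power_divide add_divide_distrib)
  also have "(1 - cos (2 * pi * t))\<^sup>2 + (sin (2 * pi * t))\<^sup>2 = 2 - 2 * cos (2 * pi * t)"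
    using sin_cos_squared_add [of "2 * pi * t"] by (simp add: power2_diff)
  finally show ?thesis .
qed

lemma kap_std_loop:
  assumes "i \<ge> 1" "std_loop i t \<noteq> 0"
  shows "kap (std_loop i t) = real i"
proof -
  have "2 - 2 * cos (2 * pi * t) \<noteq> 0"
    using assms norm_std_loop_sq [of i t] by auto
  moreover have "fst (std_loop i t) = (2 - 2 * cos (2 * pi * t)) / (2 * real i)"
    by (simp add: std_loop_def diff_divide_distrib)
  moreover have "2 * (c / (2 * real i)) / (c / (real i)\<^sup>2) = real i" if "c \<noteq> 0" for c
    using that assms(1) by (simp add: power2_eq_square)
  ultimately show ?thesis
    unfolding kap_def norm_std_loop_sq by metis
qed

lemma circ_std_loop: "i \<ge> 1 \<Longrightarrow> circ i (std_loop i t) = std_loop i t"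
  using kap_std_loop [of i t] by (auto simp: circ_def)

context tree_lift
begin

text \<open>Fully covered edges contribute whole turns, which \<open>std_loop\<close> does not see;
  at most one edge is partly covered, and it gives the position on its circle.\<close>

lemma circ_eq_std_loop:
  assumes t: "t \<in> {0..1}" and i: "1 \<le> i" "i \<le> n"
  shows "circ i (f t) = std_loop i (\<Sum>e | e \<in> E \<and> lab e = i. sg e * \<phi> e t)"
proof -
  have int: "sg e * \<phi> e t \<in> \<int>" if "e \<in> E" "\<not> (0 < \<phi> e t \<and> \<phi> e t < 1)" for e
  proof -
    have "\<phi> e t = 0 \<or> \<phi> e t = 1"
      using range [OF that(1) t] that(2) by auto
    then show ?thesis
      by (auto simp: sg_def)
  qed
  show ?thesis
  proof (cases "\<exists>e\<in>E. lab e = i \<and> 0 < \<phi> e t \<and> \<phi> e t < 1")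
    case True
    then obtain e where e: "e \<in> E" "lab e = i" "0 < \<phi> e t" "\<phi> e t < 1" by blast
    have "(\<Sum>e | e \<in> E \<and> lab e = i. sg e * \<phi> e t) = sg e * \<phi> e t + (\<Sum>e' \<in> {e'. e' \<in> E \<and> lab e' = i} - {e}. sg e' * \<phi> e' t)"
      using e finE by (intro sum.remove) auto
    moreover have "(\<Sum>e' \<in> {e'. e' \<in> E \<and> lab e' = i} - {e}. sg e' * \<phi> e' t) \<in> \<int>"
      by (intro Ints_sum int) (use partial_edge_unique [OF e(1) _ t e(3,4)] in auto)
    ultimately obtain k :: int where "(\<Sum>e | e \<in> E \<and> lab e = i. sg e * \<phi> e t) = sg e * \<phi> e t + of_int k"
      by (auto elim: Ints_cases)
    then have *: "std_loop i (\<Sum>e | e \<in> E \<and> lab e = i. sg e * \<phi> e t) = f t"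
      using on_edge [OF e(1) t e(3,4)] e(2) by (simp only: std_loop_add_int)
    show ?thesis
      using circ_std_loop [OF i(1)] on_edge [OF e(1) t e(3,4)] e(2) * by metis
  next
    case False
    then have "(\<Sum>e | e \<in> E \<and> lab e = i. sg e * \<phi> e t) \<in> \<int>"
      by (intro Ints_sum int) auto
    then obtain k where "(\<Sum>e | e \<in> E \<and> lab e = i. sg e * \<phi> e t) = 0 + of_int k"
      by (auto elim: Ints_cases)
    then have "std_loop i (\<Sum>e | e \<in> E \<and> lab e = i. sg e * \<phi> e t) = std_loop i 0"
      by (simp only: std_loop_add_int)
    moreover have "circ i (f t) = 0"
      using ex_edge [OF t, of i] False i by (auto simp: circ_def)
    ultimately show ?thesis
      by (simp add: std_loop_def zero_prod_def)
  qed
qed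

lemma dist_circ_le:
  assumes "s \<in> {0..1}" "t \<in> {0..1}" "1 \<le> i" "i \<le> n"
  shows "dist (circ i (f s)) (circ i (f t)) \<le> 4 * pi * edist i s t"
proof -
  let ?S = "{e \<in> E. lab e = i}"
  have "\<bar>(\<Sum>e\<in>?S. sg e * \<phi> e s) - (\<Sum>e\<in>?S. sg e * \<phi> e t)\<bar> = \<bar>\<Sum>e\<in>?S. sg e * (\<phi> e s - \<phi> e t)\<bar>"
    by (simp add: sum_subtractf right_diff_distrib)
  also have "\<dots> \<le> edist i s t"
    unfolding edist_def by (intro order_trans [OF sum_abs] sum_mono) (auto simp: sg_def abs_mult)
  finally have "4 * pi * \<bar>(\<Sum>e\<in>?S. sg e * \<phi> e s) - (\<Sum>e\<in>?S. sg e * \<phi> e t)\<bar> \<le> 4 * pi * edist i s t"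
    by simp
  then show ?thesis
    unfolding circ_eq_std_loop [OF assms(1,3,4)] circ_eq_std_loop [OF assms(2,3,4)]
    by (rule order_trans [OF std_loop_Lipschitz [OF assms(3)]])
qed

end

section \<open>Estimates that are uniform over all levels and lifts\<close>

lemma dist_std_loop_sq:
  "(dist (std_loop i x) (std_loop i y))\<^sup>2 = (2 - 2 * cos (2 * pi * (x - y))) / (real i)\<^sup>2"
proof -
  have "(dist (std_loop i x) (std_loop i y))\<^sup>2 =
      ((cos (2 * pi * y) - cos (2 * pi * x)) / real i)\<^sup>2 + ((sin (2 * pi * x) - sin (2 * pi * y)) / real i)\<^sup>2"
    unfolding dist_norm norm_sq_pt by (simp add: std_loop_def diff_divide_distrib)
  also have "\<dots> = ((cos (2 * pi * y) - cos (2 * pi * x))\<^sup>2 + (sin (2 * pi * x) - sin (2 * pi * y))\<^sup>2) / (real i)\<^sup>2"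
    by (simp add: power_divide add_divide_distrib)
  also have "(cos (2 * pi * y) - cos (2 * pi * x))\<^sup>2 + (sin (2 * pi * x) - sin (2 * pi * y))\<^sup>2
      = 2 - 2 * (cos (2 * pi * x) * cos (2 * pi * y) + sin (2 * pi * x) * sin (2 * pi * y))"
    using sin_cos_squared_add [of "2 * pi * x"] sin_cos_squared_add [of "2 * pi * y"]
    by (simp add: power2_diff algebra_simps)
  also have "cos (2 * pi * x) * cos (2 * pi * y) + sin (2 * pi * x) * sin (2 * pi * y) = cos (2 * pi * (x - y))"
    by (simp add: cos_diff right_diff_distrib)
  finally show ?thesis .
qed

text \<open>The modulus of continuity does not depend on the lift: a large change of \<open>\<phi> e\<close> forces \<open>f\<close> to
  traverse a long arc of a circle, and only the edges containing an endpoint can change at all.\<close>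

lemma edist_equicontinuous:
  assumes f: "path f" and i: "i \<ge> 1" and eps: "0 < \<epsilon>"
  obtains d where "d > 0"
    "\<And>n E \<phi> s t. \<lbrakk>tree_lift n f E \<phi>; s \<in> {0..1}; t \<in> {0..1}; \<bar>s - t\<bar> < d\<rbrakk> \<Longrightarrow> tree_lift.edist E \<phi> i s t \<le> \<epsilon>"
proof -
  \<comment> \<open>At most two edges will contribute, each at most \<open>r\<close>, whence
    \<open>\<epsilon> / 2\<close>. The bound 1/2 prevents an edge from switching between 0 and 1 and
    keeps \<open>2 * pi * r\<close> where cosine decreases.\<close>
  define r where "r = min (\<epsilon> / 2) (1 / 2)"
  have r: "0 < r" "r \<le> 1/2" "2 * r \<le> \<epsilon>"
    using eps by (auto simp: r_def)
  \<comment> \<open>Squared length of the chord of circle \<open>i\<close> between parameters at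
    distance \<open>r\<close>.\<close>
  define k where "k = (2 - 2 * cos (2 * pi * r)) / (real i)\<^sup>2"
  have "cos (2 * pi * r) < cos 0"
    using r by (intro cos_monotone_0_pi) auto
  then have k: "k > 0"
    using i by (simp add: k_def)
  have "uniformly_continuous_on {0..1} f"
    using f by (simp add: path_def compact_uniformly_continuous)
  then obtain d where d: "d > 0" "\<And>v w. \<lbrakk>v \<in> {0..1}; w \<in> {0..1}; dist v w < d\<rbrakk> \<Longrightarrow> dist (f v) (f w) < sqrt k"
    using k unfolding uniformly_continuous_on_def by (metis real_sqrt_gt_zero)
  show ?thesis
  proof
    show "d > 0" by fact
    fix n E \<phi> s t assume T: "tree_lift n f E \<phi>" and st: "s \<in> {0..1}" "t \<in> {0..1}" "\<bar>s - t\<bar> < d"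
    interpret tree_lift n f E \<phi> by (rule T)
    have small: "\<bar>\<phi> e s - \<phi> e t\<bar> \<le> r" if e: "e \<in> E" "lab e = i" for e
    proof (rule ccontr)
      assume N: "\<not> \<bar>\<phi> e s - \<phi> e t\<bar> \<le> r"
      define lo hi where "lo = min (\<phi> e s) (\<phi> e t)" and "hi = max (\<phi> e s) (\<phi> e t)"
      have lohi: "0 \<le> lo" "hi \<le> 1" "hi - lo > r"
        using N range [OF e(1) st(1)] range [OF e(1) st(2)] by (auto simp: lo_def hi_def)
      \<comment> \<open>The interval from \<open>c\<close> to \<open>c + r\<close> is centred in
        that from \<open>lo\<close> to \<open>hi\<close>, so both values are strictly between 0 and
        1 and \<open>on_edge\<close> applies to them.\<close>
      define c where "c = lo + (hi - lo - r) / 2"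
      have c2: "2 * c = lo + hi - r"
        by (simp add: c_def field_simps)
      have c: "lo < c" "c + r < hi" "0 < c" "c + r < 1"
        using lohi c2 by linarith+
      obtain v where v: "min s t \<le> v" "v \<le> max s t" "\<phi> e v = c" "v \<in> {0..1}"
        by (rule phi_ivt [OF e(1) st(1,2), of c]) (use c r in \<open>auto simp: lo_def hi_def\<close>)
      obtain w where w: "min s t \<le> w" "w \<le> max s t" "\<phi> e w = c + r" "w \<in> {0..1}"
        by (rule phi_ivt [OF e(1) st(1,2), of "c + r"]) (use c r in \<open>auto simp: lo_def hi_def\<close>)
      have "dist v w < d"
        using v w st(3) by (auto simp: dist_real_def)
      then have lt: "dist (f v) (f w) < sqrt k"
        using d(2) v w by blast
      have "(dist (f v) (f w))\<^sup>2 = (2 - 2 * cos (2 * pi * (sg e * c - sg e * (c + r)))) / (real i)\<^sup>2"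
        using on_edge [OF e(1) v(4)] on_edge [OF e(1) w(4)] c r v w e(2) dist_std_loop_sq by auto
      also have "cos (2 * pi * (sg e * c - sg e * (c + r))) = cos (2 * pi * r)"
        by (auto simp: sg_def)
      finally have "(dist (f v) (f w))\<^sup>2 = k"
        by (simp add: k_def)
      then have "dist (f v) (f w) = sqrt k"
        by (metis real_sqrt_unique zero_le_dist)
      then show False
        using lt by simp
    qed
    define P where "P t = {e \<in> E. lab e = i \<and> 0 < \<phi> e t \<and> \<phi> e t < 1}" for t
    have P: "card (P t) \<le> 1" "finite (P t)" if "t \<in> {0..1}" for t
    proof -
      show "finite (P t)"
        using finE by (auto simp: P_def)
      then show "card (P t) \<le> 1"
        using partial_edge_unique [OF _ _ that] by (auto simp: P_def card_le_Suc0_iff_eq)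
    qed
    have "edist i s t = (\<Sum>e\<in>P s \<union> P t. \<bar>\<phi> e s - \<phi> e t\<bar>)"
      unfolding edist_def
    proof (rule sum.mono_neutral_right)
      show "finite {e \<in> E. lab e = i}" "P s \<union> P t \<subseteq> {e \<in> E. lab e = i}"
        using finE by (auto simp: P_def)
      show "\<forall>e\<in>{e \<in> E. lab e = i} - (P s \<union> P t). \<bar>\<phi> e s - \<phi> e t\<bar> = 0"
      proof
        fix e assume e: "e \<in> {e \<in> E. lab e = i} - (P s \<union> P t)"
        then have "\<phi> e s = 0 \<or> \<phi> e s = 1" "\<phi> e t = 0 \<or> \<phi> e t = 1"
          using range [of e s] range [of e t] st by (auto simp: P_def)
        moreover have "\<bar>\<phi> e s - \<phi> e t\<bar> \<le> 1/2"
          using small [of e] e r by auto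
        ultimately show "\<bar>\<phi> e s - \<phi> e t\<bar> = 0"
          by auto
      qed
    qed
    also have "\<dots> \<le> (\<Sum>e\<in>P s \<union> P t. r)"
      by (intro sum_mono small) (auto simp: P_def)
    also have "\<dots> = real (card (P s \<union> P t)) * r"
      by simp
    also have "\<dots> \<le> 2 * r"
    proof -
      have "card (P s \<union> P t) \<le> 2"
        using card_Un_le [of "P s" "P t"] P(1) [OF st(1)] P(1) [OF st(2)] by linarith
      then show ?thesis
        using r by (intro mult_right_mono) auto
    qed
    finally show "edist i s t \<le> \<epsilon>"
      using r by simp
  qed
qed

text \<open>The equicontinuity estimate with value 1 is chained over \<open>K\<close> steps shorter
  than its \<open>d\<close>; the resulting bound \<open>K\<close> depends on \<open>f\<close> and
  \<open>i\<close> only.\<close>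

lemma edist_bounded:
  assumes f: "path f" and i: "i \<ge> 1"
  obtains M where "0 \<le> M"
    "\<And>n E \<phi> s t. \<lbrakk>tree_lift n f E \<phi>; s \<in> {0..1}; t \<in> {0..1}\<rbrakk> \<Longrightarrow> tree_lift.edist E \<phi> i s t \<le> M"
proof -
  obtain d where d: "d > 0"
    "\<And>n E \<phi> s t. \<lbrakk>tree_lift n f E \<phi>; s \<in> {0..1}; t \<in> {0..1}; \<bar>s - t\<bar> < d\<rbrakk> \<Longrightarrow> tree_lift.edist E \<phi> i s t \<le> 1"
    using edist_equicontinuous [OF f i, of 1] by auto
  obtain K where K: "K > 0" "inverse (real K) < d"
    using d(1) by (metis ex_inverse_of_nat_less)
  show ?thesis
  proof
    fix n E \<phi> s t assume T: "tree_lift n f E \<phi>" and st: "s \<in> {0..1::real}" "t \<in> {0..1::real}"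
    interpret tree_lift n f E \<phi> by (rule T)
    define x where "x k = s + (t - s) * (real k / real K)" for k
    have x01: "x k \<in> {0..1}" if "k \<le> K" for k
    proof -
      have "x k = (1 - real k / real K) * s + (real k / real K) * t"
        using K by (simp add: x_def field_simps)
      moreover have "0 \<le> real k / real K" "real k / real K \<le> 1"
        using that K by auto
      ultimately show ?thesis
        using st convex_bound_le [of s 1 t "1 - real k / real K" "real k / real K"] by auto
    qed
    have "edist i s (x k) \<le> real k" if "k \<le> K" for k
      using that
    proof (induction k)
      case 0
      then show ?case by (simp add: x_def edist_def)
    next
      case (Suc k)
      have "x k - x (Suc k) = (s - t) * inverse (real K)"
        using K by (simp add: x_def field_simps)
      then have "\<bar>x k - x (Suc k)\<bar> = \<bar>t - s\<bar> * inverse (real K)"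
        by (simp add: abs_mult abs_minus_commute)
      also have "\<dots> \<le> 1 * inverse (real K)"
        using st by (intro mult_right_mono) auto
      finally have "edist i (x k) (x (Suc k)) \<le> 1"
        using d(2) [OF T x01 x01, of k "Suc k"] Suc.prems K by auto
      then show ?case
        using Suc edist_triangle [of i s "x (Suc k)" "x k"] by auto
    qed
    from this [of K] show "edist i s t \<le> real K"
      using K by (simp add: x_def)
  qed auto
qed

lemma sum_half_powers_le: "(\<Sum>i\<in>{Suc m..n}. (1/2::real) ^ i) \<le> (1/2) ^ m"
proof -
  have "(\<Sum>i\<in>{Suc m..n}. (1/2::real) ^ i) \<le> (1/2) ^ m - (1/2) ^ n" if "m \<le> n"
    using that
  proof (induction n rule: dec_induct)
    case (step k)
    have "(\<Sum>i\<in>{Suc m..Suc k}. (1/2::real) ^ i) = (\<Sum>i\<in>{Suc m..k}. (1/2::real) ^ i) + (1/2) * (1/2) ^ k"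
      using step by simp
    moreover have "(1/2::real) ^ Suc k = (1/2) * (1/2) ^ k"
      by simp
    ultimately show ?case
      using step.IH by linarith
  qed simp
  moreover have "(1/2::real) ^ n \<ge> 0" by simp
  ultimately show ?thesis
    by (cases "m \<le> n") (auto intro: order_trans)
qed

text \<open>If the limit height has equal ends and no dip between them, then at high levels the
  weighted tree distance of the two lifts is arbitrarily small. As each weight is positive and
  fixed, every circle coordinate of \<open>f s\<close> and \<open>f t\<close> agrees.\<close>

lemma null_if_tree_lifts:
  assumes f: "path f" "path_image f \<subseteq> Y1"
    and lifts: "\<And>n. n \<ge> N0 \<Longrightarrow> \<exists>E \<phi>. tree_lift n f E \<phi>"
  shows "homotopic_paths (path_image f) f (\<lambda>_. f 0)"
proof -
  have "\<forall>k. \<exists>E \<phi>. tree_lift (N0 + k) f E \<phi>"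
    using lifts by simp
  then obtain E \<phi> where T: "\<And>k. tree_lift (N0 + k) f (E k) (\<phi> k)"
    by metis
  have "\<exists>M. 0 \<le> M \<and> (\<forall>n E \<phi> s t. tree_lift n f E \<phi> \<longrightarrow> s \<in> {0..1} \<longrightarrow> t \<in> {0..1} \<longrightarrow> tree_lift.edist E \<phi> i s t \<le> M)"
    if "i \<ge> 1" for i
    using edist_bounded [OF f(1) that] by metis
  then obtain M where M: "\<And>i. i \<ge> 1 \<Longrightarrow> 0 \<le> M i"
    "\<And>i n E \<phi> s t. \<lbrakk>i \<ge> 1; tree_lift n f E \<phi>; s \<in> {0..1}; t \<in> {0..1}\<rbrakk> \<Longrightarrow> tree_lift.edist E \<phi> i s t \<le> M i"
    by metis
  \<comment> \<open>Makes circle \<open>i\<close> contribute at most \<open>(1/2) ^ i\<close> to any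
    distance at any level. The denominator is positive also at \<open>i = 0\<close>, where
    \<open>M\<close> is not controlled.\<close>
  define l where "l i = (1/2) ^ i / (1 + \<bar>M i\<bar>)" for i :: nat
  have l: "0 < l i" for i
    by (simp add: l_def add_pos_nonneg)
  have l_le: "l i \<le> (1/2) ^ i" for i
  proof -
    have "(1/2) ^ i / (1 + \<bar>M i\<bar>) \<le> (1/2) ^ i / 1"
      by (intro divide_left_mono) auto
    then show ?thesis by (simp add: l_def)
  qed
  define ed where "ed k = tree_lift.edist (E k) (\<phi> k)" for k
  define h where "h k = tree_lift.height (E k) (\<phi> k) l" for k
  have ed0: "0 \<le> ed k i s t" for k i s t
    unfolding ed_def by (rule tree_lift.edist_nonneg [OF T])
  have led0: "0 \<le> l i * ed k i s t" for k i s t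
    using l [of i] ed0 by simp
  have edl: "l i * ed k i s t \<le> (1/2) ^ i" if "i \<ge> 1" "s \<in> {0..1}" "t \<in> {0..1}" for k i s t
  proof -
    have "ed k i s t \<le> 1 + \<bar>M i\<bar>"
      using M(2) [OF that(1) T that(2,3), of k] by (simp add: ed_def)
    then have "l i * ed k i s t \<le> l i * (1 + \<bar>M i\<bar>)"
      using l [of i] by (intro mult_left_mono) auto
    also have "\<dots> = (1/2) ^ i"
      by (simp add: l_def add_pos_nonneg less_imp_neq [symmetric])
    finally show ?thesis .
  qed
  have hdiff: "\<bar>h k s - h k t\<bar> \<le> (\<Sum>i\<in>{1..N0 + k}. l i * ed k i s t)" for k s t
    unfolding h_def ed_def by (rule tree_lift.height_diff_le [OF T l])
  have tail: "(\<Sum>i\<in>{Suc m..N0 + k}. l i * ed k i s t) \<le> (1/2) ^ m" if "s \<in> {0..1}" "t \<in> {0..1}" for m k s t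
    by (rule order_trans [OF sum_mono sum_half_powers_le]) (use edl that in auto)
  have h1: "h k 1 = 0" "h k 0 = 0" for k
    unfolding h_def using tree_lift.height_ends [OF T] by auto
  have bounded: "norm (h k t) \<le> 1" if "t \<in> {0..1}" for k t
    using hdiff [of k t 1] tail [where m = 0 and k = k and s = t and t = 1] that h1 by auto
  have equicont: "\<exists>d>0. \<forall>k t. t \<in> {0..1} \<and> norm (s - t) < d \<longrightarrow> norm (h k s - h k t) < e"
    if s: "s \<in> {0..1}" and e: "0 < e" for s e
  proof -
    \<comment> \<open>Circles beyond \<open>m\<close> contribute less than \<open>e / 2\<close>; the
      first \<open>m\<close> together at most \<open>e / 4\<close>, because the weights sum to at
      most 1.\<close>
    obtain m where m: "(1/2::real) ^ m < e / 2"
      using real_arch_pow_inv [of "e/2" "1/2"] e by auto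
    have "\<exists>d>0. \<forall>n E \<phi> s t. tree_lift n f E \<phi> \<longrightarrow> s \<in> {0..1} \<longrightarrow> t \<in> {0..1} \<longrightarrow> \<bar>s - t\<bar> < d \<longrightarrow> tree_lift.edist E \<phi> i s t \<le> e / 4"
      if "i \<in> {1..m}" for i
      using edist_equicontinuous [OF f(1), of i "e/4"] that e by (metis atLeastAtMost_iff divide_pos_pos zero_less_numeral)
    then obtain d where d: "\<And>i. i \<in> {1..m} \<Longrightarrow> d i > 0"
      "\<And>i n E \<phi> s t. \<lbrakk>i \<in> {1..m}; tree_lift n f E \<phi>; s \<in> {0..1}; t \<in> {0..1}; \<bar>s - t\<bar> < d i\<rbrakk> \<Longrightarrow> tree_lift.edist E \<phi> i s t \<le> e / 4"
      by metis
    define D where "D = Min (insert 1 (d ` {1..m}))"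
    have D: "D > 0"
      using d(1) by (auto simp: D_def)
    have "norm (h k s - h k t) < e" if t: "t \<in> {0..1}" "norm (s - t) < D" for k t
    proof -
      have small: "l i * ed k i s t \<le> (1/2) ^ i * (e / 4)" if i: "i \<in> {1..m}" for i
      proof -
        have "D \<le> d i"
          unfolding D_def by (rule Min_le) (use i in auto)
        then have "ed k i s t \<le> e / 4"
          unfolding ed_def using d(2) [OF i T s t(1)] t(2) by auto
        then show ?thesis
          using l_le [of i] ed0 l [of i] e by (intro mult_mono) auto
      qed
      have "(\<Sum>i\<in>{1..N0 + k}. l i * ed k i s t) \<le> (\<Sum>i\<in>{1..m} \<union> {Suc m..N0 + k}. l i * ed k i s t)"
        by (intro sum_mono2) (auto simp: led0)
      also have "\<dots> = (\<Sum>i\<in>{1..m}. l i * ed k i s t) + (\<Sum>i\<in>{Suc m..N0 + k}. l i * ed k i s t)"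
        by (intro sum.union_disjoint) auto
      also have "\<dots> \<le> (\<Sum>i\<in>{1..m}. (1/2) ^ i * (e / 4)) + (1/2) ^ m"
        using small tail [OF s t(1)] by (intro add_mono sum_mono) auto
      also have "(\<Sum>i\<in>{1..m}. (1/2) ^ i * (e / 4)) = (\<Sum>i\<in>{Suc 0..m}. (1/2) ^ i) * (e / 4)"
        by (simp add: sum_distrib_right)
      also have "\<dots> \<le> 1 * (e / 4)"
        using e sum_half_powers_le [of 0 m] by (intro mult_right_mono) auto
      finally show ?thesis
        using hdiff [of k s t] m e by simp
    qed
    then show ?thesis
      using D by blast
  qed
  obtain g r where g: "continuous_on {0..1} g" and r: "strict_mono (r :: nat \<Rightarrow> nat)"
    and lim: "\<And>e. 0 < e \<Longrightarrow> \<exists>N. \<forall>n x. N \<le> n \<and> x \<in> {0..1} \<longrightarrow> norm (h (r n) x - g x) < e"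
    using Arzela_Ascoli [of "{0..1::real}" h 1] bounded equicont by (metis (no_types, lifting) compact_Icc)
  have glim: "(\<lambda>n. h (r n) x) \<longlonglongrightarrow> g x" if "x \<in> {0..1}" for x
    unfolding LIMSEQ_iff using lim that by meson
  show ?thesis
  proof (rule height_function_null [OF f(1) g])
    show "g 0 = 0" "g 1 = 0"
      using glim [of 0] glim [of 1] h1 LIMSEQ_unique [OF tendsto_const, of 0] by auto
    show "0 \<le> g t" if "0 \<le> t" "t \<le> 1" for t
    proof (rule tendsto_lowerbound [OF glim])
      show "\<forall>\<^sub>F n in sequentially. 0 \<le> h (r n) t"
        unfolding h_def using tree_lift.height_nonneg [OF T l] that by (auto intro!: always_eventually)
    qed (use that in auto)
    fix s t assume st: "0 \<le> s" "s \<le> t" "t \<le> 1" and eq: "g s = g t"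
      and min: "\<And>v. s \<le> v \<Longrightarrow> v \<le> t \<Longrightarrow> g s \<le> g v"
    have st01: "s \<in> {0..1}" "t \<in> {0..1}" using st by auto
    have circ: "circ i (f s) = circ i (f t)" if i: "i \<ge> 1" for i
    proof (rule ccontr)
      assume "circ i (f s) \<noteq> circ i (f t)"
      then have pos: "0 < dist (circ i (f s)) (circ i (f t))" by simp
      \<comment> \<open>Replacing the heights by their limit costs four errors below
        \<open>e\<close>; multiplied by \<open>4 * pi\<close> they amount to only half of the
        assumed weighted distance.\<close>
      define e where "e = l i * dist (circ i (f s)) (circ i (f t)) / (8 * (4 * pi))"
      have e: "e > 0"
        using pos l by (simp add: e_def)
      obtain N where N: "\<And>n x. N \<le> n \<Longrightarrow> x \<in> {0..1} \<Longrightarrow> \<bar>h (r n) x - g x\<bar> < e"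
        using lim [OF e] by auto
      \<comment> \<open>High enough for the uniform approximation and for circle \<open>i\<close> to
        occur in the tree.\<close>
      define n where "n = max N i"
      have n: "N \<le> n" "i \<le> N0 + r n"
        using strict_mono_imp_increasing [OF r, of n] by (auto simp: n_def)
      obtain u where u: "s \<le> u" "u \<le> t"
        "(\<Sum>i\<in>{1..N0 + r n}. l i * ed (r n) i s t) \<le> h (r n) s + h (r n) t - 2 * h (r n) u"
        unfolding h_def ed_def by (rule tree_lift.height_minimum_ge [OF T l st])
      have "\<bar>h (r n) s - g s\<bar> < e" "\<bar>h (r n) t - g t\<bar> < e" "\<bar>h (r n) u - g u\<bar> < e" "g s \<le> g u"
        using N [OF n(1)] st01 u st min by auto
      then have "h (r n) s + h (r n) t - 2 * h (r n) u < 4 * e"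
        using eq by linarith
      moreover have "l i * ed (r n) i s t \<le> (\<Sum>i\<in>{1..N0 + r n}. l i * ed (r n) i s t)"
        using i n by (intro member_le_sum) (auto simp: led0)
      ultimately have "l i * ed (r n) i s t < 4 * e"
        using u(3) by linarith
      moreover have "dist (circ i (f s)) (circ i (f t)) \<le> 4 * pi * ed (r n) i s t"
        unfolding ed_def by (rule tree_lift.dist_circ_le [OF T st01 i n(2)])
      then have "l i * dist (circ i (f s)) (circ i (f t)) \<le> l i * (4 * pi * ed (r n) i s t)"
        using l [of i] by (intro mult_left_mono) auto
      ultimately have "l i * dist (circ i (f s)) (circ i (f t)) < 4 * pi * (4 * e)"
        by (smt (verit, best) mult.left_commute mult_less_cancel_left_pos pi_gt_zero zero_less_mult_iff)
      then show False
        using pos l [of i] by (simp add: e_def)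
    qed
    have Y: "f s \<in> Y1" "f t \<in> Y1"
      using path_Y1D [OF f(2)] st by auto
    show "f s = f t"
    proof (cases "f s = 0 \<and> f t = 0")
      case False
      \<comment> \<open>It is enough to compare on the circle through a nonzero point of the two:
        there the other one has the same nonzero image under \<open>circ\<close>, hence is
        equal.\<close>
      then obtain p q where pq: "{p, q} = {f s, f t}" "p \<noteq> 0" by (metis insert_commute)
      then have "p \<in> Y1" and c: "circ (idx p) p = circ (idx p) q" and "idx p \<ge> 1"
        using Y circ [of "idx p"] idx_pos [of p] by (auto simp: doubleton_eq_iff)
      then have "circ (idx p) p = p"
        using kap_idx [of p] by (simp add: circ_def)
      then have "q = p"
        using c pq(2) by (auto simp: circ_def split: if_splits)
      then show ?thesis
        using pq(1) by (auto simp: doubleton_eq_iff)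
    qed simp
  qed
qed

section \<open>The word of the remaining path\<close>

lemma set_crs:
  assumes "p \<in> Y1" "(i, b) \<in> set (crs n p q)"
  shows "1 \<le> i \<and> i \<le> n"
proof -
  obtain x y where xy: "cls n p = Some x" "cls n q = Some y"
    using assms(2) by (cases "(cls n p, cls n q)" rule: cross.cases) auto
  then have "fst x = i"
    using assms(2) by (cases x; cases y) (auto split: if_splits)
  then show ?thesis
    using xy(1) idx_pos [OF assms(1)] by (auto simp: cls_def split: if_splits)
qed

lemma set_seqword:
  assumes "\<And>k. k \<le> b \<Longrightarrow> p k \<in> Y1" "(i, c) \<in> set (seqword n p a b)"
  shows "1 \<le> i \<and> i \<le> n"
proof -
  obtain k where "k < b" "(i, c) \<in> set (crs n (p k) (p (Suc k)))"
    using assms(2) by (auto simp: seqword_def)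
  then show ?thesis
    using set_crs [OF assms(1)] by (meson less_imp_le)
qed

lemma length_seqword: "length (seqword n p a b) \<le> b - a"
proof (induction b)
  case (Suc b)
  show ?case
  proof (cases "a \<le> b")
    case True
    then show ?thesis
      using Suc length_cross [of "cls n (p b)" "cls n (p (Suc b))"] by (simp add: seqword_Suc)
  qed (simp add: seqword_def)
qed (simp add: seqword_def)

text \<open>\<open>Q t\<close> is the reduced word of the part of the path after time \<open>t\<close>.\<close>

lemma ex_lift:
  assumes f: "path f" "path_image f \<subseteq> Y1"
  obtains Q d L where "0 < d" "Q 0 = hol n f" "Q 1 = []"
    "\<And>t. t \<in> {0..1} \<Longrightarrow> reduced (Q t) \<and> length (Q t) \<le> L \<and> (\<forall>a\<in>set (Q t). 1 \<le> fst a \<and> fst a \<le> n)"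
    "\<And>s t. \<lbrakk>s \<in> {0..1}; t \<in> {0..1}; \<bar>s - t\<bar> < d\<rbrakk> \<Longrightarrow> Q s = red (crs n (f s) (f t) @ Q t)"
proof -
  obtain K where K: "good n f K"
    using ex_good [OF f(1)] by blast
  then have K0: "0 < K"
    by (simp add: good_def)
  define p where "p k = f (real k / real K)" for k
  define S where "S k = seqword n p k K" for k
  \<comment> \<open>Index of the first sample at or after time \<open>t\<close>; \<open>Q t\<close>
    crosses from \<open>f t\<close> to that sample and then follows the remaining samples.\<close>
  define c where "c t = nat \<lceil>t * real K\<rceil>" for t
  define Q where "Q t = red (crs n (f t) (p (c t)) @ S (c t))" for t
  have c: "t \<le> real (c t) / real K" "real (c t) / real K < t + 1 / real K" "real (c t) / real K \<le> 1" "c t \<le> K"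
    if "t \<in> {0..1}" for t
  proof -
    have 1: "t * real K \<le> real (c t)" "real (c t) < t * real K + 1"
      using that K0 unfolding c_def by (simp add: of_nat_nat; linarith)+
    have "real (c t) < real K + 1"
      using 1(2) that mult_right_mono [of t 1 "real K"] by (simp del: mult_le_cancel_right1)
    then show "c t \<le> K" by linarith
    then show "t \<le> real (c t) / real K" "real (c t) / real K < t + 1 / real K" "real (c t) / real K \<le> 1"
      using 1 K0 by (simp_all add: field_simps)
  qed
  have fY: "f t \<in> Y1" if "t \<in> {0..1}" for t
    using path_Y1D [OF f(2)] that by auto
  have pY: "p k \<in> Y1" if "k \<le> K" for k
    unfolding p_def using that K0 by (intro fY) auto
  have forward: "Q s = red (crs n (f s) (f t) @ Q t)"
    if st: "s \<in> {0..1}" "t \<in> {0..1}" "s \<le> t" "t - s \<le> 1 / real K" for s t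
  proof -
    \<comment> \<open>A step of at most one mesh width raises the ceiling by at most one, so a
      single triangle suffices to pass the sample.\<close>
    have "c t = c s \<or> c t = Suc (c s)"
    proof -
      have "s * real K \<le> t * real K" "t * real K \<le> s * real K + 1"
        using st K0 by (auto simp: field_simps)
      moreover have "0 \<le> s * real K"
        using st by simp
      ultimately have "\<lceil>s * real K\<rceil> \<le> \<lceil>t * real K\<rceil>" "\<lceil>t * real K\<rceil> \<le> \<lceil>s * real K\<rceil> + 1" "0 \<le> \<lceil>s * real K\<rceil>"
        by (linarith, linarith, linarith)
      then show ?thesis
        unfolding c_def by linarith
    qed
    then have Qs: "Q s = red (crs n (f s) (p (c t)) @ S (c t))"
    proof
      assume ct: "c t = Suc (c s)"
      then have "S (c s) = crs n (p (c s)) (p (c t)) @ S (c t)"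
        unfolding S_def using c(4) [OF st(2)] by (simp add: seqword_rec)
      then have "Q s = red (crs n (f s) (p (c s)) @ crs n (p (c s)) (p (c t)) @ S (c t))"
        by (simp add: Q_def)
      also have "\<dots> = red (crs n (f s) (p (c t)) @ S (c t))"
      proof (rule red_crs_crs)
        have "real (c t) / real K = real (c s) / real K + 1 / real K"
          by (simp add: ct add_divide_distrib)
        moreover have "2 / real K = 1 / real K + 1 / real K"
          by simp
        ultimately have *: "\<bar>s - real (c s) / real K\<bar> \<le> 2 / real K" "\<bar>s - real (c t) / real K\<bar> \<le> 2 / real K"
          "\<bar>real (c s) / real K - real (c t) / real K\<bar> \<le> 2 / real K"
          using c [OF st(1)] K0 by (auto simp: abs_le_iff)
        show "dist (f s) (p (c s)) < eta n" "dist (p (c s)) (p (c t)) < eta n" "dist (f s) (p (c t)) < eta n"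
          unfolding p_def using * st c(3) by (auto intro!: goodD [OF K])
      qed (use st fY pY c(4) in auto)
      finally show ?thesis .
    qed (simp add: Q_def)
    have "red (crs n (f s) (f t) @ Q t) = red (crs n (f s) (f t) @ crs n (f t) (p (c t)) @ S (c t))"
      by (simp add: Q_def)
    also have "\<dots> = red (crs n (f s) (p (c t)) @ S (c t))"
    proof (rule red_crs_crs)
      have "2 / real K = 1 / real K + 1 / real K" "0 \<le> 1 / real K"
        by simp_all
      then have *: "\<bar>s - t\<bar> \<le> 2 / real K" "\<bar>s - real (c t) / real K\<bar> \<le> 2 / real K" "\<bar>t - real (c t) / real K\<bar> \<le> 2 / real K"
        using c [OF st(2)] st by linarith+
      show "dist (f s) (f t) < eta n" "dist (f t) (p (c t)) < eta n" "dist (f s) (p (c t)) < eta n"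
        unfolding p_def using * st c(3) by (auto intro!: goodD [OF K])
    qed (use st fY pY c(4) in auto)
    finally show ?thesis
      using Qs by simp
  qed
  \<comment> \<open>Crossing forth and back is trivial by the cocycle identity, so the backward rule
    follows from the forward one.\<close>
  have backward: "Q t = red (crs n (f t) (f s) @ Q s)"
    if st: "s \<in> {0..1}" "t \<in> {0..1}" "s \<le> t" "t - s \<le> 1 / real K" for s t
  proof -
    have "2 / real K = 1 / real K + 1 / real K" "0 \<le> 1 / real K"
      by simp_all
    then have "\<bar>s - t\<bar> \<le> 2 / real K"
      using st by linarith
    then have d: "dist (f s) (f t) < eta n" "dist (f t) (f s) < eta n" "dist (f t) (f t) < eta n"
      using st goodD [OF K, of s t] eta_pos [of n] by (auto simp: dist_commute)
    have "red (crs n (f t) (f s) @ Q s) = red (crs n (f t) (f s) @ crs n (f s) (f t) @ Q t)"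
      using forward [OF st] by simp
    also have "\<dots> = red (crs n (f t) (f t) @ Q t)"
      by (rule red_crs_crs) (use d fY st in auto)
    finally show ?thesis
      by (simp add: Q_def)
  qed
  show ?thesis
  proof
    show "0 < 1 / real K" using K0 by simp
    show "Q 0 = hol n f"
      unfolding hol_eq [OF K f(2)] by (simp add: Q_def c_def S_def p_def [abs_def] sword_def)
    show "Q 1 = []"
      using K0 by (simp add: Q_def c_def S_def p_def)
    show "reduced (Q t) \<and> length (Q t) \<le> Suc K \<and> (\<forall>a\<in>set (Q t). 1 \<le> fst a \<and> fst a \<le> n)"
      if t: "t \<in> {0..1}" for t
    proof (intro conjI ballI)
      show "reduced (Q t)" by (simp add: Q_def)
      have "length (crs n (f t) (p (c t)) @ S (c t)) \<le> Suc K"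
        unfolding S_def length_append
        using length_cross [of "cls n (f t)" "cls n (p (c t))"] length_seqword [of n p "c t" K] by linarith
      then show "length (Q t) \<le> Suc K"
        unfolding Q_def by (rule order_trans [OF length_red])
      fix a assume "a \<in> set (Q t)"
      then have "a \<in> set (crs n (f t) (p (c t)) @ S (c t))"
        unfolding Q_def using set_red by blast
      then consider "(fst a, snd a) \<in> set (crs n (f t) (p (c t)))" | "(fst a, snd a) \<in> set (seqword n p (c t) K)"
        by (auto simp: S_def)
      then have "1 \<le> fst a \<and> fst a \<le> n"
        by cases (rule set_crs [OF fY [OF t]], assumption, rule set_seqword [OF pY], assumption+)
      then show "1 \<le> fst a" "fst a \<le> n" by auto
    qed
    show "Q s = red (crs n (f s) (f t) @ Q t)" if "s \<in> {0..1}" "t \<in> {0..1}" "\<bar>s - t\<bar> < 1 / real K" for s t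
    proof (cases "s \<le> t")
      case True
      show ?thesis
        by (rule forward) (use that True in auto)
    next
      case False
      show ?thesis
        by (rule backward) (use that False in auto)
    qed
  qed
qed

section \<open>Edge coordinates\<close>

text \<open>Arc length from the origin to \<open>p\<close> along the shorter arc of circle
  \<open>i\<close>, as a fraction of the full circle: 1/2 at the far point. The side is not
  recorded, and points off the circle get 0.\<close>

definition ang :: "nat \<Rightarrow> pt \<Rightarrow> real" where
  "ang i p = (if p \<noteq> 0 \<and> kap p = real i then arccos (1 - real i * fst p) / (2 * pi) else 0)"

lemma circle_bounds:
  assumes "p \<noteq> 0" "kap p = real i" "i \<ge> 1"
  shows "0 < real i * fst p" "real i * fst p \<le> 2"
proof -
  have "0 < kap p" using assms by simp
  then show "0 < real i * fst p"
    using assms by (auto simp: kap_def zero_less_divide_iff zero_less_mult_iff)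
  have "(1 - real i * fst p)\<^sup>2 \<le> 1"
    using circle_eq [OF assms] by (metis le_add_same_cancel1 zero_le_power2)
  then have "\<bar>1 - real i * fst p\<bar> \<le> 1"
    by (simp add: abs_square_le_1)
  then show "real i * fst p \<le> 2" by linarith
qed

lemma ang_range:
  assumes "i \<ge> 1"
  shows "0 \<le> ang i p" "ang i p \<le> 1/2" "p \<noteq> 0 \<Longrightarrow> kap p = real i \<Longrightarrow> 0 < ang i p"
    "p \<noteq> 0 \<Longrightarrow> kap p = real i \<Longrightarrow> ang i p = 1/2 \<longleftrightarrow> snd p = 0"
proof -
  have *: "0 < ang i p \<and> ang i p \<le> 1/2 \<and> (ang i p = 1/2 \<longleftrightarrow> snd p = 0)" if p: "p \<noteq> 0" "kap p = real i"
  proof -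
    note b = circle_bounds [OF p assms]
    have cos: "cos (arccos (1 - real i * fst p)) = 1 - real i * fst p"
      using b by (intro cos_arccos) auto
    have "arccos (1 - real i * fst p) \<noteq> 0"
    proof
      assume "arccos (1 - real i * fst p) = 0"
      then have "cos 0 = 1 - real i * fst p"
        using cos by (simp only:)
      then show False
        using b(1) unfolding cos_zero by linarith
    qed
    moreover have "arccos (1 - real i * fst p) \<le> pi" "0 \<le> arccos (1 - real i * fst p)"
      using b by (auto intro: arccos_ubound arccos_lbound)
    moreover have "arccos (1 - real i * fst p) = pi \<longleftrightarrow> snd p = 0"
    proof -
      have "arccos (1 - real i * fst p) = pi \<longleftrightarrow> 1 - real i * fst p = - 1"
      proof
        assume "arccos (1 - real i * fst p) = pi"
        then have "cos pi = 1 - real i * fst p"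
          using cos by (simp only:)
        then show "1 - real i * fst p = - 1"
          by simp
      qed (simp only: arccos_minus_1)
      also have "\<dots> \<longleftrightarrow> (1 - real i * fst p)\<^sup>2 = 1"
        unfolding power2_eq_1_iff using b(1) by argo
      also have "\<dots> \<longleftrightarrow> (real i * snd p)\<^sup>2 = 0"
        using circle_eq [OF p assms] by argo
      also have "\<dots> \<longleftrightarrow> snd p = 0"
        using assms by simp
      finally show ?thesis .
    qed
    ultimately show ?thesis
      using p by (auto simp: ang_def field_simps)
  qed
  show "0 \<le> ang i p" "ang i p \<le> 1/2"
    using * by (auto simp: ang_def)
  show "p \<noteq> 0 \<Longrightarrow> kap p = real i \<Longrightarrow> 0 < ang i p"
    "p \<noteq> 0 \<Longrightarrow> kap p = real i \<Longrightarrow> ang i p = 1/2 \<longleftrightarrow> snd p = 0"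
    using * by auto
qed

lemma std_loop_ang:
  assumes "p \<noteq> 0" "kap p = real i" "i \<ge> 1"
  shows "p = std_loop i (if snd p < 0 then - ang i p else ang i p)"
proof -
  note b = circle_bounds [OF assms]
  have a: "2 * pi * ang i p = arccos (1 - real i * fst p)"
    using assms by (simp add: ang_def)
  have c: "cos (2 * pi * ang i p) = 1 - real i * fst p"
    unfolding a using b by (intro cos_arccos) auto
  have "sin (2 * pi * ang i p) = sqrt (1 - (1 - real i * fst p)\<^sup>2)"
    unfolding a using b by (intro sin_arccos) auto
  also have "1 - (1 - real i * fst p)\<^sup>2 = (real i * snd p)\<^sup>2"
    using circle_eq [OF assms] by simp
  finally have s: "sin (2 * pi * ang i p) = real i * \<bar>snd p\<bar>"
    by (simp add: abs_mult)
  show ?thesis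
    using assms c s by (auto simp: std_loop_def prod_eq_iff field_simps)
qed

text \<open>Gluing along two closed sets that meet only in the origin. The rest of the earring is
  closed because circle \<open>i\<close> minus the origin is cut out by the open condition that
  \<open>kap\<close> is within 1/2 of \<open>i\<close>.\<close>

lemma continuous_on_ang:
  assumes i: "i \<ge> 1"
  shows "continuous_on Y1 (ang i)"
proof -
  define A where "A = Y1 \<inter> {p. p = 0 \<or> kap p = real i}"
  define B where "B = Y1 \<inter> {p. p = 0 \<or> kap p \<noteq> real i}"
  have AB: "A \<union> B = Y1"
    by (auto simp: A_def B_def)
  have "A = Y1 \<inter> Xc i"
    using Xc_iff [OF i] by (auto simp: A_def)
  moreover have "closed (Xc i)"
    unfolding Xc_def by (intro closed_Collect_eq continuous_intros)
  ultimately have clA: "closedin (top_of_set Y1) A"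
    by (simp add: closedin_closed_Int)
  have "closedin (top_of_set Y1) (Y1 - {p \<in> - {0}. kap p \<in> {real i - 1/2 <..< real i + 1/2}})"
    using open_kap_interval by (simp add: Diff_eq closedin_closed_Int closed_Compl)
  moreover have "Y1 - {p \<in> - {0}. kap p \<in> {real i - 1/2 <..< real i + 1/2}} = B"
  proof (intro set_eqI iffI)
    fix p assume p: "p \<in> B"
    have "\<not> (real i - 1/2 < kap p \<and> kap p < real i + 1/2)" if "p \<noteq> 0"
      using p that kap_idx [of p] by (auto simp: B_def)
    then show "p \<in> Y1 - {p \<in> - {0}. kap p \<in> {real i - 1/2 <..< real i + 1/2}}"
      using p by (auto simp: B_def)
  qed (auto simp: B_def)
  ultimately have clB: "closedin (top_of_set Y1) B"
    by simp
  have contA: "continuous_on A (\<lambda>p. arccos (1 - real i * fst p) / (2 * pi))"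
  proof (intro continuous_intros ballI)
    fix p assume "p \<in> A"
    then show "- 1 \<le> 1 - real i * fst p \<and> 1 - real i * fst p \<le> 1"
      using circle_bounds [of p i] i by (cases "p = 0") (auto simp: A_def)
  qed simp
  have "continuous_on (A \<union> B) (\<lambda>p. if p = 0 \<or> kap p = real i then arccos (1 - real i * fst p) / (2 * pi) else 0)"
  proof (rule continuous_on_cases_local)
    show "closedin (top_of_set (A \<union> B)) A" "closedin (top_of_set (A \<union> B)) B"
      using clA clB by (simp_all only: AB)
    fix p assume "p \<in> A \<and> \<not> (p = 0 \<or> kap p = real i) \<or> p \<in> B \<and> (p = 0 \<or> kap p = real i)"
    then have "p = 0"
      by (auto simp: A_def B_def)
    then show "arccos (1 - real i * fst p) / (2 * pi) = 0"
      by simp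
  qed (use contA in auto)
  then show ?thesis
    unfolding AB by (rule continuous_on_eq) (auto simp: ang_def)
qed

text \<open>The lift of \<open>p\<close> lies within half an edge of the vertex \<open>Q\<close>, in
  the direction of the letter with circle of \<open>p\<close> and side \<open>s\<close>. That half
  edge leads away from the root if it begins an edge with tail \<open>Q\<close>; if \<open>Q\<close>
  begins with the opposite letter it is the upper half of the edge \<open>Q\<close>, measured from
  the other end. All edges further down are full.\<close>

definition edge_val :: "letter list \<Rightarrow> letter list \<Rightarrow> bool \<Rightarrow> pt \<Rightarrow> real" where
  "edge_val e Q s p =
    (if tl e = Q then (if snd (hd e) = s then ang (lab e) p else 0)
     else if e = Q then 1 - (if snd (hd e) = s then 0 else ang (lab e) p)
     else if suffix e Q then 1 else 0)"

lemma continuous_on_edge_val: "lab e \<ge> 1 \<Longrightarrow> continuous_on Y1 (edge_val e Q s)"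
  unfolding edge_val_def
  by (cases "tl e = Q"; cases "e = Q"; cases "suffix e Q"; cases "snd (hd e) = s";
      simp add: continuous_on_ang continuous_on_diff)

lemma tl_neq_self: "xs \<noteq> [] \<Longrightarrow> tl xs \<noteq> xs"
  by (cases xs) auto

text \<open>At the far point the lift is the midpoint of the edge \<open>(j, c) # Q\<close>, at
  distance 1/2 from both ends, so changing the base vertex and the side together does not change any
  coordinate. Reducedness rules out that a neighbouring edge is the same half edge.\<close>

lemma edge_val_cross:
  assumes e: "e \<noteq> []" "reduced e" and Q: "reduced ((j, c) # Q)"
    and p: "ang j p = 1/2" "\<And>i. i \<noteq> j \<Longrightarrow> ang i p = 0"
  shows "edge_val e ((j, c) # Q) (\<not> c) p = edge_val e Q c p"
proof -
  obtain i b V where eq: "e = (i, b) # V"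
    using e(1) by (cases e) auto
  have len: "xs \<noteq> x # xs" "x # xs \<noteq> xs" "x # y # xs \<noteq> xs" "xs \<noteq> x # y # xs" for x y and xs :: "letter list"
    by (auto dest: arg_cong [of _ _ length])
  have nosuf: "\<not> suffix (x # y # xs) xs" "\<not> suffix (x # xs) xs" for x y and xs :: "letter list"
    by (auto dest: suffix_length_le)
  consider "e = (j, c) # Q" | "V = (j, c) # Q" | "V = Q" "e \<noteq> (j, c) # Q" | "e = Q"
    | "e \<noteq> (j, c) # Q" "V \<noteq> (j, c) # Q" "V \<noteq> Q" "e \<noteq> Q"
    by blast
  then show ?thesis
  proof cases
    case 1
    then show ?thesis
      using p by (simp add: edge_val_def len)
  next
    case 2
    then have "b = (\<not> c) \<longrightarrow> i \<noteq> j"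
      using e eq by (auto simp: reduced_Cons)
    then show ?thesis
      using 2 p(2) [of i] eq by (auto simp: edge_val_def len nosuf)
  next
    case 3
    then have "b = c \<longrightarrow> i \<noteq> j"
      using eq by auto
    moreover have "\<not> suffix e ((j, c) # Q)"
      using 3 eq by (auto simp: suffix_Cons nosuf)
    ultimately have "edge_val e ((j, c) # Q) (\<not> c) p = 0" "edge_val e Q c p = 0"
      using 3 p(2) [of i] eq len by (auto simp: edge_val_def)
    then show ?thesis by simp
  next
    case 4
    then have "b = (\<not> c) \<longrightarrow> i \<noteq> j"
      using Q eq by (auto simp: reduced_Cons)
    moreover have "suffix e ((j, c) # Q)" "tl e \<noteq> (j, c) # Q" "tl e \<noteq> Q" "e \<noteq> (j, c) # Q"
      using 4 eq len by (auto simp: suffix_Cons dest: arg_cong [of _ _ length])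
    ultimately show ?thesis
      using 4 p(2) [of i] eq by (auto simp: edge_val_def)
  next
    case 5
    then show ?thesis
      using eq by (auto simp: edge_val_def suffix_Cons)
  qed
qed

lemma crs_same_side: "(snd p < 0) = (snd q < 0) \<Longrightarrow> crs n p q = []"
  by (auto simp: cls_def)

text \<open>For times near a passage of a far point, when the path may switch sides infinitely
  often.\<close>

lemma tendsto_two_branches:
  assumes "(g \<longlongrightarrow> v) F" "(h \<longlongrightarrow> v) F" "\<forall>\<^sub>F t in F. k t = g t \<or> k t = h t"
  shows "(k \<longlongrightarrow> v) F"
proof (rule topological_tendstoI)
  fix U assume "open U" "v \<in> U"
  then have "\<forall>\<^sub>F t in F. g t \<in> U" "\<forall>\<^sub>F t in F. h t \<in> U"
    using assms topological_tendstoD by blast+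
  then show "\<forall>\<^sub>F t in F. k t \<in> U"
    using assms(3) by eventually_elim auto
qed

text \<open>\<open>Q\<close> is locally constant except where the path sits at the far point of one
  of the first \<open>n\<close> circles. Near such a time only two pairs of vertex and side occur,
  and \<open>edge_val_cross\<close> makes their coordinates agree at the limit.\<close>

lemma continuous_on_lift_coordinate:
  assumes f: "path f" "path_image f \<subseteq> Y1" and d: "d > 0"
    and red: "\<And>t. t \<in> {0..1} \<Longrightarrow> reduced (Q t)"
    and Q: "\<And>s t. \<lbrakk>s \<in> {0..1}; t \<in> {0..1}; \<bar>s - t\<bar> < d\<rbrakk> \<Longrightarrow> Q s = red (crs n (f s) (f t) @ Q t)"
    and e: "e \<noteq> []" "reduced e" "1 \<le> lab e" "lab e \<le> n"
  shows "continuous_on {0..1} (\<lambda>t. edge_val e (Q t) (snd (f t) < 0) (f t))"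
  unfolding continuous_on_def
proof
  fix t0 :: real assume t0: "t0 \<in> {0..1}"
  let ?F = "at t0 within {0..1}"
  define p0 where "p0 = f t0"
  have Y: "f t \<in> Y1" if "t \<in> {0..1}" for t
    using path_Y1D [OF f(2)] that by auto
  have p0Y: "p0 \<in> Y1"
    using Y t0 by (simp add: p0_def)
  have flim: "(f \<longlongrightarrow> p0) ?F"
    using f(1) t0 by (simp add: path_def continuous_on_def p0_def)
  have evt: "\<forall>\<^sub>F t in ?F. t \<in> {0..1} \<and> \<bar>t0 - t\<bar> < d"
    using d unfolding eventually_at by (intro exI [of _ d]) (auto simp: dist_real_def abs_minus_commute)
  have lim: "((\<lambda>t. edge_val e Q' s (f t)) \<longlongrightarrow> edge_val e Q' s p0) ?F" for Q' s
    using continuous_on_edge_val [OF e(3), of Q' s] p0Y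
    by (rule continuous_on_tendsto_compose [OF _ flim]) (use Y in \<open>auto simp: eventually_at_filter\<close>)
  obtain Qa sa Qb sb where ev: "\<forall>\<^sub>F t in ?F. (Q t, snd (f t) < 0) = (Qa, sa) \<or> (Q t, snd (f t) < 0) = (Qb, sb)"
    and val: "edge_val e Qa sa p0 = edge_val e (Q t0) (snd p0 < 0) p0"
      "edge_val e Qb sb p0 = edge_val e (Q t0) (snd p0 < 0) p0"
  proof -
    have const: "Q t = Q t0" if "t \<in> {0..1} \<and> \<bar>t0 - t\<bar> < d" "crs n p0 (f t) = []" for t
      using Q [OF t0, of t] that red [of t] by (simp add: p0_def red_reduced)
    \<comment> \<open>Off the axis the side is locally constant. In the second case the side may
      oscillate, but there is no crossing and the angle at \<open>p0\<close> is 0 for every edge of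
      the tree, so both sides give the same value. The rest are far points.\<close>
    consider "snd p0 \<noteq> 0" | "p0 = 0 \<or> idx p0 > n" | "snd p0 = 0" "p0 \<noteq> 0" "idx p0 \<le> n"
      by force
    then show ?thesis
    proof cases
      case 1
      have "((\<lambda>t. snd (f t)) \<longlongrightarrow> snd p0) ?F"
        by (rule tendsto_snd [OF flim])
      then have "\<forall>\<^sub>F t in ?F. (snd (f t) < 0) = (snd p0 < 0)"
        using order_tendstoD [of "\<lambda>t. snd (f t)" "snd p0" ?F 0] 1
        by (cases "snd p0 < 0") (auto elim: eventually_mono)
      then have "\<forall>\<^sub>F t in ?F. (Q t, snd (f t) < 0) = (Q t0, snd p0 < 0)"
        using evt by eventually_elim (use const crs_same_side in auto)
      then show ?thesis
        by (intro that [of "Q t0" "snd p0 < 0" "Q t0" "snd p0 < 0"]) (auto elim: eventually_mono)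
    next
      case 2
      then have "cls n p0 = None"
        by (auto simp: cls_def)
      then have "\<forall>\<^sub>F t in ?F. Q t = Q t0"
        using evt by (auto elim!: eventually_mono intro: const)
      moreover have "ang (lab e) p0 = 0"
        using 2 e kap_idx [OF p0Y] by (auto simp: ang_def)
      ultimately show ?thesis
        by (intro that [of "Q t0" True "Q t0" False]) (auto elim!: eventually_mono simp: edge_val_def)
    next
      case 3
      define j where "j = idx p0"
      have j: "kap p0 = real j" "j \<ge> 1" "j \<le> n"
        using kap_idx [OF p0Y] idx_pos [OF p0Y] 3 by (auto simp: j_def)
      have "(1 - real j * fst p0)\<^sup>2 = 1"
        using circle_eq [OF 3(2) j(1,2)] 3(1) by simp
      then have far: "fst p0 * real j = 2"
        using circle_bounds [OF 3(2) j(1,2)] by (auto simp: power2_eq_1_iff mult.commute)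
      obtain r where r: "r > 0" and "r \<le> 1 / (2 * real j)" and R0: "\<And>p q. \<lbrakk>p \<in> Xc j; fst p * real j \<ge> 3/2; dist p q < r\<rbrakk>
          \<Longrightarrow> q \<noteq> 0 \<and> \<bar>kap q - real j\<bar> < 1/2 \<and> fst q * real j > 1"
        by (rule far_point_nbhd [OF j(2)], rule that, assumption+)
      have R: "q \<noteq> 0 \<and> \<bar>kap q - real j\<bar> < 1/2 \<and> fst q * real j > 1" if "dist p0 q < r" for q
        by (rule R0 [of p0]) (use far Xc_iff [OF j(2), of p0] j(1) that in auto)
      have cls: "cls n q = Some (j, snd q < 0)" if "q \<in> Y1" "dist p0 q < r" for q
      proof -
        have "\<bar>real (idx q) - real j\<bar> < 1/2"
          using R [OF that(2)] kap_idx [OF that(1)] by simp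
        then have "idx q = j" by linarith
        then show ?thesis
          using R [OF that(2)] j by (simp add: cls_def)
      qed
      have "\<forall>\<^sub>F t in ?F. dist p0 (f t) < r"
        using tendstoD [OF flim r] by (simp add: dist_commute)
      \<comment> \<open>The word after passing to the lower side: the crossing
        \<open>(j, True)\<close> no longer lies ahead, so it is removed from the front of
        \<open>Q t0\<close>.\<close>
      define Q1 where "Q1 = push (j, False) (Q t0)"
      have "\<forall>\<^sub>F t in ?F. (Q t, snd (f t) < 0) = (Q t0, False) \<or> (Q t, snd (f t) < 0) = (Q1, True)"
        using evt \<open>\<forall>\<^sub>F t in ?F. dist p0 (f t) < r\<close>
      proof eventually_elim
        case (elim t)
        show ?case
        proof (cases "snd (f t) < 0")
          case True
          then have "crs n p0 (f t) = [(j, True)]"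
            using cls [of p0] cls [of "f t"] elim Y p0Y r 3(1) by simp
          then have "Q t0 = push (j, True) (Q t)"
            using Q [OF t0, of t] elim red [of t] by (simp add: p0_def red_reduced)
          then have "Q t = Q1"
            using push_flip_push [of "Q t" "(j, True)"] elim red [of t] by (simp add: Q1_def)
          then show ?thesis
            using True by simp
        next
          case False
          then show ?thesis
            using const [of t] crs_same_side [of p0 "f t" n] elim 3(1) by simp
        qed
      qed
      moreover have "edge_val e Q1 True p0 = edge_val e (Q t0) False p0"
      proof -
        have a: "ang j p0 = 1/2" "\<And>i. i \<noteq> j \<Longrightarrow> ang i p0 = 0"
          using ang_range(4) [OF j(2) 3(2) j(1)] 3(1) j(1) by (auto simp: ang_def)
        show ?thesis
        \<comment> \<open>Removing the crossing either deletes the first letter or adds an inverse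
          one; the same edge is approached from above or from below.\<close>
        proof (cases "\<exists>w. Q t0 = (j, True) # w")
          case True
          then obtain w where w: "Q t0 = (j, True) # w" by blast
          then show ?thesis
            using edge_val_cross [OF e(1,2) _ a, of True w] red [OF t0] by (simp add: Q1_def push_Cons)
        next
          case False
          then have "Q1 = (j, False) # Q t0"
            by (cases "Q t0") (auto simp: Q1_def push_Cons)
          then show ?thesis
            using edge_val_cross [OF e(1,2) _ a, of False "Q t0"] reduced_push [OF red [OF t0], of "(j, False)"]
            by (simp add: Q1_def)
        qed
      qed
      ultimately show ?thesis
        using 3(1) by (intro that [of "Q t0" False Q1 True]) auto
    qed
  qed
  have "((\<lambda>t. edge_val e (Q t) (snd (f t) < 0) (f t)) \<longlongrightarrow> edge_val e (Q t0) (snd p0 < 0) p0) ?F"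
  proof (rule tendsto_two_branches)
    show "((\<lambda>t. edge_val e Qa sa (f t)) \<longlongrightarrow> edge_val e (Q t0) (snd p0 < 0) p0) ?F"
      "((\<lambda>t. edge_val e Qb sb (f t)) \<longlongrightarrow> edge_val e (Q t0) (snd p0 < 0) p0) ?F"
      using lim [of Qa sa] lim [of Qb sb] val by simp_all
  qed (use ev in \<open>auto elim: eventually_mono\<close>)
  then show "((\<lambda>t. edge_val e (Q t) (snd (f t) < 0) (f t)) \<longlongrightarrow> edge_val e (Q t0) (snd (f t0) < 0) (f t0)) ?F"
    by (simp add: p0_def)
qed

text \<open>The trivial word \<open>hol n f\<close> makes \<open>Q\<close> start, as it always ends,
  at the root, so that the lifted path is closed.\<close>

theorem ex_tree_lift:
  assumes f: "path f" "path_image f \<subseteq> Y1" and ends: "f 0 = 0" "f 1 = 0" and hol: "hol n f = []"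
  shows "\<exists>E \<phi>. tree_lift n f E \<phi>"
proof -
  obtain Q d L where d: "0 < d" and Q01: "Q 0 = hol n f" "Q 1 = []"
    and QL: "\<And>t. t \<in> {0..1} \<Longrightarrow> reduced (Q t) \<and> length (Q t) \<le> L \<and> (\<forall>a\<in>set (Q t). 1 \<le> fst a \<and> fst a \<le> n)"
    and Q: "\<And>s t. \<lbrakk>s \<in> {0..1}; t \<in> {0..1}; \<bar>s - t\<bar> < d\<rbrakk> \<Longrightarrow> Q s = red (crs n (f s) (f t) @ Q t)"
    using ex_lift [OF f, of n] by metis
  \<comment> \<open>One letter more than the bound for \<open>Q t\<close>, since the lift may lie on
    an edge leading away from \<open>Q t\<close>.\<close>
  define E where "E = {e. e \<noteq> [] \<and> reduced e \<and> length e \<le> Suc L \<and> (\<forall>a\<in>set e. 1 \<le> fst a \<and> fst a \<le> n)}"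
  define \<phi> where "\<phi> e t = edge_val e (Q t) (snd (f t) < 0) (f t)" for e t
  have E: "e \<noteq> []" "reduced e" "1 \<le> lab e" "lab e \<le> n" if "e \<in> E" for e
    using that by (auto simp: E_def)
  have Y: "f t \<in> Y1" if "t \<in> {0..1}" for t
    using path_Y1D [OF f(2)] that by auto
  have "tree_lift n f E \<phi>"
  proof
    have "E \<subseteq> {w. set w \<subseteq> {1..n} \<times> UNIV \<and> length w \<le> Suc L}"
      by (auto simp: E_def)
    then show "finite E"
      by (rule finite_subset) (intro finite_lists_length_le finite_cartesian_product; simp)
    show "e \<noteq> []" "1 \<le> lab e \<and> lab e \<le> n" if "e \<in> E" for e
      using E [OF that] by auto
    show "tl e \<in> E" if "e \<in> E" "tl e \<noteq> []" for e
      using that by (cases e) (auto simp: E_def reduced_Cons)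
    show "continuous_on {0..1} (\<phi> e)" if "e \<in> E" for e
      unfolding \<phi>_def by (rule continuous_on_lift_coordinate [OF f d _ Q E [OF that]]) (use QL in auto)
    show "0 \<le> \<phi> e t \<and> \<phi> e t \<le> 1" if "e \<in> E" "t \<in> {0..1}" for e t
      using ang_range(1,2) [OF E(3) [OF that(1)], of "f t"] by (auto simp: \<phi>_def edge_val_def)
    show "\<phi> e 0 = 0 \<and> \<phi> e 1 = 0" if "e \<in> E" for e
      using E(1) [OF that] Q01 hol ends by (auto simp: \<phi>_def edge_val_def ang_def)
  next
    fix e t assume e: "e \<in> E" and t: "t \<in> {0..1}" and pos: "0 < \<phi> e t" and tl: "tl e \<noteq> []"
    obtain a V where eq: "e = a # V"
      using E(1) [OF e] by (cases e) auto
    have V: "V \<noteq> []" "V \<noteq> tl V"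
      using tl eq tl_neq_self [of V] by auto
    show "\<phi> (tl e) t = 1"
    proof (cases "V = Q t")
      case True
      then have a: "snd a = (snd (f t) < 0)" "0 < ang (fst a) (f t)"
        using pos eq by (auto simp: \<phi>_def edge_val_def split: if_splits)
      \<comment> \<open>The lift lies on \<open>e\<close> beyond its lower end \<open>V\<close>.
        Were it on the edge \<open>V\<close> as well, circle and side of \<open>f t\<close> would
        force the first letter of \<open>V\<close> to be the inverse of \<open>a\<close>, against
        the reducedness of \<open>e\<close>.\<close>
      have "ang (lab V) (f t) = 0" if "snd (hd V) \<noteq> (snd (f t) < 0)"
      proof (rule ccontr)
        assume "ang (lab V) (f t) \<noteq> 0"
        then have "lab V = fst a"
          using a(2) by (auto simp: ang_def split: if_splits)
        then have "hd V = flip a"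
          using that a(1) by (auto simp: flip_def prod_eq_iff)
        then show False
          using E(2) [OF e] V eq by (simp add: reduced_Cons)
      qed
      then show ?thesis
        using True V eq by (auto simp: \<phi>_def edge_val_def)
    next
      case False
      then have "suffix e (Q t)"
        using pos eq by (auto simp: \<phi>_def edge_val_def split: if_splits)
      then have "suffix V (Q t)" "length V < length (Q t)"
        using eq by (auto simp: suffix_def)
      then have "tl V \<noteq> Q t" "V \<noteq> Q t"
        by (auto dest: arg_cong [of _ _ length])
      then show ?thesis
        using \<open>suffix V (Q t)\<close> eq by (simp add: \<phi>_def edge_val_def)
    qed
  next
    fix e e' t assume e: "e \<in> E" "e' \<in> E" and pos: "0 < \<phi> e t" "0 < \<phi> e' t"
    have *: "suffix x (Q t) \<or> (tl x = Q t \<and> hd x = (lab x, snd (f t) < 0) \<and> f t \<noteq> 0 \<and> kap (f t) = real (lab x))"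
      if "0 < \<phi> x t" for x
      using that by (auto simp: \<phi>_def edge_val_def ang_def prod_eq_iff split: if_splits)
    have ne: "e = hd e # tl e" "e' = hd e' # tl e'"
      using E(1) e by simp_all
    show "suffix e e' \<or> suffix e' e"
      using * [OF pos(1)] * [OF pos(2)]
    proof (elim disjE conjE)
      assume "suffix e (Q t)" "suffix e' (Q t)"
      then show ?thesis
        by (rule suffix_same_cases)
    next
      assume "suffix e (Q t)" "tl e' = Q t"
      then show ?thesis
        by (metis ne(2) suffix_ConsI)
    next
      assume "suffix e' (Q t)" "tl e = Q t"
      then show ?thesis
        by (metis ne(1) suffix_ConsI)
    next
      assume "tl e = Q t" "tl e' = Q t" "hd e = (lab e, snd (f t) < 0)" "hd e' = (lab e', snd (f t) < 0)"
        "kap (f t) = real (lab e)" "kap (f t) = real (lab e')"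
      then have "e = e'"
        using ne by (metis of_nat_eq_iff [where 'a = real])
      then show ?thesis by simp
    qed
  next
    fix e t assume e: "e \<in> E" and t: "t \<in> {0..1}" and pos: "0 < \<phi> e t" "\<phi> e t < 1"
    show "f t = std_loop (lab e) (sg e * \<phi> e t)"
    proof (cases "tl e = Q t")
      case True
      then have a: "snd (hd e) = (snd (f t) < 0)" "\<phi> e t = ang (lab e) (f t)"
        using pos by (auto simp: \<phi>_def edge_val_def split: if_splits)
      then have "f t \<noteq> 0" "kap (f t) = real (lab e)"
        using pos by (auto simp: ang_def split: if_splits)
      then show ?thesis
        using std_loop_ang [of "f t" "lab e"] E(3) [OF e] a by (simp add: sg_def split: if_splits)
    next
      case False
      then have a: "snd (hd e) \<noteq> (snd (f t) < 0)" "\<phi> e t = 1 - ang (lab e) (f t)"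
        using pos by (auto simp: \<phi>_def edge_val_def split: if_splits)
      then have "f t \<noteq> 0" "kap (f t) = real (lab e)"
        using pos by (auto simp: ang_def split: if_splits)
      then have *: "f t = std_loop (lab e) (if snd (f t) < 0 then - ang (lab e) (f t) else ang (lab e) (f t))"
        by (rule std_loop_ang) (rule E(3) [OF e])
      \<comment> \<open>Measured from the other end of the edge, the parameter differs from the
        signed angle by one full turn.\<close>
      have "(if snd (f t) < 0 then - ang (lab e) (f t) else ang (lab e) (f t)) =
          sg e * \<phi> e t + of_int (if snd (f t) < 0 then - 1 else 1)"
        using a by (auto simp: sg_def)
      then show ?thesis
        using * by (simp only: std_loop_add_int)
    qed
  next
    fix t i assume t: "t \<in> {0..1}" and p: "f t \<noteq> 0" "kap (f t) = real i" and i: "i \<le> n"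
    have i1: "i \<ge> 1"
      using idx_pos [OF Y [OF t] p(1)] idx_eq [OF p(2)] by simp
    note a = ang_range [OF i1, of "f t"]
    let ?s = "snd (f t) < 0"
    show "\<exists>e\<in>E. lab e = i \<and> 0 < \<phi> e t \<and> \<phi> e t < 1"
    \<comment> \<open>The half edge carrying \<open>f t\<close> leads towards the root exactly if
      \<open>Q t\<close> begins with the letter inverse to \<open>(i, ?s)\<close>.\<close>
    proof (cases "Q t \<noteq> [] \<and> hd (Q t) = (i, \<not> ?s)")
      case True
      then have "Q t \<in> E" "tl (Q t) \<noteq> Q t"
        using QL [OF t] tl_neq_self [of "Q t"] by (auto simp: E_def)
      then show ?thesis
        using True a p by (intro bexI [of _ "Q t"]) (auto simp: \<phi>_def edge_val_def)
    next
      case False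
      then have "(i, ?s) # Q t \<in> E"
        using QL [OF t] i i1 by (auto simp: E_def reduced_Cons)
      then show ?thesis
        using a p by (intro bexI [of _ "(i, ?s) # Q t"]) (auto simp: \<phi>_def edge_val_def)
    qed
  qed
  then show ?thesis by blast
qed

theorem null_if_hol_Nil:
  assumes "path f" "path_image f \<subseteq> Y1" "f 0 = 0" "f 1 = 0" and "\<And>n. n \<ge> N0 \<Longrightarrow> hol n f = []"
  shows "homotopic_paths (path_image f) f (\<lambda>_. 0)"
  using null_if_tree_lifts [OF assms(1,2), of N0] ex_tree_lift assms by simp

section \<open>Words of loops\<close>

lemma continuous_std_loop: "continuous_on S (std_loop i)"
  unfolding std_loop_def by (cases "i = 0") (auto intro!: continuous_intros)

lemma std_loop_0 [simp]: "std_loop i 0 = 0" "std_loop i 1 = 0"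
  by (simp_all add: std_loop_def zero_prod_def)

lemma std_loop_in_Xc: "i \<ge> 1 \<Longrightarrow> std_loop i t \<in> Xc i"
  using kap_std_loop [of i t] by (cases "std_loop i t = 0") (auto simp: Xc_iff)

lemma letter_loop:
  assumes "fst a \<ge> 1"
  shows "path (letter_loop a)" "pathstart (letter_loop a) = 0" "pathfinish (letter_loop a) = 0"
    "path_image (letter_loop a) \<subseteq> Xc (fst a)"
proof -
  obtain i b where a: "a = (i, b)" by fastforce
  have "path (std_loop i)"
    by (simp add: path_def continuous_std_loop)
  then show "path (letter_loop a)"
    by (simp add: a)
  show "pathstart (letter_loop a) = 0" "pathfinish (letter_loop a) = 0"
    by (simp_all add: a pathstart_def pathfinish_def reversepath_def)
  show "path_image (letter_loop a) \<subseteq> Xc (fst a)"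
    using std_loop_in_Xc assms by (auto simp: a path_image_def reversepath_def)
qed

lemma word_loop:
  assumes "\<And>a. a \<in> set w \<Longrightarrow> 1 \<le> fst a \<and> Xc (fst a) \<subseteq> S" "0 \<in> S"
  shows "path (word_loop w) \<and> pathstart (word_loop w) = 0 \<and> pathfinish (word_loop w) = 0 \<and>
    path_image (word_loop w) \<subseteq> S"
  using assms
proof (induction w)
  case Nil
  then show ?case
    by (auto simp: path_def pathstart_def pathfinish_def path_image_def zero_prod_def)
next
  case (Cons a w)
  then have "path (word_loop w) \<and> pathstart (word_loop w) = 0 \<and> pathfinish (word_loop w) = 0 \<and>
    path_image (word_loop w) \<subseteq> S" and a: "1 \<le> fst a" "Xc (fst a) \<subseteq> S"
    by auto
  moreover note letter_loop [OF a(1)]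
  ultimately show ?case
    by (auto simp: path_image_join)
qed

lemma Xc_subset_Y1: "i \<ge> 1 \<Longrightarrow> Xc i \<subseteq> Y1"
  by (auto simp: Y1_def)

lemma Xc_subset_wedge: "1 \<le> i \<Longrightarrow> i \<le> n \<Longrightarrow> Xc i \<subseteq> wedge n"
  by (auto simp: wedge_def)

lemma frac01: "k \<le> K \<Longrightarrow> 0 \<le> real k / real K \<and> real k / real K \<le> 1"
  by (cases "K = 0") auto

lemma zero_in_Y1 [simp]: "0 \<in> Y1"
  by (simp add: Y1_iff)

text \<open>The loop changes sides at the far point, from upper to lower, and at the origin, where
  the class is \<open>None\<close>; only the first change is recorded.\<close>

lemma hol_std_loop:
  assumes "1 \<le> i" "i \<le> n"
  shows "hol n (std_loop i) = [(i, True)]"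
proof -
  have "path (std_loop i)" and im: "path_image (std_loop i) \<subseteq> Y1"
    using letter_loop [of "(i, True)"] assms Xc_subset_Y1 by auto
  then obtain K0 where "good n (std_loop i) K0"
    using ex_good by blast
  \<comment> \<open>Sample \<open>K\<close> out of \<open>K + K\<close> is the far point, and
    \<open>K \<ge> 3\<close> keeps the next sample in the far half.\<close>
  define K where "K = K0 + 3"
  have K: "K \<ge> 3" "good n (std_loop i) (K + K)"
    using \<open>good n (std_loop i) K0\<close> by (auto simp: K_def intro: good_mono)
  define p where "p k = std_loop i (real k / real (K + K))" for k
  define \<theta> where "\<theta> k = pi * real k / real K" for k :: nat
  have p: "p k = ((1 - cos (\<theta> k)) / real i, sin (\<theta> k) / real i)" for k
  proof -
    have "2 * pi * (real k / real (K + K)) = \<theta> k"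
      using K by (simp add: \<theta>_def field_simps)
    then show ?thesis
      by (simp only: p_def std_loop_def) (simp add: diff_divide_distrib)
  qed
  have upper: "\<not> snd (p k) < 0" if "k \<le> K" for k
  proof -
    have "0 \<le> \<theta> k" "\<theta> k \<le> pi"
      using that K by (simp_all add: \<theta>_def field_simps)
    then show ?thesis
      using sin_ge_zero [of "\<theta> k"] by (simp add: p divide_less_0_iff not_less)
  qed
  have lower: "snd (p k) < 0" if "K < k" "k < K + K" for k
  proof -
    have "pi < \<theta> k" "\<theta> k < 2 * pi"
      using that K by (simp_all add: \<theta>_def field_simps)
    then show ?thesis
      using sin_lt_zero [of "\<theta> k"] assms(1) by (simp add: p divide_less_0_iff)
  qed
  have "crs n (p K) (p (Suc K)) = [(i, True)]"
  proof -
    have Y: "p k \<in> Y1" for k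
      unfolding p_def using std_loop_in_Xc [OF assms(1)] Xc_subset_Y1 [OF assms(1)] by blast
    have cls: "cls n (p k) = Some (i, snd (p k) < 0)" if "cos (\<theta> k) < 0" for k
    proof -
      have "fst (p k) * real i > 1"
        using that assms by (simp add: p)
      moreover from this have "p k \<noteq> 0" by auto
      moreover from this have "kap (p k) = real i"
        using kap_std_loop [OF assms(1)] by (simp add: p_def)
      ultimately show ?thesis
        using assms cls_Some_iff [OF Y] by simp
    qed
    have "\<theta> K = pi"
      using K by (simp add: \<theta>_def)
    then have 1: "cls n (p K) = Some (i, False)"
      using cls [of K] upper [of K] by simp
    have "\<theta> (Suc K) = pi + pi / real K"
      using K by (simp add: \<theta>_def field_simps)
    moreover have "pi / real K < pi / 2" "0 < pi / real K"
      using K by (simp_all add: field_simps)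
    ultimately have "cos (\<theta> (Suc K)) < 0"
      using cos_gt_zero [of "pi / real K"] by simp
    then have 2: "cls n (p (Suc K)) = Some (i, True)"
      using cls [of "Suc K"] lower [of "Suc K"] K by simp
    show ?thesis
      by (simp add: 1 2)
  qed
  moreover have "seqword n p 0 K = []"
    by (rule seqword_Nil, rule crs_same_side) (use upper in auto)
  moreover have "seqword n p (Suc K) (K + K) = []"
  proof (rule seqword_Nil)
    fix k assume k: "Suc K \<le> k" "k < K + K"
    show "crs n (p k) (p (Suc k)) = []"
    proof (cases "Suc k = K + K")
      case True
      then have "p (Suc k) = 0"
        using K by (simp add: p_def)
      then show ?thesis
        by simp
    next
      case False
      then show ?thesis
        by (intro crs_same_side) (use lower k in auto)
    qed
  qed
  moreover have "sword n (std_loop i) (K + K) = seqword n p 0 K @ crs n (p K) (p (Suc K)) @ seqword n p (Suc K) (K + K)"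
  proof -
    have "sword n (std_loop i) (K + K) = seqword n p 0 (K + K)"
      by (simp add: sword_def p_def [abs_def])
    also have "\<dots> = seqword n p 0 K @ seqword n p K (K + K)"
      by (simp add: seqword_append)
    also have "seqword n p K (K + K) = crs n (p K) (p (Suc K)) @ seqword n p (Suc K) (K + K)"
      using K by (intro seqword_rec) simp
    finally show ?thesis .
  qed
  ultimately show ?thesis
    using hol_eq [OF K(2) im] by simp
qed

lemma hol_join_reversepath:
  assumes "path g" "path_image g \<subseteq> Y1"
  shows "red (hol n g @ hol n (reversepath g)) = []"
proof -
  have "homotopic_paths Y1 (g +++ reversepath g) (linepath (pathstart g) (pathstart g))"
    by (rule homotopic_paths_rinv) (use assms in auto)
  then have "hol n (g +++ reversepath g) = hol n (\<lambda>_. pathstart g)"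
    using homotopic_paths_hol_eq [of "g +++ reversepath g" "linepath (pathstart g) (pathstart g)" n]
    by (simp add: linepath_refl)
  moreover have "pathstart g \<in> Y1"
    using assms by blast
  ultimately show ?thesis
    using hol_join [of g "reversepath g" n] assms by (simp add: hol_const)
qed

lemma hol_letter_loop:
  assumes "1 \<le> fst a" "fst a \<le> n"
  shows "hol n (letter_loop a) = [a]"
proof -
  obtain i b where a: "a = (i, b)" by fastforce
  have i: "1 \<le> i" "i \<le> n" using assms a by auto
  show ?thesis
  proof (cases b)
    case True
    then show ?thesis
      using hol_std_loop [OF i] a by simp
  next
    case False
    have "push (i, True) (hol n (reversepath (std_loop i))) = []"
      using hol_join_reversepath [of "std_loop i" n] letter_loop [of "(i, True)"] i Xc_subset_Y1 [OF i(1)]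
      by (simp add: hol_std_loop red_reduced)
    then have "hol n (reversepath (std_loop i)) = push (i, False) []"
      using push_flip_push [of "hol n (reversepath (std_loop i))" "(i, True)"] by simp
    then show ?thesis
      using False a by simp
  qed
qed

lemma hol_word_loop:
  assumes "\<And>a. a \<in> set w \<Longrightarrow> 1 \<le> fst a \<and> fst a \<le> n"
  shows "hol n (word_loop w) = red w"
  using assms
proof (induction w)
  case Nil
  then show ?case
    using hol_const [OF zero_in_Y1] by (simp add: zero_prod_def)
next
  case (Cons a w)
  have a: "1 \<le> fst a" "fst a \<le> n"
    using Cons.prems by auto
  have w: "path (word_loop w) \<and> pathstart (word_loop w) = 0 \<and> pathfinish (word_loop w) = 0 \<and>
    path_image (word_loop w) \<subseteq> Y1"
    by (rule word_loop) (use Cons.prems Xc_subset_Y1 in auto)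
  have "hol n (letter_loop a +++ word_loop w) = red (hol n (letter_loop a) @ hol n (word_loop w))"
    by (rule hol_join) (use w letter_loop [OF a(1)] Xc_subset_Y1 [OF a(1)] in auto)
  then show ?case
    using Cons hol_letter_loop [OF a] by simp
qed

text \<open>Injectivity of \<psi>_1, by contracting \<open>f +++ reversepath g\<close> inside its
  own image. Since the contraction stays there, \<open>S\<close> can be the earring or a finite
  wedge.\<close>

theorem homotopic_if_hol_eq:
  assumes f: "path f" "path_image f \<subseteq> S" "pathstart f = 0" "pathfinish f = 0"
    and g: "path g" "path_image g \<subseteq> S" "pathstart g = 0" "pathfinish g = 0"
    and S: "S \<subseteq> Y1" and eq: "\<And>n. n \<ge> N0 \<Longrightarrow> hol n f = hol n g"
  shows "homotopic_paths S f g"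
proof -
  let ?c = "linepath 0 0 :: real \<Rightarrow> pt"
  let ?r = "reversepath g"
  have h: "path (f +++ ?r)" "path_image (f +++ ?r) \<subseteq> S"
    using f g by (auto simp: path_image_join)
  have "homotopic_paths (path_image (f +++ ?r)) (f +++ ?r) (\<lambda>_. 0)"
  proof (rule null_if_hol_Nil)
    show "(f +++ ?r) 0 = 0" "(f +++ ?r) 1 = 0"
      using f g by (simp_all add: joinpaths_def pathstart_def pathfinish_def reversepath_def)
    show "hol n (f +++ ?r) = []" if "n \<ge> N0" for n
    proof -
      have "hol n (f +++ ?r) = red (hol n f @ hol n ?r)"
        by (rule hol_join) (use f g S in auto)
      also have "\<dots> = []"
        unfolding eq [OF that] by (rule hol_join_reversepath) (use g S in auto)
      finally show ?thesis .
    qed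
  qed (use h S in auto)
  then have null: "homotopic_paths S (f +++ ?r) ?c"
    using h(2) homotopic_paths_subset by (simp add: linepath_refl)
  have "homotopic_paths S f (f +++ ?c)"
    using homotopic_paths_rid [OF f(1,2)] f(4) by (simp add: homotopic_paths_sym)
  also have "homotopic_paths S (f +++ ?c) (f +++ (?r +++ g))"
  proof (rule homotopic_paths_join)
    show "homotopic_paths S ?c (?r +++ g)"
      using homotopic_paths_linv [OF g(1,2)] g(4) by (simp add: homotopic_paths_sym)
  qed (use f in auto)
  also have "homotopic_paths S (f +++ (?r +++ g)) ((f +++ ?r) +++ g)"
    by (rule homotopic_paths_assoc) (use f g in auto)
  also have "homotopic_paths S ((f +++ ?r) +++ g) (?c +++ g)"
    by (rule homotopic_paths_join [OF null]) (use g in auto)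
  also have "homotopic_paths S (?c +++ g) g"
    using homotopic_paths_lid [OF g(1,2)] g(3) by simp
  finally show ?thesis .
qed


section \<open>Retractions and collapses\<close>

text \<open>All circles meet at the origin, so formulas in \<open>kap\<close> have coefficients
  without a limit there; continuity at that point comes from the size estimate alone.\<close>

lemma continuous_on_linear_bound_at_0:
  fixes g :: "'a::real_normed_vector \<Rightarrow> 'b::real_normed_vector"
  assumes g: "continuous_on (S - {0}) g" and g0: "g 0 = 0" and e: "0 < e"
    and B: "\<And>p. p \<in> S \<Longrightarrow> p \<noteq> 0 \<Longrightarrow> norm p < e \<Longrightarrow> norm (g p) \<le> B * norm p"
  shows "continuous_on S g"
  unfolding continuous_on_def
proof
  fix p assume p: "p \<in> S"
  show "(g \<longlongrightarrow> g p) (at p within S)"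
  proof (cases "p = 0")
    case True
    have "((\<lambda>q::'a. B * norm q) \<longlongrightarrow> B * norm (0::'a)) (at 0 within S)"
      by (intro tendsto_intros)
    then have "((\<lambda>q. B * norm q) \<longlongrightarrow> 0) (at p within S)"
      using True by simp
    moreover have "\<forall>\<^sub>F q in at p within S. norm (g q) \<le> B * norm q"
      unfolding eventually_at by (intro exI [of _ e]) (use e B True in auto)
    ultimately have "(g \<longlongrightarrow> 0) (at p within S)"
      by (rule Lim_null_comparison [rotated])
    then show ?thesis
      using True g0 by simp
  next
    case False
    have "(g \<longlongrightarrow> g p) (at p within (S - {0}))"
      using p False g by (auto simp: continuous_on_def)
    moreover have "at p within (S - {0}) = at p within S"
      using False by (intro at_within_nhd [of p "- {0}"]) auto
    ultimately show ?thesis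
      by simp
  qed
qed

lemma continuous_on_scaled:
  fixes c :: "pt \<Rightarrow> real"
  assumes c: "continuous_on (S - {0}) c" and B: "\<And>p. p \<in> S \<Longrightarrow> \<bar>c p\<bar> \<le> B"
  shows "continuous_on S (\<lambda>p. c p *\<^sub>R p)"
proof (rule continuous_on_linear_bound_at_0 [where e = 1 and B = B])
  show "continuous_on (S - {0}) (\<lambda>p. c p *\<^sub>R p)"
    by (intro continuous_intros c)
qed (use B in \<open>auto intro: mult_right_mono\<close>)

lemma continuous_on_kap': "continuous_on (S - {0}) kap"
  by (rule continuous_on_subset [OF continuous_on_kap]) auto

text \<open>Scaling by \<open>c\<close> divides \<open>kap\<close> by \<open>c\<close>, so the
  factor \<open>kap p / real N\<close> moves points with smaller \<open>kap\<close> along their rays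
  onto circle \<open>N\<close>.\<close>

definition squash :: "nat \<Rightarrow> pt \<Rightarrow> pt" where
  "squash N p = min 1 (kap p / real N) *\<^sub>R p"

text \<open>A continuous extension of \<open>retr n\<close> beyond the earring, applied to
  homotopies that leave it. The interpolation takes place between \<open>n\<close> and
  \<open>n + 1\<close>, where \<open>Y1\<close> has no points.\<close>

definition cut :: "nat \<Rightarrow> pt \<Rightarrow> pt" where
  "cut n p = max 0 (min 1 (real n + 1 - kap p)) *\<^sub>R p"

lemma squash_0 [simp]: "squash N 0 = 0" and cut_0 [simp]: "cut n 0 = 0"
  by (simp_all add: squash_def cut_def)

lemma continuous_on_squash:
  assumes "S \<subseteq> {p. 0 \<le> kap p}"
  shows "continuous_on S (squash N)"
  unfolding squash_def
proof (rule continuous_on_scaled)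
  show "continuous_on (S - {0}) (\<lambda>p. min 1 (kap p / real N))"
    unfolding divide_inverse by (intro continuous_intros continuous_on_kap')
  fix p assume "p \<in> S"
  then have "0 \<le> kap p / real N"
    using assms by auto
  then show "\<bar>min 1 (kap p / real N)\<bar> \<le> 1"
    by linarith
qed

lemma continuous_on_cut: "continuous_on S (cut n)"
  unfolding cut_def
  by (rule continuous_on_scaled [where B = 1])
    (auto intro!: continuous_intros continuous_on_kap')

lemma Y1_kap_nonneg: "Y1 \<subseteq> {p. 0 \<le> kap p}"
  by (auto simp: Y1_iff)

lemma kap_squash:
  assumes "N \<ge> 1" "p \<noteq> 0" "1 \<le> kap p"
  shows "kap (squash N p) = max (real N) (kap p)" "squash N p \<noteq> 0"
proof -
  have c: "min 1 (kap p / real N) \<noteq> 0"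
    using assms by (auto simp: min_def)
  show "squash N p \<noteq> 0"
    using c assms by (simp add: squash_def)
  show "kap (squash N p) = max (real N) (kap p)"
    using assms unfolding squash_def kap_scaleR [OF c] by (auto simp: min_def max_def field_simps)
qed

lemma cut_eq: "kap p \<le> real n \<Longrightarrow> cut n p = p" "real n + 1 \<le> kap p \<Longrightarrow> cut n p = 0"
  by (simp_all add: cut_def)

lemma retr_eq_cut:
  assumes "p \<in> Y1" "n \<ge> 1"
  shows "retr n p = cut n p"
proof (cases "p \<in> wedge n")
  case True
  then show ?thesis
    using assms wedge_iff [of n p] by (auto simp: retr_def cut_eq)
next
  case False
  then have "p \<noteq> 0" "\<not> idx p \<le> n"
    using assms wedge_iff [of n p] kap_idx [of p] idx_pos [of p] by auto
  then have "real n + 1 \<le> kap p"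
    using kap_idx [OF assms(1)] by simp
  then show ?thesis
    using False by (simp add: retr_def cut_eq zero_prod_def)
qed

lemma retr_in_wedge: "n \<ge> 1 \<Longrightarrow> retr n p \<in> wedge n"
  using wedge_iff [of n 0] by (auto simp: retr_def zero_prod_def)

lemma squash_in_Y1:
  assumes "N \<ge> 1" "p \<in> Y1"
  shows "squash N p = 0 \<or> (\<exists>i\<ge>N. kap (squash N p) = real i)"
proof (cases "p = 0")
  case False
  then have "kap p = real (idx p)" "1 \<le> kap p"
    using kap_idx [OF assms(2)] idx_pos [OF assms(2)] by auto
  then show ?thesis
    using kap_squash [OF assms(1) False] by (intro disjI2 exI [of _ "max N (idx p)"]) auto
qed simp

text \<open>On circle numbers one map takes the maximum with \<open>N\<close> and the other kills
  everything above \<open>n\<close>; these commute because \<open>N \<le> n\<close>.\<close>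

lemma retr_squash:
  assumes "1 \<le> N" "N \<le> n" "p \<in> Y1"
  shows "retr n (squash N p) = squash N (retr n p)"
proof (cases "p = 0")
  case False
  have k: "kap p = real (idx p)" "1 \<le> kap p"
    using kap_idx [OF assms(3)] idx_pos [OF assms(3) False] by auto
  have "squash N p \<in> Y1"
    using squash_in_Y1 [OF assms(1,3)] assms(1) by (auto simp: Y1_iff)
  then have "retr n (squash N p) = cut n (squash N p)" "retr n p = cut n p"
    using retr_eq_cut assms by simp_all
  moreover have "cut n (squash N p) = squash N (cut n p)"
  proof (cases "idx p \<le> n")
    case True
    then show ?thesis
      using kap_squash [OF assms(1) False k(2)] k assms by (simp add: cut_eq)
  next
    case False
    then have "real n + 1 \<le> kap p"
      using k by simp
    then show ?thesis
      using kap_squash [OF assms(1) \<open>p \<noteq> 0\<close> k(2)] assms by (simp add: cut_eq)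
  qed
  ultimately show ?thesis by simp
qed (use assms in \<open>simp add: retr_eq_cut\<close>)

lemma squash_std_loop:
  assumes "1 \<le> i" "1 \<le> N"
  shows "squash N (std_loop i t) = std_loop (if i \<le> N then N else i) t"
proof (cases "std_loop i t = 0")
  case True
  then have "cos (2 * pi * t) = 1" "sin (2 * pi * t) = 0"
    using assms(1) by (auto simp: std_loop_def zero_prod_def field_simps)
  then have "std_loop (if i \<le> N then N else i) t = 0"
    by (simp add: std_loop_def zero_prod_def)
  then show ?thesis
    using True by simp
next
  case False
  then have "kap (std_loop i t) = real i"
    using kap_std_loop assms by blast
  then show ?thesis
    using assms by (auto simp: squash_def std_loop_def min_def field_simps)
qed

lemma squash_letter_loop:
  assumes "1 \<le> i" "1 \<le> N"
  shows "squash N \<circ> letter_loop (i, b) = letter_loop (if i \<le> N then N else i, b)"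
  using squash_std_loop [OF assms] by (auto simp: fun_eq_iff reversepath_def)

text \<open>Scaling carries standard loops to standard loops with the same parametrisation, so this
  is an equality of paths and not just a homotopy.\<close>

lemma squash_word_loop:
  assumes "1 \<le> N" "\<And>a. a \<in> set w \<Longrightarrow> 1 \<le> fst a"
  shows "squash N \<circ> word_loop w = word_loop (collapse N w)"
  using assms(2)
proof (induction w)
  case Nil
  then show ?case
    by (simp add: collapse_def fun_eq_iff squash_def)
next
  case (Cons a w)
  obtain i b where a: "a = (i, b)" by fastforce
  then have "1 \<le> i" using Cons.prems [of a] by simp
  have IH: "squash N \<circ> word_loop w = word_loop (collapse N w)"
    by (rule Cons.IH) (use Cons.prems in auto)
  have "squash N \<circ> word_loop (a # w) = (squash N \<circ> letter_loop (i, b)) +++ (squash N \<circ> word_loop w)"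
    by (simp only: a word_loop.simps path_compose_join)
  also have "\<dots> = letter_loop (if i \<le> N then N else i, b) +++ word_loop (collapse N w)"
    by (simp only: squash_letter_loop [OF \<open>1 \<le> i\<close> assms(1)] IH)
  also have "\<dots> = word_loop (collapse N (a # w))"
    by (simp add: collapse_def a)
  finally show ?case .
qed

section \<open>Canonical sequences computed by crossing words\<close>

lemma path_retr:
  assumes "path f" "path_image f \<subseteq> Y1" "n \<ge> 1"
  shows "path (retr n \<circ> f)" "path_image (retr n \<circ> f) \<subseteq> wedge n"
proof -
  have "continuous_on Y1 (retr n)"
    by (rule continuous_on_eq [OF continuous_on_cut]) (use retr_eq_cut assms in auto)
  then show "path (retr n \<circ> f)"
    using assms by (intro path_continuous_image) (auto intro: continuous_on_subset)
  show "path_image (retr n \<circ> f) \<subseteq> wedge n"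
  proof
    fix x assume "x \<in> path_image (retr n \<circ> f)"
    then obtain t where "x = retr n (f t)"
      unfolding path_image_def by auto
    then show "x \<in> wedge n"
      using retr_in_wedge [OF assms(3)] by simp
  qed
qed

lemma hol_retr:
  assumes f: "path f" "path_image f \<subseteq> Y1" and n: "1 \<le> n" "n \<le> m"
  shows "hol m (retr n \<circ> f) = hol n f"
proof -
  note r = path_retr [OF f n(1)]
  have rY: "path_image (retr n \<circ> f) \<subseteq> Y1"
    using r(2) wedge_subset_Y1 by blast
  obtain K1 K2 where "good m (retr n \<circ> f) K1" "good n f K2"
    using ex_good r(1) f(1) by meson
  then have K: "good m (retr n \<circ> f) (K1 + K2)" "good n f (K1 + K2)"
    by (auto intro: good_mono)
  have "sword m (retr n \<circ> f) (K1 + K2) = sword n f (K1 + K2)"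
    unfolding sword_def
  proof (rule seqword_cong)
    fix k assume "k \<le> K1 + K2"
    then have "f (real k / real (K1 + K2)) \<in> Y1"
      by (intro path_Y1D [OF f(2)]) (use frac01 in blast)+
    then show "cls m ((retr n \<circ> f) (real k / real (K1 + K2))) = cls n (f (real k / real (K1 + K2)))"
      using cls_retr n by simp
  qed
  then show ?thesis
    using hol_eq [OF K(1) rY] hol_eq [OF K(2) f(2)] by simp
qed

lemma set_hol:
  assumes "path f" "path_image f \<subseteq> Y1" "a \<in> set (hol n f)"
  shows "1 \<le> fst a \<and> fst a \<le> n"
proof -
  obtain K where K: "good n f K"
    using ex_good assms(1) by blast
  have "a \<in> set (sword n f K)"
    using assms(3) set_red unfolding hol_eq [OF K assms(2)] by blast
  then have "(fst a, snd a) \<in> set (seqword n (\<lambda>k. f (real k / real K)) 0 K)"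
    by (simp add: sword_def)
  then show ?thesis
    by (rule set_seqword [rotated]) (rule path_Y1D [OF assms(2)]; simp add: frac01)
qed

text \<open>At every level \<open>m \<ge> n\<close> both loops have the crossing word
  \<open>hol n f\<close>, so injectivity applies with threshold \<open>n\<close> and keeps the
  homotopy in the wedge.\<close>

lemma retr_homotopic_word_loop:
  assumes f: "path f" "path_image f \<subseteq> Y1" "pathstart f = 0" "pathfinish f = 0" and n: "n \<ge> 1"
  shows "homotopic_paths (wedge n) (retr n \<circ> f) (word_loop (hol n f))"
proof -
  have w: "path (word_loop (hol n f)) \<and> pathstart (word_loop (hol n f)) = 0 \<and>
      pathfinish (word_loop (hol n f)) = 0 \<and> path_image (word_loop (hol n f)) \<subseteq> wedge n"
    by (rule word_loop) (use set_hol [OF f(1,2), of _ n] wedge_iff [OF n, of 0] Xc_subset_wedge in auto)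
  show ?thesis
  proof (rule homotopic_if_hol_eq)
    show "pathstart (retr n \<circ> f) = 0" "pathfinish (retr n \<circ> f) = 0"
      using f n retr_eq_cut [of 0 n] by (auto simp: pathstart_compose pathfinish_compose)
    show "hol m (retr n \<circ> f) = hol m (word_loop (hol n f))" if "m \<ge> n" for m
    proof -
      have "hol m (word_loop (hol n f)) = red (hol n f)"
        by (rule hol_word_loop) (use set_hol [OF f(1,2), of _ n] that in force)
      then show ?thesis
        using hol_retr [OF f(1,2) n that] by (simp add: red_reduced)
    qed
  qed (use w path_retr [OF f(1,2) n] wedge_subset_Y1 in auto)
qed

text \<open>Existence is the preceding homotopy; uniqueness holds because homotopic loops have the
  same crossing word and the loop of a reduced word has that word itself.\<close>

theorem word_of_eq_hol:
  assumes f: "path f" "path_image f \<subseteq> Y1" "pathstart f = 0" "pathfinish f = 0" and n: "n \<ge> 1"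
  shows "word_of n f = hol n f"
  unfolding word_of_def
proof (rule the_equality)
  show "reduced (hol n f) \<and> (\<forall>(i, b)\<in>set (hol n f). 1 \<le> i \<and> i \<le> n) \<and>
      homotopic_paths (wedge n) (retr n \<circ> f) (word_loop (hol n f))"
    using retr_homotopic_word_loop [OF f n] set_hol [OF f(1,2), of _ n] by force
  fix w assume w: "reduced w \<and> (\<forall>(i, b)\<in>set w. 1 \<le> i \<and> i \<le> n) \<and>
      homotopic_paths (wedge n) (retr n \<circ> f) (word_loop w)"
  then have "homotopic_paths Y1 (retr n \<circ> f) (word_loop w)"
    using wedge_subset_Y1 homotopic_paths_subset by blast
  then have "hol n (retr n \<circ> f) = hol n (word_loop w)"
    by (rule homotopic_paths_hol_eq)
  moreover have "hol n (word_loop w) = red w"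
    by (rule hol_word_loop) (use w in auto)
  ultimately show "w = hol n f"
    using hol_retr [OF f(1,2) n order_refl] w by (simp add: red_reduced)
qed

text \<open>The truncated loop is homotopic to a word loop, and \<open>squash N\<close> turns that
  into the loop of the collapsed word; commuting with \<open>retr n\<close> then settles the whole
  loop. The truncated version occurs where a null homotopy is deformed, the other where one is
  built.\<close>

theorem hol_squash:
  assumes f: "path f" "path_image f \<subseteq> Y1" "pathstart f = 0" "pathfinish f = 0" and N: "1 \<le> N" "N \<le> n"
  shows "hol n (squash N \<circ> f) = red (collapse N (hol n f))"
    and "hol n (squash N \<circ> (retr n \<circ> f)) = red (collapse N (hol n f))"
proof -
  have n: "n \<ge> 1" using N by simp
  have cont: "continuous_on S (squash N)" if "S \<subseteq> Y1" for S
    using that Y1_kap_nonneg by (intro continuous_on_squash) blast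
  have YY: "squash N p \<in> Y1" if "p \<in> Y1" for p
    using squash_in_Y1 [OF N(1) that] N(1) by (auto simp: Y1_iff)
  have "homotopic_paths Y1 (squash N \<circ> (retr n \<circ> f)) (squash N \<circ> word_loop (hol n f))"
    using retr_homotopic_word_loop [OF f n] cont [OF wedge_subset_Y1]
    by (rule homotopic_paths_continuous_image) (use YY wedge_subset_Y1 in auto)
  then have "hol n (squash N \<circ> (retr n \<circ> f)) = hol n (squash N \<circ> word_loop (hol n f))"
    by (rule homotopic_paths_hol_eq)
  also have "squash N \<circ> word_loop (hol n f) = word_loop (collapse N (hol n f))"
    by (rule squash_word_loop [OF N(1)]) (use set_hol [OF f(1,2)] in auto)
  also have "hol n (word_loop (collapse N (hol n f))) = red (collapse N (hol n f))"
    by (rule hol_word_loop) (use set_hol [OF f(1,2), of _ n] N in \<open>auto simp: collapse_def\<close>)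
  finally show *: "hol n (squash N \<circ> (retr n \<circ> f)) = red (collapse N (hol n f))" .
  have s: "path (squash N \<circ> f)" "path_image (squash N \<circ> f) \<subseteq> Y1"
    using f(1) cont [OF f(2)] YY f(2) by (auto intro!: path_continuous_image simp: path_image_compose)
  have "hol n (squash N \<circ> f) = hol n (retr n \<circ> (squash N \<circ> f))"
    using hol_retr [OF s n order_refl] by simp
  also have "\<dots> = hol n (squash N \<circ> (retr n \<circ> f))"
  proof -
    have "homotopic_paths Y1 (retr n \<circ> (squash N \<circ> f)) (squash N \<circ> (retr n \<circ> f))"
    proof (rule homotopic_paths_eq)
      show "path (retr n \<circ> (squash N \<circ> f))" "path_image (retr n \<circ> (squash N \<circ> f)) \<subseteq> Y1"
        using path_retr [OF s n] wedge_subset_Y1 by auto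
      show "(retr n \<circ> (squash N \<circ> f)) t = (squash N \<circ> (retr n \<circ> f)) t" if "t \<in> {0..1}" for t
        using retr_squash [OF N] path_Y1D [OF f(2)] that by simp
    qed
    then show ?thesis
      by (rule homotopic_paths_hol_eq)
  qed
  finally show "hol n (squash N \<circ> f) = red (collapse N (hol n f))"
    using * by simp
qed

section \<open>The harmonic archipelago\<close>

lemma An_iff: "n \<ge> 1 \<Longrightarrow> p \<in> An n \<longleftrightarrow> p = 0 \<or> real n \<le> kap p \<and> kap p \<le> real n + 1"
  using dist_center_le_iff(1) [of n p] dist_center_le_iff(2) [of "Suc n" p]
  by (auto simp: An_def)

text \<open>An interior point of the annulus is interior to the outer disk and outside the closure
  of the inner one, which makes both inequalities strict and excludes the origin.\<close>

lemma intAn_iff: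
  assumes "n \<ge> 1"
  shows "p \<in> intAn n \<longleftrightarrow> real n < kap p \<and> kap p < real n + 1"
proof
  assume p: "p \<in> intAn n"
  have "An n \<subseteq> cball (1 / real n, 0) (1 / real n)"
    by (auto simp: An_def dist_commute)
  then have "p \<in> interior (cball (1 / real n, 0) (1 / real n))"
    using p interior_mono unfolding intAn_def by blast
  then have 1: "dist p (1 / real n, 0) < 1 / real n"
    by (simp add: interior_cball dist_commute)
  have "An n \<subseteq> - ball (1 / real (Suc n), 0) (1 / real (Suc n))"
    by (auto simp: An_def dist_commute)
  then have "p \<in> interior (- ball (1 / real (Suc n), 0) (1 / real (Suc n)))"
    using p interior_mono unfolding intAn_def by blast
  then have "p \<notin> closure (ball (1 / real (Suc n), 0) (1 / real (Suc n)))"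
    unfolding interior_complement by blast
  then have 2: "dist p (1 / real (Suc n), 0) > 1 / real (Suc n)"
    by (simp add: dist_commute del: of_nat_Suc)
  show "real n < kap p \<and> kap p < real n + 1"
    using 1 2 dist_center_le_iff(2) [OF assms, of p] dist_center_le_iff(1) [of "Suc n" p]
    by auto
next
  assume p: "real n < kap p \<and> kap p < real n + 1"
  define U where "U = {q \<in> - {0}. kap q \<in> {real n <..< real n + 1}}"
  have "open U"
    unfolding U_def by (rule open_kap_interval)
  moreover have "U \<subseteq> An n"
    using An_iff [OF assms] by (auto simp: U_def)
  moreover have "p \<in> U"
    using p assms by (auto simp: U_def)
  ultimately show "p \<in> intAn n"
    unfolding intAn_def using interior_maximal by blast
qed

lemma Yup_iff:
  assumes "n \<ge> 1"
  shows "p \<in> Yup n \<longleftrightarrow> p \<in> Y1 \<or> 1 \<le> kap p \<and> kap p \<le> real n + 1"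
proof
  assume "p \<in> Yup n"
  then consider "p \<in> Y1" | i where "1 \<le> i" "i \<le> n" "p \<in> An i"
    by (auto simp: Yup_def)
  then show "p \<in> Y1 \<or> 1 \<le> kap p \<and> kap p \<le> real n + 1"
  proof cases
    case 2
    then have "p = 0 \<or> real i \<le> kap p \<and> kap p \<le> real i + 1" "1 \<le> real i" "real i \<le> real n"
      using An_iff [of i p] by auto
    then show ?thesis
      by (cases "p = 0") auto
  qed simp
next
  assume R: "p \<in> Y1 \<or> 1 \<le> kap p \<and> kap p \<le> real n + 1"
  show "p \<in> Yup n"
  proof (cases "p \<in> Y1")
    case False
    with R have k: "1 \<le> kap p" "kap p \<le> real n + 1" by auto
    define f where "f = nat \<lfloor>kap p\<rfloor>"
    have f: "1 \<le> f" "real f \<le> kap p" "kap p \<le> real f + 1"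
      using k by (auto simp: f_def le_nat_iff le_floor_iff of_nat_nat)
    obtain i where i: "1 \<le> i" "i \<le> n" "real i \<le> kap p" "kap p \<le> real i + 1"
    proof (cases "n \<le> f")
      case True
      then have "real n \<le> real f" by simp
      then show ?thesis
        using that [of n] assms k f by linarith
    qed (use that [of f] f in auto)
    then have "p \<in> An i"
      using An_iff [of i p] by simp
    then show ?thesis
      using i by (auto simp: Yup_def)
  qed (simp add: Yup_def)
qed

lemma HA_set_iff: "p \<in> HA_set \<longleftrightarrow> p = 0 \<or> 1 \<le> kap p"
proof -
  have "\<exists>n\<ge>1. kap p \<le> real n + 1"
    using real_arch_simple [of "kap p"] by (metis add_increasing2 le_add1 le_add2 of_nat_add of_nat_mono order_trans zero_le_one)
  then show ?thesis
    by (auto simp: HA_set_def Yup_iff Y1_iff)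
qed

section \<open>Convergence in the archipelago and in the plane\<close>

lemma norm_le_kap: "p \<noteq> 0 \<Longrightarrow> 0 < kap p \<Longrightarrow> norm p \<le> 2 / kap p"
proof -
  assume p: "p \<noteq> 0" "0 < kap p"
  have "kap p * (norm p)\<^sup>2 = 2 * fst p"
    using p by (simp add: kap_def)
  also have "\<dots> \<le> 2 * norm p"
    using norm_fst_le [of "fst p" "snd p"] by (simp add: abs_le_iff)
  finally have "kap p * norm p \<le> 2"
    using p by (simp add: power2_eq_square)
  then show "norm p \<le> 2 / kap p"
    using p by (simp add: field_simps)
qed

text \<open>A sequence leaving every \<open>Yup m\<close> can only converge to the origin in the archipelago, and such a
  sequence also converges to the origin in the plane.\<close>

lemma limitin_HA_imp_tendsto:
  assumes T: "HA_topology T" and lim: "limitin T y p sequentially"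
    and y: "\<And>k. y k \<in> HA_set"
  shows "y \<longlonglongrightarrow> p"
proof (rule ccontr)
  assume "\<not> y \<longlonglongrightarrow> p"
  then obtain e where e: "e > 0" "\<not> eventually (\<lambda>k. dist (y k) p < e) sequentially"
    by (auto simp: tendsto_iff)
  obtain r :: "nat \<Rightarrow> nat" where r: "strict_mono r" "\<And>k. \<not> dist (y (r k)) p < e"
    using not_eventually_sequentiallyD [OF e(2)] by blast
  define w where "w = y \<circ> r"
  have w: "\<And>k. w k \<in> HA_set" "\<And>k. \<not> dist (w k) p < e"
    using y r by (auto simp: w_def)
  have limw: "limitin T w p sequentially"
    unfolding w_def by (rule limitin_subsequence [OF r(1) lim])
  have topT: "topspace T = HA_set" and sub: "\<And>n. n \<ge> 1 \<Longrightarrow> subtopology T (Yup n) = top_of_set (Yup n)"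
    using T by (auto simp: HA_topology_def)
  have p: "p \<in> HA_set"
    using lim limitin_topspace topT by metis
  show False
  \<comment> \<open>If infinitely many terms lie in one \<open>Yup m\<close>, a larger one contains
    the limit too, and there both topologies agree. Otherwise the terms visit annuli of unbounded
    number.\<close>
  proof (cases "\<exists>m\<ge>1. infinite {k. w k \<in> Yup m}")
    case True
    then obtain m where m: "m \<ge> 1" "infinite {k. w k \<in> Yup m}" by blast
    obtain s :: "nat \<Rightarrow> nat" where s: "strict_mono s" "\<And>k. s k \<in> {k. w k \<in> Yup m}"
      using infinite_enumerate [OF m(2)] by blast
    obtain m' where m': "m' \<ge> 1" "p \<in> Yup m'"
      using p by (auto simp: HA_set_def)
    define M where "M = max m m'"
    have M: "M \<ge> 1" "Yup m \<subseteq> Yup M" "Yup m' \<subseteq> Yup M"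
      using m m' by (auto simp: M_def Yup_iff)
    have "limitin (subtopology T (Yup M)) (w \<circ> s) p sequentially"
      unfolding limitin_subtopology
      using limitin_subsequence [OF s(1) limw] s(2) M m' by (auto intro!: always_eventually)
    then have "(w \<circ> s) \<longlonglongrightarrow> p"
      unfolding sub [OF M(1)] limitin_subtopology by simp
    then have "\<forall>\<^sub>F k in sequentially. dist ((w \<circ> s) k) p < e"
      using e(1) by (rule tendstoD)
    then show False
      using w(2) by (auto simp: eventually_sequentially)
  next
    case False
    define J where "J q = nat \<lfloor>kap q\<rfloor>" for q
    have J: "w k \<in> intAn (J (w k)) \<and> J (w k) \<ge> 1" if "w k \<notin> Yup 1" for k
    proof -
      have k: "w k \<notin> Y1" "1 < kap (w k)"
        using w(1) [of k] that by (auto simp: HA_set_iff Yup_iff)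
      then have J1: "J (w k) \<ge> 1"
        by (auto simp: J_def le_nat_iff le_floor_iff)
      then have "real (J (w k)) \<noteq> kap (w k)" "J (w k) \<ge> 1"
        using k(1) unfolding Y1_iff by metis+
      moreover have "real (J (w k)) \<le> kap (w k)" "kap (w k) < real (J (w k)) + 1"
        using k by (auto simp: J_def of_nat_nat)
      ultimately show ?thesis
        using intAn_iff [of "J (w k)"] by simp
    qed
    have large: "\<exists>k>b. w k \<notin> Yup 1 \<and> m < J (w k)" for m b
    proof -
      have "finite ({k. w k \<in> Yup (m + 1)} \<union> {..b})"
        using False by simp
      then obtain k where k: "k \<notin> {k. w k \<in> Yup (m + 1)} \<union> {..b}"
        using infinite_UNIV_nat ex_new_if_finite by blast
      then have "kap (w k) > real m + 2" "w k \<notin> Yup 1"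
        using w(1) [of k] by (auto simp: HA_set_iff Yup_iff)
      then show ?thesis
        using k by (intro exI [of _ k]) (auto simp: J_def zless_nat_eq_int_zless less_floor_iff)
    qed
    \<comment> \<open>Strictly increasing annulus numbers give each annulus at most one term and
      form an admissible index sequence.\<close>
    have "\<exists>s. \<forall>n. w (s n) \<notin> Yup 1 \<and> s n < s (Suc n) \<and> J (w (s n)) < J (w (s (Suc n)))"
    proof (rule dependent_nat_choice [where P = "\<lambda>_ k. w k \<notin> Yup 1" and Q = "\<lambda>_ k k'. k < k' \<and> J (w k) < J (w k')"])
      show "\<exists>k. w k \<notin> Yup 1"
        using large by blast
      show "\<exists>k'. w k' \<notin> Yup 1 \<and> k < k' \<and> J (w k) < J (w k')" for k
        using large [where b = k and m = "J (w k)"] by blast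
    qed
    then obtain s where "\<forall>n. w (s n) \<notin> Yup 1 \<and> s n < s (Suc n) \<and> J (w (s n)) < J (w (s (Suc n)))" ..
    then have s: "\<And>k. w (s k) \<notin> Yup 1" "\<And>k. s k < s (Suc k) \<and> J (w (s k)) < J (w (s (Suc k)))"
      by simp_all
    have sm: "strict_mono s" "strict_mono (\<lambda>k. J (w (s k)))"
      using s(2) by (auto simp: strict_mono_Suc_iff)
    obtain z where z: "\<And>n. n \<ge> 1 \<Longrightarrow> z n \<in> intAn n"
      using T by (auto simp: HA_topology_def)
    \<comment> \<open>The condition on limits is about sequences with a point in every open annulus,
      so the annuli without a chosen term are filled with \<open>z\<close>.\<close>
    define v where "v n = (if \<exists>k. n = J (w (s k)) then w (s (SOME k. n = J (w (s k)))) else z n)" for n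
    have v: "v (J (w (s k))) = w (s k)" for k
    proof -
      have "J (w (s k)) = J (w (s l)) \<longleftrightarrow> k = l" for l
        using strict_mono_eq [OF sm(2), of k l] by simp
      then have "(SOME l. J (w (s k)) = J (w (s l))) = k"
        by simp
      then show ?thesis
        by (auto simp: v_def)
    qed
    have "v n \<in> intAn n" if "n \<ge> 1" for n
    proof (cases "\<exists>k. n = J (w (s k))")
      case True
      then obtain k where k: "n = J (w (s k))" by blast
      then show ?thesis
        using v [of k] J [OF s(1), of k] by simp
    qed (use z that in \<open>simp add: v_def\<close>)
    have "v \<circ> (\<lambda>k. J (w (s k))) = w \<circ> s"
      using v by auto
    then have "limitin T (v \<circ> (\<lambda>k. J (w (s k)))) p sequentially"
      using limitin_subsequence [OF sm(1) limw] by simp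
    have p0: "p = 0"
    proof -
      have "\<forall>y p. (\<forall>n\<ge>1. y n \<in> intAn n) \<and> (\<exists>r. strict_mono r \<and> limitin T (y \<circ> r) p sequentially) \<longrightarrow> p = 0"
        using T by (simp add: HA_topology_def zero_prod_def)
      then show ?thesis
        using sm(2) \<open>\<And>n. n \<ge> 1 \<Longrightarrow> v n \<in> intAn n\<close> \<open>limitin T (v \<circ> (\<lambda>k. J (w (s k)))) p sequentially\<close> by blast
    qed
    have "norm (w (s k)) \<le> 2 / real k" if "k > 0" for k
    proof -
      have "k \<le> J (w (s k))"
        using strict_mono_imp_increasing [OF sm(2)] by simp
      moreover have "real (J (w (s k))) < kap (w (s k))"
        using J [OF s(1), of k] intAn_iff by blast
      ultimately have k: "real k \<le> kap (w (s k))"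
        by simp
      then have "w (s k) \<noteq> 0" using that by auto
      then have "norm (w (s k)) \<le> 2 / kap (w (s k))"
        using norm_le_kap k that by simp
      also have "\<dots> \<le> 2 / real k"
        using k that by (intro divide_left_mono) auto
      finally show ?thesis .
    qed
    moreover obtain k where k: "k > 0" "inverse (real k) < e / 2"
      using e(1) by (metis ex_inverse_of_nat_less half_gt_zero)
    moreover have "2 / real k < e"
      using k by (simp add: field_simps)
    ultimately have "norm (w (s k)) < e"
      by (meson le_less_trans)
    then show False
      using w(2) [of "s k"] p0 by simp
  qed
qed

text \<open>In inverted coordinates \<open>p \<mapsto> 2 *\<^sub>R p /\<^sub>R (norm p)\<^sup>2\<close> the annulus becomes a strip with vertical sides, and
  \<open>radial m a\<close> is the projection from \<open>a\<close> to the side at \<open>m\<close>. Clearing denominators makes the formula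
  meaningful for the points at the height of \<open>a\<close>, which are sent to the origin.\<close>

definition radial_dir :: "pt \<Rightarrow> pt \<Rightarrow> pt" where
  "radial_dir a p = 2 *\<^sub>R p - (norm p)\<^sup>2 *\<^sub>R ((2 / (norm a)\<^sup>2) *\<^sub>R a)"

definition radial_num :: "real \<Rightarrow> pt \<Rightarrow> pt \<Rightarrow> pt" where
  "radial_num m a p = \<bar>fst (radial_dir a p)\<bar> *\<^sub>R ((2 / (norm a)\<^sup>2) *\<^sub>R a) + \<bar>m - kap a\<bar> *\<^sub>R radial_dir a p"

definition radial :: "real \<Rightarrow> pt \<Rightarrow> pt \<Rightarrow> pt" where
  "radial m a p = (2 * \<bar>fst (radial_dir a p)\<bar> / (norm (radial_num m a p))\<^sup>2) *\<^sub>R radial_num m a p"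

text \<open>With P and A the inverted points of \<open>p\<close> and \<open>a\<close>,
  \<open>radial_dir a p\<close> is \<open>(norm p)\<^sup>2\<close> times P - A, and the first
  coordinate of an inverted point is its \<open>kap\<close>.\<close>

lemma fst_radial_dir: "p \<noteq> 0 \<Longrightarrow> fst (radial_dir a p) = (norm p)\<^sup>2 * (kap p - kap a)"
  by (simp add: radial_dir_def kap_def field_simps)

text \<open>The ray from A through P meets the vertical line at \<open>m\<close> in some point X,
  provided \<open>p\<close> and \<open>m\<close> are on the same side of \<open>a\<close>; that is
  the sign hypothesis. \<open>radial_num\<close> is X multiplied by
  \<open>\<bar>fst (radial_dir a p)\<bar>\<close>, and \<open>radial\<close> inverts X back.\<close>

lemma fst_radial_num:
  assumes "0 \<le> (kap p - kap a) * (m - kap a)" "p \<noteq> 0"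
  shows "fst (radial_num m a p) = \<bar>fst (radial_dir a p)\<bar> * m"
proof -
  have "\<bar>m - kap a\<bar> * fst (radial_dir a p) = \<bar>fst (radial_dir a p)\<bar> * (m - kap a)"
  proof -
    have "\<bar>m - kap a\<bar> * (kap p - kap a) = \<bar>kap p - kap a\<bar> * (m - kap a)"
    proof -
      have "\<bar>y\<bar> * x = \<bar>x\<bar> * y" if "0 \<le> x * y" for x y :: real
        using that by (auto simp: zero_le_mult_iff abs_if)
      then show ?thesis
        using assms(1) by blast
    qed
    then show ?thesis
      using assms(2) by (simp add: fst_radial_dir abs_mult mult.left_commute)
  qed
  moreover have "fst ((2 / (norm a)\<^sup>2) *\<^sub>R a) = kap a"
    by (simp add: kap_def)
  moreover have "fst (radial_num m a p) =
      \<bar>fst (radial_dir a p)\<bar> * fst ((2 / (norm a)\<^sup>2) *\<^sub>R a) + \<bar>m - kap a\<bar> * fst (radial_dir a p)"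
    by (simp only: radial_num_def fst_add fst_scaleR real_scaleR_def)
  ultimately show ?thesis
    by (simp add: right_diff_distrib)
qed

text \<open>Inversion is injective: equal inverted points are positive multiples of each other with
  equal norms.\<close>

lemma radial_dir_nonzero:
  assumes "p \<noteq> 0" "a \<noteq> 0" "p \<noteq> a"
  shows "radial_dir a p \<noteq> 0"
proof
  assume "radial_dir a p = 0"
  then have "2 *\<^sub>R p = (norm p)\<^sup>2 *\<^sub>R ((2 / (norm a)\<^sup>2) *\<^sub>R a)"
    by (simp add: radial_dir_def)
  then have eq: "p = ((norm p)\<^sup>2 / (norm a)\<^sup>2) *\<^sub>R a"
    by (metis (no_types, lifting) divide_inverse mult.assoc mult.left_commute mult_2_right
        real_vector.scale_scale scaleR_cancel_left times_divide_eq_left zero_neq_numeral)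
  then have "norm p = (norm p)\<^sup>2 / (norm a)\<^sup>2 * norm a"
    by (metis abs_of_nonneg divide_nonneg_nonneg norm_scaleR zero_le_power2)
  then have "norm p = norm a"
    using assms by (simp add: power2_eq_square field_simps)
  then show False
    using eq assms by simp
qed

lemma radial_num_nonzero:
  assumes "0 \<le> (kap p - kap a) * (m - kap a)" "p \<noteq> 0" "a \<noteq> 0" "p \<noteq> a" "m > 0" "m \<noteq> kap a"
  shows "radial_num m a p \<noteq> 0"
proof (cases "fst (radial_dir a p) = 0")
  case True
  then show ?thesis
    using radial_dir_nonzero assms by (simp add: radial_num_def)
next
  case False
  then have "fst (radial_num m a p) \<noteq> 0"
    using fst_radial_num [OF assms(1,2)] assms by simp
  then show ?thesis by auto
qed

lemma kap_radial:
  assumes "0 \<le> (kap p - kap a) * (m - kap a)" "p \<noteq> 0" "a \<noteq> 0" "p \<noteq> a" "m > 0" "m \<noteq> kap a"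
  shows "radial m a p = 0 \<or> kap (radial m a p) = m"
proof (cases "fst (radial_dir a p) = 0")
  case True
  then show ?thesis
    by (simp add: radial_def)
next
  case False
  define v where "v = radial_num m a p"
  define k where "k = \<bar>fst (radial_dir a p)\<bar>"
  have v: "v \<noteq> 0" "fst v = k * m" and k: "k > 0"
    using radial_num_nonzero [OF assms] fst_radial_num [OF assms(1,2)] False by (auto simp: v_def k_def)
  have "kap ((2 * k / (norm v)\<^sup>2) *\<^sub>R v) = kap v / (2 * k / (norm v)\<^sup>2)"
    using v k by (intro kap_scaleR) auto
  also have "\<dots> = m"
    using v k by (simp add: kap_def field_simps)
  finally show ?thesis
    by (simp add: radial_def v_def k_def)
qed

lemma radial_fixed:
  assumes "kap p = m" "p \<noteq> 0" "m \<noteq> kap a"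
  shows "radial m a p = p"
proof -
  define b where "b = \<bar>m - kap a\<bar>"
  have b: "b > 0"
    using assms by (simp add: b_def)
  have k: "\<bar>fst (radial_dir a p)\<bar> = (norm p)\<^sup>2 * b"
    using assms by (simp add: fst_radial_dir b_def abs_mult)
  have v: "radial_num m a p = (2 * b) *\<^sub>R p"
    unfolding radial_num_def k b_def [symmetric] by (simp add: radial_dir_def algebra_simps)
  have "radial m a p = (2 * ((norm p)\<^sup>2 * b) / (norm ((2 * b) *\<^sub>R p))\<^sup>2 * (2 * b)) *\<^sub>R p"
    unfolding radial_def k v by simp
  also have "2 * ((norm p)\<^sup>2 * b) / (norm ((2 * b) *\<^sub>R p))\<^sup>2 * (2 * b) = 1"
    using b assms by (simp add: power2_eq_square field_simps)
  finally show ?thesis by simp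
qed

text \<open>Near the origin the term \<open>2 *\<^sub>R p\<close> dominates
  \<open>radial_dir\<close>, so \<open>radial_num\<close> is at least of order
  \<open>norm p\<close>, while its scaling factor has a numerator of order
  \<open>(norm p)\<^sup>2\<close>. This supplies continuity at the origin.\<close>

lemma radial_bound:
  assumes a: "a \<noteq> 0" "m \<noteq> kap a"
  obtains e C where "e > 0"
    "\<And>p. \<lbrakk>p \<noteq> 0; norm p < e; \<bar>kap p - kap a\<bar> \<le> 1\<rbrakk> \<Longrightarrow> norm (radial m a p) \<le> C * norm p"
proof -
  define b where "b = \<bar>m - kap a\<bar>"
  define c where "c = norm ((2 / (norm a)\<^sup>2) *\<^sub>R a)"
  have b: "b > 0" and c: "c \<ge> 0"
    using a by (auto simp: b_def c_def)
  \<comment> \<open>Ensures \<open>(b + 1) * c * norm p \<le> b\<close>, which absorbs both terms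
    containing the inverted \<open>a\<close> and leaves
    \<open>norm v \<ge> b * norm p\<close>.\<close>
  define e where "e = b / ((b + 1) * c + 1)"
  show ?thesis
  proof
    show "e > 0"
      using b c by (simp add: e_def add_nonneg_pos)
    fix p :: pt assume p: "p \<noteq> 0" "norm p < e" "\<bar>kap p - kap a\<bar> \<le> 1"
    define k where "k = \<bar>fst (radial_dir a p)\<bar>"
    define v where "v = radial_num m a p"
    have k: "0 \<le> k" "k \<le> (norm p)\<^sup>2"
      using p by (auto simp: k_def fst_radial_dir abs_mult intro: mult_left_le)
    have n: "norm p > 0" using p by simp
    have small: "(b + 1) * c * norm p \<le> b"
    proof -
      have "((b + 1) * c + 1) * norm p \<le> ((b + 1) * c + 1) * e"
        using p b c by (intro mult_left_mono) auto
      also have "\<dots> = b"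
        using b c by (simp add: e_def add_nonneg_pos less_imp_neq [symmetric])
      finally have "((b + 1) * c + 1) * norm p \<le> b" .
      moreover have "((b + 1) * c + 1) * norm p = (b + 1) * c * norm p + norm p"
        by (simp add: algebra_simps)
      ultimately show ?thesis
        using n by linarith
    qed
    have "norm (radial_dir a p) \<ge> norm (2 *\<^sub>R p) - norm ((norm p)\<^sup>2 *\<^sub>R ((2 / (norm a)\<^sup>2) *\<^sub>R a))"
      unfolding radial_dir_def by (rule norm_triangle_ineq2)
    then have d: "norm (radial_dir a p) \<ge> 2 * norm p - (norm p)\<^sup>2 * c"
      by (simp add: c_def)
    have "norm v \<ge> norm (b *\<^sub>R radial_dir a p) - norm (k *\<^sub>R ((2 / (norm a)\<^sup>2) *\<^sub>R a))"
      unfolding v_def radial_num_def k_def [symmetric] b_def [symmetric]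
      by (metis add.commute norm_diff_ineq)
    then have "norm v \<ge> b * norm (radial_dir a p) - k * c"
      using b k by (simp add: c_def)
    moreover have "b * norm (radial_dir a p) \<ge> b * (2 * norm p - (norm p)\<^sup>2 * c)"
      using d b by (intro mult_left_mono) auto
    moreover have "k * c \<le> (norm p)\<^sup>2 * c"
      using k c by (intro mult_right_mono) auto
    moreover have "(b + 1) * c * norm p * norm p \<le> b * norm p"
      using small n by (intro mult_right_mono) auto
    ultimately have v: "norm v \<ge> b * norm p"
      by (simp add: power2_eq_square algebra_simps)
    then have v0: "norm v > 0"
      using b n by (meson less_le_trans mult_pos_pos)
    have "norm (radial m a p) = 2 * k / (norm v)\<^sup>2 * norm v"
      using k by (simp add: radial_def v_def k_def)
    also have "\<dots> = 2 * k / norm v"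
      using v0 by (simp add: power2_eq_square)
    also have "\<dots> \<le> 2 * (norm p)\<^sup>2 / (b * norm p)"
      using v k b n by (intro frac_le) auto
    also have "\<dots> = 2 / b * norm p"
      using b n by (simp add: power2_eq_square)
    finally show "norm (radial m a p) \<le> 2 / b * norm p" .
  qed
qed

lemma continuous_on_radial:
  assumes "\<And>p. p \<in> S \<Longrightarrow> radial_num m a p \<noteq> 0"
  shows "continuous_on S (radial m a)"
proof -
  have 1: "continuous_on S (radial_dir a)"
    unfolding radial_dir_def by (intro continuous_intros)
  then have 2: "continuous_on S (radial_num m a)"
    unfolding radial_num_def by (intro continuous_intros)
  show ?thesis
    unfolding radial_def by (intro continuous_intros 1 2) (use assms in auto)
qed

text \<open>In the strip, the vertical line through \<open>a\<close> separates the points projected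
  to the side at \<open>j\<close> from those projected to the side at \<open>j + 1\<close>. Along
  that line both projections run off to infinity, the origin of the plane, so the branches fit
  together.\<close>

definition puncture :: "nat \<Rightarrow> pt \<Rightarrow> pt \<Rightarrow> pt" where
  "puncture j a p = (if kap p \<le> real j then p else if kap p \<le> kap a then radial (real j) a p
    else if kap p \<le> real j + 1 then radial (real j + 1) a p else p)"

lemma puncture_0 [simp]: "puncture j a 0 = 0"
  by (simp add: puncture_def)

lemma puncture_cases:
  assumes j: "j \<ge> 1" and a: "a \<in> intAn j" and p: "p \<noteq> 0" "p \<noteq> a"
  shows "puncture j a p = p \<and> (kap p \<le> real j \<or> real j + 1 \<le> kap p) \<or>
    puncture j a p = 0 \<or> kap (puncture j a p) = real j \<or> kap (puncture j a p) = real j + 1"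
proof -
  have k: "real j < kap a" "kap a < real j + 1"
    using a intAn_iff [OF j] by auto
  then have a0: "a \<noteq> 0" by auto
  have "radial (real j) a p = 0 \<or> kap (radial (real j) a p) = real j" if "kap p \<le> kap a"
    by (rule kap_radial) (use that k j p a0 in \<open>auto intro: mult_nonpos_nonpos\<close>)
  moreover have "radial (real j + 1) a p = 0 \<or> kap (radial (real j + 1) a p) = real j + 1" if "kap a \<le> kap p"
    by (rule kap_radial) (use that k j p a0 in auto)
  ultimately show ?thesis
    by (auto simp: puncture_def)
qed

text \<open>At the seams \<open>j\<close> and \<open>j + 1\<close> the projections fix the circles,
  at \<open>kap a\<close> both vanish. The origin is adherent to all branches and is treated by the
  linear bound.\<close>

lemma continuous_on_puncture:
  assumes j: "j \<ge> 1" and a: "a \<in> intAn j"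
  shows "continuous_on (- {a}) (puncture j a)"
proof -
  have k: "real j < kap a" "kap a < real j + 1"
    using a intAn_iff [OF j] by auto
  then have a0: "a \<noteq> 0" by auto
  define R where "R = - {0, a}"
  have kR: "continuous_on X kap" if "X \<subseteq> R" for X
    by (rule continuous_on_subset [OF continuous_on_kap]) (use that in \<open>auto simp: R_def\<close>)
  have lo: "continuous_on {p \<in> R. kap p \<le> kap a} (radial (real j) a)"
    by (rule continuous_on_radial, rule radial_num_nonzero)
      (use k j a0 in \<open>auto simp: R_def intro: mult_nonpos_nonpos\<close>)
  have hi: "continuous_on {p \<in> R. kap a \<le> kap p} (radial (real j + 1) a)"
    by (rule continuous_on_radial, rule radial_num_nonzero)
      (use k j a0 in \<open>auto simp: R_def\<close>)
  have "continuous_on R (puncture j a)"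
    unfolding puncture_def
  proof (intro continuous_on_cases_le)
    show "continuous_on {p \<in> {p \<in> {p \<in> R. real j \<le> kap p}. kap a \<le> kap p}. kap p \<le> real j + 1} (radial (real j + 1) a)"
      by (rule continuous_on_subset [OF hi]) auto
    show "continuous_on {p \<in> {p \<in> R. real j \<le> kap p}. kap p \<le> kap a} (radial (real j) a)"
      by (rule continuous_on_subset [OF lo]) auto
    fix p assume p: "p \<in> {p \<in> {p \<in> R. real j \<le> kap p}. kap a \<le> kap p}" "kap p = real j + 1"
    then show "radial (real j + 1) a p = p"
      using k by (intro radial_fixed) (auto simp: R_def)
  next
    fix p assume p: "p \<in> {p \<in> R. real j \<le> kap p}" "kap p = kap a"
    then have "radial (real j) a p = 0" "radial (real j + 1) a p = 0"
      by (auto simp: radial_def R_def fst_radial_dir)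
    then show "radial (real j) a p = (if kap p \<le> real j + 1 then radial (real j + 1) a p else p)"
      using p k by simp
  next
    fix p assume p: "p \<in> R" "kap p = real j"
    then show "p = (if kap p \<le> kap a then radial (real j) a p else if kap p \<le> real j + 1 then radial (real j + 1) a p else p)"
      using k radial_fixed [of p "real j" a] by (auto simp: R_def)
  qed (auto intro!: kR continuous_intros)
  then have cont: "continuous_on (- {a} - {0}) (puncture j a)"
    by (rule continuous_on_subset) (auto simp: R_def)
  obtain e1 C1 where e1: "e1 > 0"
    "\<And>p. \<lbrakk>p \<noteq> 0; norm p < e1; \<bar>kap p - kap a\<bar> \<le> 1\<rbrakk> \<Longrightarrow> norm (radial (real j) a p) \<le> C1 * norm p"
    using radial_bound [OF a0, of "real j"] k by auto
  obtain e2 C2 where e2: "e2 > 0"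
    "\<And>p. \<lbrakk>p \<noteq> 0; norm p < e2; \<bar>kap p - kap a\<bar> \<le> 1\<rbrakk> \<Longrightarrow> norm (radial (real j + 1) a p) \<le> C2 * norm p"
    using radial_bound [OF a0, of "real j + 1"] k by auto
  show ?thesis
  proof (rule continuous_on_linear_bound_at_0 [OF cont, of "min e1 e2" "max 1 (max C1 C2)"])
    fix p :: pt assume p: "p \<noteq> 0" "norm p < min e1 e2"
    have mono: "x \<le> max 1 (max C1 C2) * norm p" if "x \<le> C * norm p" "C \<le> max 1 (max C1 C2)" for x C
      using that mult_right_mono [OF that(2) norm_ge_zero [of p]] by linarith
    show "norm (puncture j a p) \<le> max 1 (max C1 C2) * norm p"
      unfolding puncture_def using mono [of _ 1] mono [of _ C1] mono [of _ C2] e1(2) [of p] e2(2) [of p] p k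
      by auto
  qed (use e1 e2 in auto)
qed

lemma puncture_Y1:
  assumes j: "j \<ge> 1" and a: "a \<in> intAn j" and p: "p \<in> Y1"
  shows "puncture j a p = p"
proof (cases "kap p \<le> real j")
  case False
  have k: "real j < kap a" "kap a < real j + 1"
    using a intAn_iff [OF j] by auto
  have "p \<noteq> 0" using False j by auto
  have "real j + 1 \<le> kap p"
    using False kap_idx [OF p] by simp
  then show ?thesis
    using k False radial_fixed [of p "real j + 1" a] \<open>p \<noteq> 0\<close> by (auto simp: puncture_def)
qed (simp add: puncture_def)

text \<open>One \<open>puncture\<close> per annulus. Moved points land at the origin or on a circle
  numbered at most \<open>Suc m\<close>, so they neither return to a cleared annulus nor hit a later
  puncture. Points of \<open>Y1\<close> never move, which preserves the boundary values of a
  homotopy.\<close>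

lemma push_off_punctures:
  assumes h: "continuous_on S h" "h ` S \<subseteq> HA_set" and N: "N \<ge> 1"
    and a: "\<And>i. i \<ge> N \<Longrightarrow> a i \<in> intAn i \<and> a i \<notin> h ` S" and m: "N \<le> m"
  shows "\<exists>H. continuous_on S H \<and> (\<forall>x\<in>S. H x \<in> HA_set \<and> (\<forall>i\<ge>m. H x \<noteq> a i) \<and>
    (\<forall>i. N \<le> i \<and> i < m \<longrightarrow> \<not> (real i < kap (H x) \<and> kap (H x) < real i + 1)) \<and> (h x \<in> Y1 \<longrightarrow> H x = h x))"
  using m
proof (induction m rule: dec_induct)
  case base
  have "h x \<noteq> a i" if "x \<in> S" "N \<le> i" for x i
    using a [OF that(2)] that(1) by (metis imageI)
  then show ?case
    using h by (intro exI [of _ h]) auto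
next
  case (step m)
  then obtain H where H: "continuous_on S H" and Hx: "\<And>x. x \<in> S \<Longrightarrow> H x \<in> HA_set"
    "\<And>x i. x \<in> S \<Longrightarrow> i \<ge> m \<Longrightarrow> H x \<noteq> a i"
    "\<And>x i. x \<in> S \<Longrightarrow> N \<le> i \<Longrightarrow> i < m \<Longrightarrow> \<not> (real i < kap (H x) \<and> kap (H x) < real i + 1)"
    "\<And>x. x \<in> S \<Longrightarrow> h x \<in> Y1 \<Longrightarrow> H x = h x"
    by blast
  have m1: "m \<ge> 1" and am: "a m \<in> intAn m"
    using step N a by auto
  have ka: "real i < kap (a i)" if "i \<ge> m" for i
    using a [of i] intAn_iff [of i] that step N by simp
  let ?H = "\<lambda>x. puncture m (a m) (H x)"
  have int: "\<not> (real i < real l \<and> real l < real i + 1)" for i l :: nat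
  proof (cases "i < l")
    case True
    then have "real i + 1 \<le> real l" by simp
    then show ?thesis by simp
  qed simp
  show ?case
  proof (intro exI [of _ ?H] conjI ballI allI impI)
    show "continuous_on S ?H"
      by (rule continuous_on_compose2 [OF continuous_on_puncture [OF m1 am] H])
        (rule image_subsetI, use Hx(2) [OF _ order_refl] in simp)
    fix x assume x: "x \<in> S"
    have cases: "?H x = H x \<and> \<not> (real m < kap (H x) \<and> kap (H x) < real m + 1) \<or> ?H x = 0 \<or>
        (\<exists>l. m \<le> l \<and> l \<le> Suc m \<and> kap (?H x) = real l)"
    proof (cases "H x = 0")
      case False
      have "kap (?H x) = real m + 1 \<Longrightarrow> kap (?H x) = real (Suc m)" by simp
      then show ?thesis
        using puncture_cases [OF m1 am False Hx(2) [OF x order_refl]] by (meson le_Suc_eq le_refl not_less)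
    qed simp
    show "?H x \<in> HA_set"
      using cases Hx(1) [OF x] m1 by (auto simp: HA_set_iff)
    show "?H x \<noteq> a i" if "Suc m \<le> i" for i
      using cases
    proof (elim disjE conjE exE)
      fix l assume "l \<le> Suc m" "kap (?H x) = real l"
      then have "kap (?H x) \<le> real i"
        using that by simp
      then show ?thesis
        using ka [of i] that by auto
    qed (use Hx(2) [OF x, of i] ka [of i] that in auto)
    show "\<not> (real i < kap (?H x) \<and> kap (?H x) < real i + 1)" if "N \<le> i \<and> i < Suc m" for i
      using cases
    proof (elim disjE conjE exE)
      assume "?H x = H x" "\<not> (real m < kap (H x) \<and> kap (H x) < real m + 1)"
      then show ?thesis
        using Hx(3) [OF x, of i] that by (cases "i = m") auto
    next
      fix l assume "kap (?H x) = real l"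
      then show ?thesis
        using int by simp
    qed auto
    show "?H x = h x" if "h x \<in> Y1"
      using Hx(4) [OF x that] puncture_Y1 [OF m1 am that] by simp
  qed
qed

text \<open>If infinitely many punctures were hit, a convergent subsequence of preimages in the
  compact set would be carried to a convergent subsequence of \<open>z\<close>.\<close>

lemma HA_homotopy_misses:
  fixes z :: "nat \<Rightarrow> pt" and h :: "real \<times> real \<Rightarrow> pt"
  assumes z: "\<not> (\<exists>p r. strict_mono r \<and> limitin T (z \<circ> r) p sequentially)"
    and S: "compact (S :: (real \<times> real) set)" and h: "continuous_map (top_of_set S) T h"
  obtains N where "N \<ge> 1" "\<And>n. n \<ge> N \<Longrightarrow> z n \<notin> h ` S"
proof -
  have "finite {n. z n \<in> h ` S}"
  proof (rule ccontr)
    assume "infinite {n. z n \<in> h ` S}"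
    then obtain r :: "nat \<Rightarrow> nat" where r: "strict_mono r" "\<And>k. r k \<in> {n. z n \<in> h ` S}"
      using infinite_enumerate by blast
    have "\<exists>q. q \<in> S \<and> z (r k) = h q" for k
      using r(2) [of k] by blast
    then obtain q where q: "\<And>k. q k \<in> S \<and> z (r k) = h (q k)"
      using choice [of "\<lambda>k q. q \<in> S \<and> z (r k) = h q"] by blast
    obtain l s where l: "l \<in> S" "strict_mono s" "(q \<circ> s) \<longlonglongrightarrow> l"
      using S q unfolding compact_eq_seq_compact_metric seq_compact_def by metis
    have "limitin (top_of_set S) (q \<circ> s) l sequentially"
      using l q by (simp add: limitin_subtopology)
    then have "limitin T (h \<circ> (q \<circ> s)) (h l) sequentially"
      by (rule continuous_map_limit [OF h])
    moreover have "h \<circ> (q \<circ> s) = z \<circ> (r \<circ> s)"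
      using q by auto
    ultimately show False
      using z strict_mono_o [OF r(1) l(2)] by metis
  qed
  then obtain N where N: "\<forall>n\<in>{n. z n \<in> h ` S}. n \<le> N"
    unfolding finite_nat_set_iff_bounded_le ..
  show ?thesis
  proof (rule that)
    show "z n \<notin> h ` S" if "n \<ge> Suc N" for n
      using N that by auto
  qed simp
qed

text \<open>The annuli below \<open>N\<close> may still be occupied, and \<open>squash N\<close>
  sends them to circle \<open>N\<close>; those from \<open>N\<close> to \<open>n\<close> are empty
  by the gap hypothesis, and everything from \<open>n + 1\<close> on is killed by
  \<open>cut n\<close>.\<close>

lemma squash_cut_in_Y1:
  assumes N: "1 \<le> N" "N \<le> n" and p: "p \<in> HA_set"
    and gap: "\<And>i. N \<le> i \<Longrightarrow> i \<le> n \<Longrightarrow> \<not> (real i < kap p \<and> kap p < real i + 1)"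
  shows "squash N (cut n p) \<in> Y1"
proof (cases "p = 0 \<or> real n + 1 \<le> kap p")
  case True
  then show ?thesis
    by (auto simp: cut_eq)
next
  case False
  then have k: "p \<noteq> 0" "1 \<le> kap p" "kap p < real n + 1"
    using p by (auto simp: HA_set_iff)
  have le: "kap p \<le> real n"
    using gap [of n] N k by auto
  have "\<exists>i\<ge>1. max (real N) (kap p) = real i"
  proof (cases "kap p \<le> real N")
    case False
    define i where "i = nat \<lfloor>kap p\<rfloor>"
    have i: "real i \<le> kap p" "kap p < real i + 1"
      using k by (auto simp: i_def of_nat_nat)
    then have "N \<le> i" "i \<le> n"
      using False le by linarith+
    then have "kap p = real i"
      using gap [of i] i by auto
    then show ?thesis
      using False N \<open>N \<le> i\<close> by auto
  qed (use N in auto)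
  then have "squash N p \<in> Y1"
    using kap_squash [OF N(1) k(1,2)] by (auto simp: Y1_iff)
  then show ?thesis
    using le by (simp add: cut_eq)
qed

text \<open>The segment lies on the ray through \<open>p\<close>. Along it \<open>kap\<close> grows
  from \<open>kap p\<close> to at most \<open>N\<close>, so only the first annuli are
  crossed.\<close>

lemma closed_segment_squash:
  assumes N: "N \<ge> 1" and p: "p \<in> Y1"
  shows "closed_segment p (squash N p) \<subseteq> Yup N"
proof
  fix q assume "q \<in> closed_segment p (squash N p)"
  then obtain u where u: "0 \<le> u" "u \<le> 1" "q = (1 - u) *\<^sub>R p + u *\<^sub>R squash N p"
    by (auto simp: in_segment)
  show "q \<in> Yup N"
  proof (cases "p = 0 \<or> real N \<le> kap p")
    case True
    then have "squash N p = p"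
      using N by (auto simp: squash_def)
    then have "q = p"
      using u by (simp add: algebra_simps)
    then show ?thesis
      using p Yup_iff [OF N] by simp
  next
    case False
    then have k: "p \<noteq> 0" "1 \<le> kap p" "kap p < real N"
      using kap_idx [OF p] idx_pos [OF p] by auto
    define d where "d = (1 - u) + u * (kap p / real N)"
    have q: "q = d *\<^sub>R p"
      using u k N by (simp add: d_def squash_def algebra_simps)
    have "kap p / real N \<le> 1" "0 < kap p / real N"
      using k N by auto
    then have "0 \<le> (1 - u) * (1 - kap p / real N)" "0 \<le> u * (1 - kap p / real N)"
      using u by (intro mult_nonneg_nonneg; simp)+
    then have d: "kap p / real N \<le> d" "d \<le> 1"
      unfolding d_def left_diff_distrib right_diff_distrib by linarith+
    then have d0: "d > 0"
      using \<open>0 < kap p / real N\<close> by linarith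
    have "kap q = kap p / d"
      unfolding q using d0 by (intro kap_scaleR) auto
    moreover have "kap p \<le> kap p / d" "kap p / d \<le> real N"
      using d d0 k N by (auto simp: field_simps mult_left_le)
    ultimately show ?thesis
      using k Yup_iff [OF N, of q] by simp
  qed
qed

theorem theorem7:
  fixes T :: "pt topology" and \<gamma> :: "real \<Rightarrow> pt"
  assumes "HA_topology T"
    and "path \<gamma>" and "path_image \<gamma> \<subseteq> Y1"
    and "pathstart \<gamma> = (0, 0)" and "pathfinish \<gamma> = (0, 0)"
  shows "homotopic_with (\<lambda>h. h 0 = (0, 0) \<and> h 1 = (0, 0))
            (top_of_set {0..1}) T \<gamma> (\<lambda>_. (0, 0))
         \<longleftrightarrow> (\<exists>N\<ge>1. \<forall>n\<ge>N. red (collapse N (word_of n \<gamma>)) = [])"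
    (is "?null \<longleftrightarrow> ?words")
proof -
  have \<gamma>: "path \<gamma>" "path_image \<gamma> \<subseteq> Y1" "pathstart \<gamma> = 0" "pathfinish \<gamma> = 0"
    using assms by (simp_all add: zero_prod_def)
  have sub: "\<And>n. n \<ge> 1 \<Longrightarrow> subtopology T (Yup n) = top_of_set (Yup n)" and topT: "topspace T = HA_set"
    using assms(1) by (auto simp: HA_topology_def)
  let ?Q = "{0..1::real} \<times> {0..1::real}"
  show ?thesis
  proof
    assume ?null
    then obtain h where h: "continuous_map (prod_topology (top_of_set {0..1}) (top_of_set {0..1})) T h"
      and h01: "\<And>x. h (0, x) = \<gamma> x" "\<And>x. h (1, x) = 0"
      and hends: "\<And>t. t \<in> {0..1::real} \<Longrightarrow> h (t, 0) = 0 \<and> h (t, 1) = 0"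
      unfolding homotopic_with_def zero_prod_def by auto
    have h: "continuous_map (top_of_set ?Q) T h"
      using h by simp
    have im: "h ` ?Q \<subseteq> HA_set"
      using continuous_map_image_subset_topspace [OF h] topT by auto
    \<comment> \<open>The square is metrizable, so sequences suffice here, and about sequences in
      \<open>T\<close> enough is known.\<close>
    have cont: "continuous_on ?Q h"
      unfolding continuous_on_sequentially
    proof (intro allI ballI impI, elim conjE)
      fix x a assume a: "a \<in> ?Q" and x: "\<forall>n. x n \<in> ?Q" "x \<longlonglongrightarrow> a"
      have "limitin (top_of_set ?Q) x a sequentially"
        using a x by (simp add: limitin_subtopology)
      then have "limitin T (h \<circ> x) (h a) sequentially"
        by (rule continuous_map_limit [OF h])
      then show "(h \<circ> x) \<longlonglongrightarrow> h a"
        by (rule limitin_HA_imp_tendsto [OF assms(1)]) (use im x in auto)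
    qed
    obtain z where z: "\<And>n. n \<ge> 1 \<Longrightarrow> z n \<in> intAn n"
      and "\<not> (\<exists>p r. strict_mono r \<and> limitin T (z \<circ> r) p sequentially)"
      using assms(1) unfolding HA_topology_def by blast
    then obtain N where N: "N \<ge> 1" "\<And>n. n \<ge> N \<Longrightarrow> z n \<notin> h ` ?Q"
      using HA_homotopy_misses [OF _ compact_Times [OF compact_Icc compact_Icc] h] by blast
    have "red (collapse N (word_of n \<gamma>)) = []" if n: "n \<ge> N" for n
    proof -
      have n1: "n \<ge> 1" using N n by simp
      \<comment> \<open>Pushing up to \<open>Suc n\<close> clears annulus \<open>n\<close> as well,
        across which \<open>cut n\<close> interpolates.\<close>
      obtain H where H: "continuous_on ?Q H" and Hx: "\<And>x. x \<in> ?Q \<Longrightarrow> H x \<in> HA_set"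
        "\<And>x i. x \<in> ?Q \<Longrightarrow> N \<le> i \<Longrightarrow> i < Suc n \<Longrightarrow> \<not> (real i < kap (H x) \<and> kap (H x) < real i + 1)"
        "\<And>x. x \<in> ?Q \<Longrightarrow> h x \<in> Y1 \<Longrightarrow> H x = h x"
        using push_off_punctures [OF cont im N(1), of z "Suc n"] z N n by (auto simp del: not_less)
      let ?F = "\<lambda>x. squash N (cut n (H x))"
      have FY: "?F x \<in> Y1" if "x \<in> ?Q" for x
        using Hx(1,2) [OF that] by (intro squash_cut_in_Y1 [OF N(1) n]) auto
      have nonneg: "0 \<le> kap (cut n p)" if "p \<in> HA_set" for p
      proof -
        have "0 \<le> kap p"
          using that by (auto simp: HA_set_iff)
        then show ?thesis
          by (cases "max 0 (min 1 (real n + 1 - kap p)) = 0") (simp_all add: cut_def kap_scaleR)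
      qed
      have contF: "continuous_on ?Q ?F"
      proof (rule continuous_on_compose2 [OF continuous_on_squash [OF subset_refl]])
        show "continuous_on ?Q (\<lambda>x. cut n (H x))"
          by (rule continuous_on_compose2 [OF continuous_on_cut [of UNIV] H]) simp
        show "(\<lambda>x. cut n (H x)) ` ?Q \<subseteq> {p. 0 \<le> kap p}"
          by (rule image_subsetI) (simp only: mem_Collect_eq nonneg [OF Hx(1)])
      qed
      \<comment> \<open>The loop lies in \<open>Y1\<close>, so the pushing leaves it alone and
        \<open>cut n\<close> acts on it as \<open>retr n\<close>.\<close>
      have F0: "?F (0, t) = (squash N \<circ> (retr n \<circ> \<gamma>)) t" if "t \<in> {0..1}" for t
        using Hx(3) [of "(0, t)"] h01 path_Y1D [OF \<gamma>(2)] retr_eq_cut n1 that by simp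
      have Fz: "?F x = 0" if "x \<in> ?Q" "h x = 0" for x
        using Hx(3) [OF that(1)] that(2) by simp
      have "homotopic_paths Y1 (squash N \<circ> (retr n \<circ> \<gamma>)) (\<lambda>_. 0)"
        unfolding homotopic_paths
      proof (intro exI conjI ballI)
        show "continuous_on ?Q ?F" by (rule contF)
        show "?F \<in> ?Q \<rightarrow> Y1" using FY by auto
        fix t :: real assume t: "t \<in> {0..1}"
        show "?F (0, t) = (squash N \<circ> (retr n \<circ> \<gamma>)) t" by (rule F0 [OF t])
        show "?F (1, t) = 0" by (rule Fz) (use t h01 in auto)
        have "retr n 0 = 0"
          using retr_eq_cut [of 0 n] n1 by simp
        then have "(squash N \<circ> (retr n \<circ> \<gamma>)) 0 = 0" "(squash N \<circ> (retr n \<circ> \<gamma>)) 1 = 0"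
          using \<gamma>(3,4) by (simp_all add: pathstart_def pathfinish_def)
        moreover have "?F (t, 0) = 0" "?F (t, 1) = 0"
          using Fz [of "(t, 0)"] Fz [of "(t, 1)"] t hends by auto
        ultimately show "pathstart (?F \<circ> Pair t) = pathstart (squash N \<circ> (retr n \<circ> \<gamma>))"
          "pathfinish (?F \<circ> Pair t) = pathfinish (squash N \<circ> (retr n \<circ> \<gamma>))"
          by (simp_all add: pathstart_def pathfinish_def)
      qed
      then have "hol n (squash N \<circ> (retr n \<circ> \<gamma>)) = hol n (\<lambda>_. 0)"
        by (rule homotopic_paths_hol_eq)
      then show ?thesis
        using hol_squash(2) [OF \<gamma> N(1) n] word_of_eq_hol [OF \<gamma> n1] by (simp add: hol_const)
    qed
    then show ?words
      using N(1) by blast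
  next
    assume ?words
    then obtain N where N: "N \<ge> 1" "\<And>n. n \<ge> N \<Longrightarrow> red (collapse N (word_of n \<gamma>)) = []"
      by blast
    let ?\<delta> = "squash N \<circ> \<gamma>"
    have \<delta>: "path ?\<delta>" "path_image ?\<delta> \<subseteq> Y1"
    proof -
      show "path ?\<delta>"
        by (intro path_continuous_image \<gamma>(1) continuous_on_squash) (use \<gamma>(2) Y1_kap_nonneg in blast)
      show "path_image ?\<delta> \<subseteq> Y1"
        unfolding path_image_compose
      proof (rule image_subsetI)
        fix p assume "p \<in> path_image \<gamma>"
        then have "squash N p = 0 \<or> (\<exists>i\<ge>N. kap (squash N p) = real i)"
          using \<gamma>(2) squash_in_Y1 [OF N(1)] by blast
        then show "squash N p \<in> Y1"
          using N(1) unfolding Y1_iff by (meson order_trans)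
      qed
    qed
    have \<delta>01: "?\<delta> 0 = 0" "?\<delta> 1 = 0"
      using \<gamma>(3,4) by (simp_all add: pathstart_def pathfinish_def)
    have Y1N: "Y1 \<subseteq> Yup N"
      using Yup_iff [OF N(1)] by blast
    have "homotopic_paths (path_image ?\<delta>) ?\<delta> (\<lambda>_. 0)"
    proof (rule null_if_hol_Nil [OF \<delta> \<delta>01])
      show "hol n ?\<delta> = []" if "n \<ge> N" for n
        using hol_squash(1) [OF \<gamma> N(1) that] N that word_of_eq_hol [OF \<gamma>] by simp
    qed
    then have "homotopic_paths (Yup N) ?\<delta> (\<lambda>_. 0)"
      using \<delta>(2) Y1N homotopic_paths_subset by blast
    moreover have "homotopic_paths (Yup N) \<gamma> ?\<delta>"
    proof (rule homotopic_paths_linear [OF \<gamma>(1) \<delta>(1)])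
      show "pathstart ?\<delta> = pathstart \<gamma>" "pathfinish ?\<delta> = pathfinish \<gamma>"
        using \<delta>01 \<gamma>(3,4) by (simp_all add: pathstart_def pathfinish_def)
      show "closed_segment (\<gamma> t) (?\<delta> t) \<subseteq> Yup N" if "t \<in> {0..1}" for t
        using closed_segment_squash [OF N(1)] path_Y1D [OF \<gamma>(2)] that by simp
    qed
    ultimately have "homotopic_paths (Yup N) \<gamma> (\<lambda>_. 0)"
      using homotopic_paths_trans by blast
    \<comment> \<open>Here the Euclidean homotopy becomes one in the archipelago: on
      \<open>Yup N\<close> both topologies coincide.\<close>
    then have "homotopic_with (\<lambda>r. pathstart r = pathstart \<gamma> \<and> pathfinish r = pathfinish \<gamma>)
        (top_of_set {0..1}) (subtopology T (Yup N)) \<gamma> (\<lambda>_. 0)"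
      unfolding homotopic_paths_def sub [OF N(1)] .
    then obtain k :: "real \<times> real \<Rightarrow> pt" where
      "continuous_map (prod_topology (top_of_set {0..1}) (top_of_set {0..1})) (subtopology T (Yup N)) k \<and>
       (\<forall>x. k (0, x) = \<gamma> x) \<and> (\<forall>x. k (1, x) = 0) \<and>
       (\<forall>t\<in>{0..1}. pathstart (\<lambda>x. k (t, x)) = pathstart \<gamma> \<and> pathfinish (\<lambda>x. k (t, x)) = pathfinish \<gamma>)"
      unfolding homotopic_with_def ..
    note k = conjunct1 [OF this] conjunct1 [OF conjunct2 [OF this]]
      conjunct1 [OF conjunct2 [OF conjunct2 [OF this]]] conjunct2 [OF conjunct2 [OF conjunct2 [OF this]]]
    show ?null
      unfolding homotopic_with_def zero_prod_def [symmetric]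
    proof (intro exI [of _ k] conjI)
      show "continuous_map (prod_topology (top_of_set {0..1}) (top_of_set {0..1})) T k"
        using k(1) by (rule continuous_map_into_fulltopology)
      show "\<forall>t\<in>{0..1}. k (t, 0) = 0 \<and> k (t, 1) = 0"
        using k(4) \<gamma>(3,4) by (simp add: pathstart_def pathfinish_def)
    qed (fact k(2), fact k(3))
  qed
qed

end
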